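(* Let $U_0\subset\mathbb{R}^n$ be a domain, let $D\subset U_0\times\mathbb{R}^m$ be a strictly convex family of bounded domains (with connected fibers) over $U_0$, and let $(F,g^F)$ be a trivial Riemannian vector bundle of finite rank $r$ defined on some neighborhood of $\overline D$. Let $\{e_1,\dots,e_r\}$ be the canonical frame of $F$. For $t\in U_0$ set $E_t:=\mathbb{R}^r$ with inner product $$g^E_t(u,v):=\int_{D_t}\sum_{\lambda,\mu=1}^r u_\lambda v_\mu\,g^F_{(t,x)}(e_\lambda,e_\mu)\,d\lambda(x),\qquad u=(u_1,\dots,u_r),\ v=(v_1,\dots,v_r)\in E_t.$$ Let $E:=\bigcup_{t\in U_0}E_t$, viewed as a (trivial) Riemannian vector bundle over $U_0$. If $(F,g^F)$ is Nakano positive on some neighborhood of $\overline D$, then the curvature of $(E,g^E)$ is strictly positive in the sense of Nakano.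
   Context: A domain is a connected open set; $d\lambda$ is Lebesgue measure; metrics on vector bundles are of class $C^2$. Families: a family of bounded domains of dimension $m$ over $U_0$ is a domain $D\subset U_0\times\mathbb{R}^m$ whose image under the projection $p:\mathbb{R}^n\times\mathbb{R}^m\to\mathbb{R}^n$ is $U_0$ and all of whose fibers $D_t:=\{x\in\mathbb{R}^m:(t,x)\in D\}$ $(t\in U_0)$ are bounded. It has $C^2$ boundary if there is a $C^2$ function $\rho$ on $U_0\times\mathbb{R}^m$ (a defining function) with $D=\{(t,x)\in U_0\times\mathbb{R}^m:\rho(t,x)<0\}$ and such that for each $t\in U_0$ the differential of $x\mapsto\rho(t,x)$ is nonzero on $\partial D_t$. It is strictly convex if it admits a $C^2$ defining function that is strictly convex on some neighborhood of $\overline D$, where a $C^2$ function is strictly convex if its real Hessian is positive definite everywhere. Curvature: for a $C^2$ Riemannian metric $g$ on the trivial bundle $E=D'\times\mathbb{R}^r$ over an open set $D'\subset\mathbb{R}^N$ with coordinates $s^1,\dots,s^N$ ($g$ viewed as a function with values in positive definite symmetric $r\times r$ matrices), put $\Theta^{(E,g)}_{jk}:=-\frac{\partial}{\partial s^k}\left(g^{-1}\frac{\partial g}{\partial s^j}\right)$, $1\le j,k\le N$ (entrywise differentiation). The curvature of $(E,g)$ is positive (resp. strictly positive) in the sense of Nakano if at every point $s$ and for every nonzero $N$-tuple $(u_1,\dots,u_N)$ of vectors in $E_s=\mathbb{R}^r$, $\sum_{j,k=1}^N g(\Theta^{(E,g)}_{jk}u_j,u_k)\ge0$ (resp. $>0$).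 *)

theory Defs
  imports "HOL-Analysis.Analysis"
begin

text \<open>
  Coordinates on a Euclidean space \<^typ>\<open>'a\<close> are taken with respect to its standard orthonormal
  basis \<^term>\<open>Basis\<close>, so indices \<open>j, k\<close> range over \<^term>\<open>Basis\<close>.  For
  \<^typ>\<open>(real ^ 'n) \<times> (real ^ 'm)\<close> this is the usual basis of \<open>\<real>\<^sup>n \<times> \<real>\<^sup>m\<close>.
\<close>

definition partial_deriv ::
    "'a::euclidean_space \<Rightarrow> ('a \<Rightarrow> 'b::real_normed_vector) \<Rightarrow> 'a \<Rightarrow> 'b" where
  "partial_deriv j f s = vector_derivative (\<lambda>h. f (s + h *\<^sub>R j)) (at 0)"

text \<open>Only meant for open \<open>S\<close>, where \<open>at x\<close> and \<open>at x within S\<close> agree.\<close>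

definition C2_on ::
    "'a::euclidean_space set \<Rightarrow> ('a \<Rightarrow> 'b::real_normed_vector) \<Rightarrow> bool" where
  "C2_on S f \<longleftrightarrow>
     (\<exists>(f' :: 'a \<Rightarrow> 'a \<Rightarrow>\<^sub>L 'b) (f'' :: 'a \<Rightarrow> 'a \<Rightarrow>\<^sub>L 'a \<Rightarrow>\<^sub>L 'b).
        (\<forall>x\<in>S. (f has_derivative blinfun_apply (f' x)) (at x)) \<and>
        (\<forall>x\<in>S. (f' has_derivative blinfun_apply (f'' x)) (at x)) \<and>
        continuous_on S f'')"

definition hessian_pos_def :: "('a::euclidean_space \<Rightarrow> real) \<Rightarrow> 'a \<Rightarrow> bool" where
  "hessian_pos_def f s \<longleftrightarrow>
     (\<forall>v. v \<noteq> 0 \<longrightarrow>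
        (\<Sum>j\<in>Basis. \<Sum>k\<in>Basis.
           (v \<bullet> j) * (v \<bullet> k) * partial_deriv k (partial_deriv j f) s) > 0)"


subsection \<open>Families of bounded domains\<close>

definition fiber :: "('a \<times> 'b) set \<Rightarrow> 'a \<Rightarrow> 'b set" where
  "fiber D t = {x. (t, x) \<in> D}"

definition bounded_domain_family ::
    "(real ^ 'n) set \<Rightarrow> ((real ^ 'n) \<times> (real ^ 'm)) set \<Rightarrow> bool" where
  "bounded_domain_family U\<^sub>0 D \<longleftrightarrow>
     open D \<and> connected D \<and> D \<subseteq> U\<^sub>0 \<times> UNIV \<and> fst ` D = U\<^sub>0 \<and>
     (\<forall>t\<in>U\<^sub>0. bounded (fiber D t))"

definition defining_function ::
    "(real ^ 'n) set \<Rightarrow> ((real ^ 'n) \<times> (real ^ 'm)) set \<Rightarrow>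
     ((real ^ 'n) \<times> (real ^ 'm) \<Rightarrow> real) \<Rightarrow> bool" where
  "defining_function U\<^sub>0 D \<rho> \<longleftrightarrow>
     C2_on (U\<^sub>0 \<times> UNIV) \<rho> \<and>
     D = {(t, x). t \<in> U\<^sub>0 \<and> \<rho> (t, x) < 0} \<and>
     (\<forall>t\<in>U\<^sub>0. \<forall>x\<in>frontier (fiber D t).
        frechet_derivative (\<lambda>y. \<rho> (t, y)) (at x) \<noteq> (\<lambda>_. 0))"

text \<open>
  The ambient space of a family over \<open>U\<^sub>0\<close> is \<open>U\<^sub>0 \<times> \<real>\<^sup>m\<close>, so its closure is the closure relative
  to \<open>U\<^sub>0 \<times> \<real>\<^sup>m\<close>.  Open sets containing the closure of \<open>D\<close> in \<open>\<real>\<^sup>n \<times> \<real>\<^sup>m\<close> are neighborhoods in this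
  sense too.
\<close>

definition closure_neighborhood ::
    "(real ^ 'n) set \<Rightarrow> ((real ^ 'n) \<times> (real ^ 'm)) set \<Rightarrow>
     ((real ^ 'n) \<times> (real ^ 'm)) set \<Rightarrow> bool" where
  "closure_neighborhood U\<^sub>0 D W \<longleftrightarrow> open W \<and> closure D \<inter> (U\<^sub>0 \<times> UNIV) \<subseteq> W"

definition strictly_convex_family ::
    "(real ^ 'n) set \<Rightarrow> ((real ^ 'n) \<times> (real ^ 'm)) set \<Rightarrow> bool" where
  "strictly_convex_family U\<^sub>0 D \<longleftrightarrow>
     bounded_domain_family U\<^sub>0 D \<and>
     (\<exists>\<rho> V. defining_function U\<^sub>0 D \<rho> \<and>
        closure_neighborhood U\<^sub>0 D V \<and> V \<subseteq> U\<^sub>0 \<times> UNIV \<and>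
        (\<forall>s\<in>V. hessian_pos_def \<rho> s))"


subsection \<open>Riemannian metrics on trivial bundles and Nakano positivity\<close>

text \<open>
  A metric on the trivial bundle of rank \<open>r\<close> over \<open>S\<close> is given by its Gram matrices
  \<open>g s $ \<kappa> $ \<mu> = g\<^sub>s(e\<^sub>\<kappa>, e\<^sub>\<mu>)\<close> in the canonical frame; values outside \<open>S\<close> are irrelevant.
\<close>

definition riemannian_metric_on ::
    "'a::euclidean_space set \<Rightarrow> ('a \<Rightarrow> real ^ 'r ^ 'r) \<Rightarrow> bool" where
  "riemannian_metric_on S g \<longleftrightarrow>
     C2_on S g \<and>
     (\<forall>s\<in>S. transpose (g s) = g s \<and> (\<forall>u. u \<noteq> 0 \<longrightarrow> (g s *v u) \<bullet> u > 0))"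

definition curvature ::
    "('a::euclidean_space \<Rightarrow> real ^ 'r ^ 'r) \<Rightarrow> 'a \<Rightarrow> 'a \<Rightarrow> 'a \<Rightarrow> real ^ 'r ^ 'r" where
  "curvature g j k s =
     - partial_deriv k (\<lambda>s'. matrix_inv (g s') ** partial_deriv j g s') s"

text \<open>The sum of \<open>g(\<Theta>\<^sub>j\<^sub>k u\<^sub>j, u\<^sub>k)\<close> over all \<open>j, k\<close>; only the values of \<open>u\<close> on \<^term>\<open>Basis\<close> matter.\<close>

definition nakano_form ::
    "('a::euclidean_space \<Rightarrow> real ^ 'r ^ 'r) \<Rightarrow> 'a \<Rightarrow> ('a \<Rightarrow> real ^ 'r) \<Rightarrow> real" where
  "nakano_form g s u =
     (\<Sum>j\<in>Basis. \<Sum>k\<in>Basis. (g s *v (curvature g j k s *v u j)) \<bullet> u k)"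

definition nakano_positive_on ::
    "'a::euclidean_space set \<Rightarrow> ('a \<Rightarrow> real ^ 'r ^ 'r) \<Rightarrow> bool" where
  "nakano_positive_on S g \<longleftrightarrow>
     (\<forall>s\<in>S. \<forall>u. (\<exists>j\<in>Basis. u j \<noteq> 0) \<longrightarrow> nakano_form g s u \<ge> 0)"

definition nakano_strictly_positive_on ::
    "'a::euclidean_space set \<Rightarrow> ('a \<Rightarrow> real ^ 'r ^ 'r) \<Rightarrow> bool" where
  "nakano_strictly_positive_on S g \<longleftrightarrow>
     (\<forall>s\<in>S. \<forall>u. (\<exists>j\<in>Basis. u j \<noteq> 0) \<longrightarrow> nakano_form g s u > 0)"


subsection \<open>The direct image metric\<close>

definition direct_image_inner ::
    "((real ^ 'n) \<times> (real ^ 'm)) set \<Rightarrow> ((real ^ 'n) \<times> (real ^ 'm) \<Rightarrow> real ^ 'r ^ 'r) \<Rightarrow>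
     real ^ 'n \<Rightarrow> real ^ 'r \<Rightarrow> real ^ 'r \<Rightarrow> real" where
  "direct_image_inner D g t u v =
     (LINT x:fiber D t|lborel. (\<Sum>\<kappa>\<in>UNIV. \<Sum>\<mu>\<in>UNIV. u $ \<kappa> * v $ \<mu> * g (t, x) $ \<kappa> $ \<mu>))"

definition direct_image_metric ::
    "((real ^ 'n) \<times> (real ^ 'm)) set \<Rightarrow> ((real ^ 'n) \<times> (real ^ 'm) \<Rightarrow> real ^ 'r ^ 'r) \<Rightarrow>
     real ^ 'n \<Rightarrow> real ^ 'r ^ 'r" where
  "direct_image_metric D g t =
     (\<chi> \<kappa> \<mu>. direct_image_inner D g t (axis \<kappa> 1) (axis \<mu> 1))"

end

theory Submission
  imports Defs
begin

text \<open>
  With \<open>g w = \<Sum>\<^sub>j g\<^sub>j u\<^sub>j\<close>, Nakano positivity of a metric \<open>g\<close> says \<open>\<Sum>\<^sub>j\<^sub>k g\<^sub>j\<^sub>k(u\<^sub>j, u\<^sub>k) \<le> g(w, w)\<close>.  In this form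
  it is inherited by the integral over one real variable \<open>y\<close> on a fixed interval: apply it to \<open>u\<close>
  together with a vector \<open>v(y)\<close> in the integrated direction, where \<open>v\<close> solves a first order
  equation and vanishes at both ends of the interval; all boundary terms disappear.  Iterating over
  the coordinates gives the theorem for metrics with compact fibre support.

  A metric on \<open>D = {\<rho> < 0}\<close> is reduced to this case by multiplying it with \<open>\<chi>\<^sub>n(\<rho>) \<up> 1\<close>, where \<open>\<chi>\<^sub>n\<close> is
  \<open>C\<^sup>2\<close>, vanishes on \<open>[0, \<infinity>)\<close> and has a convex increasing \<open>- ln \<chi>\<^sub>n\<close> on \<open>(-\<infinity>, 0)\<close>.  Integration by parts
  along \<open>\<nabla>\<^sub>x \<rho>\<close> shows that the fibre integrals converge together with their first and second derivatives,
  locally uniformly in \<open>t\<close>, so the direct image is \<open>C\<^sup>2\<close> and Nakano semipositive.  The Hessian of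
  \<open>- ln \<chi>\<^sub>n(\<rho>)\<close> contributes \<open>- \<chi>\<^sub>n'(\<rho>)\<close> times the Hessian of \<open>\<rho>\<close>; in the limit this is a positive mass on
  the boundary of the fibre, which makes the inequality strict.
\<close>

section \<open>Positive definite matrices\<close>

text \<open>Three obstacles shape the argument. Strict inequalities are lost in a limit, so
  positivity is quantitative: \<open>nakano_ge\<close> carries a slack \<kappa>, which is integrated
  together with the metric. The cut-off metric degenerates on the boundary, where it has no inverse;
  hence lines are treated on compact subintervals first, and Nakano positivity is phrased with an
  auxiliary solution w, a form that also survives limits. Finally, the fibres move with t while
  \<rho> and the metric are only C2: two derivatives of the fibre integral bring in \<chi>''(\<rho>)
  against a C1 coefficient and \<chi>'(\<rho>) against continuous ones. One integration by parts
  reduces the former to the latter, and the latter converge because the measures - \<chi>'(\<rho>)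
  dx have bounded mass and polynomials are dense. The same mass, bounded below by integrating by
  parts against a coordinate function, keeps the slack positive in the limit. The constants are
  uniform only over compact sets of t, so all of this is done locally in t.\<close>

lemma bounded_bilinear_matrix_mult:
  "bounded_bilinear ((**) :: real^'k^'l \<Rightarrow> real^'m^'k \<Rightarrow> real^'m^'l)"
proof -
  have "bilinear ((**) :: real^'k^'l \<Rightarrow> real^'m^'k \<Rightarrow> real^'m^'l)"
    unfolding bilinear_def
    by (auto intro!: linearI simp: matrix_add_ldistrib matrix_matrix_mult_def vec_eq_iff
        sum.distrib sum_distrib_left algebra_simps)
  then show ?thesis
    by (simp add: bilinear_conv_bounded_bilinear)
qed

lemma bounded_bilinear_matrix_vector_mult:
  "bounded_bilinear ((*v) :: real^'k^'l \<Rightarrow> real^'k \<Rightarrow> real^'l)"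
proof -
  have "bilinear ((*v) :: real^'k^'l \<Rightarrow> real^'k \<Rightarrow> real^'l)"
    unfolding bilinear_def
    by (auto intro!: linearI simp: matrix_vector_mult_def vec_eq_iff
        sum.distrib sum_distrib_left algebra_simps)
  then show ?thesis
    by (simp add: bilinear_conv_bounded_bilinear)
qed

interpretation mm: bounded_bilinear "(**) :: real^'k^'l \<Rightarrow> real^'m^'k \<Rightarrow> real^'m^'l"
  by (rule bounded_bilinear_matrix_mult)

interpretation mv: bounded_bilinear "(*v) :: real^'k^'l \<Rightarrow> real^'k \<Rightarrow> real^'l"
  by (rule bounded_bilinear_matrix_vector_mult)

lemma inner_symmetric_matrix:
  fixes A :: "real^'r^'r"
  assumes "transpose A = A"
  shows "(A *v u) \<bullet> v = (A *v v) \<bullet> u"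
  by (metis assms dot_lmul_matrix inner_commute vector_transpose_matrix)

definition pos_def :: "real^'r^'r \<Rightarrow> bool" where
  "pos_def A \<longleftrightarrow> transpose A = A \<and> (\<forall>u. u \<noteq> 0 \<longrightarrow> (A *v u) \<bullet> u > 0)"

lemma pos_def_symD: "pos_def A \<Longrightarrow> (A *v u) \<bullet> v = (A *v v) \<bullet> u"
  by (simp add: pos_def_def inner_symmetric_matrix)

lemma pos_def_nonneg: "pos_def A \<Longrightarrow> (A *v u) \<bullet> u \<ge> 0"
  by (cases "u = 0") (auto simp: pos_def_def less_imp_le mv.zero_right)

lemma pos_def_invertible: "pos_def A \<Longrightarrow> invertible A"
  by (metis pos_def_def inner_zero_left invertible_left_inverse less_irrefl matrix_left_invertible_ker)

lemma
  fixes A :: "real^'r^'r"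
  assumes "invertible A"
  shows matrix_inv_right: "A ** matrix_inv A = mat 1"
    and matrix_inv_left: "matrix_inv A ** A = mat 1"
proof -
  have "A ** matrix_inv A = mat 1 \<and> matrix_inv A ** A = mat 1"
    using someI_ex[OF assms[unfolded invertible_def]] unfolding matrix_inv_def by blast
  then show "A ** matrix_inv A = mat 1" "matrix_inv A ** A = mat 1" by auto
qed

lemma matrix_inv_mult_vector:
  fixes A :: "real^'r^'r"
  assumes "invertible A"
  shows "A *v (matrix_inv A *v u) = u" "matrix_inv A *v (A *v u) = u"
  by (simp_all add: matrix_vector_mul_assoc matrix_inv_right matrix_inv_left assms)

lemma matrix_inv_diff:
  fixes A B :: "real^'r^'r"
  assumes "invertible A" "invertible B"
  shows "matrix_inv B - matrix_inv A = matrix_inv B ** (A - B) ** matrix_inv A"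
proof -
  have "matrix_inv B ** (A - B) ** matrix_inv A
      = matrix_inv B ** (A ** matrix_inv A) - (matrix_inv B ** B) ** matrix_inv A"
    by (simp add: mm.diff_left mm.diff_right matrix_mul_assoc)
  then show ?thesis
    by (simp add: matrix_inv_left matrix_inv_right assms)
qed

text \<open>By \<open>matrix_inv_diff\<close> the error is at most the norm of
  \<open>matrix_inv (f x)\<close> times a factor tending to 0. Once that factor is below 1/2, the
  norm is at most twice that of \<open>matrix_inv A\<close>, so the factor multiplies a bounded
  quantity.\<close>

lemma tendsto_matrix_inv:
  fixes f :: "'a \<Rightarrow> real^'r^'r"
  assumes f: "(f \<longlongrightarrow> A) F" and A: "invertible A" and ev: "\<forall>\<^sub>F x in F. invertible (f x)"
  shows "((\<lambda>x. matrix_inv (f x)) \<longlongrightarrow> matrix_inv A) F"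
proof -
  let ?X = "matrix_inv A"
  obtain K where K: "K > 0" "\<And>(P::real^'r^'r) (Q::real^'r^'r). norm (P ** Q) \<le> norm P * norm Q * K"
    using mm.pos_bounded by blast
  have diff: "norm (matrix_inv B - ?X) \<le> norm (matrix_inv B) * norm (A - B) * norm ?X * K\<^sup>2"
    if "invertible B" for B
  proof -
    have "norm (matrix_inv B - ?X) \<le> norm (matrix_inv B ** (A - B)) * norm ?X * K"
      unfolding matrix_inv_diff[OF A that] by (rule K)
    also have "\<dots> \<le> (norm (matrix_inv B) * norm (A - B) * K) * norm ?X * K"
      by (intro mult_right_mono K) (use K in auto)
    finally show ?thesis by (simp add: power2_eq_square algebra_simps)
  qed
  have lim0: "((\<lambda>x. norm (A - f x) * (norm ?X * K\<^sup>2)) \<longlongrightarrow> 0) F"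
    using tendsto_mult_left_zero[OF tendsto_norm_zero[OF tendsto_diff[OF tendsto_const[of A] f, simplified]]]
    by simp
  have ev2: "\<forall>\<^sub>F x in F. norm (A - f x) * (norm ?X * K\<^sup>2) < 1/2"
    using order_tendstoD(2)[OF lim0, of "1/2"] by simp
  have "\<forall>\<^sub>F x in F. norm (matrix_inv (f x) - ?X) \<le> 2 * norm ?X * (norm (A - f x) * (norm ?X * K\<^sup>2))"
    using ev ev2
  proof eventually_elim
    case (elim x)
    let ?\<delta> = "norm (A - f x) * (norm ?X * K\<^sup>2)"
    have d: "norm (matrix_inv (f x) - ?X) \<le> norm (matrix_inv (f x)) * ?\<delta>"
      using diff[OF elim(1)] by (simp add: algebra_simps)
    have "norm (matrix_inv (f x)) \<le> norm ?X + norm (matrix_inv (f x) - ?X)"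
      by (metis add.commute diff_add_cancel norm_triangle_ineq)
    moreover have "norm (matrix_inv (f x)) * ?\<delta> \<le> norm (matrix_inv (f x)) * (1/2)"
      by (rule mult_left_mono) (use elim in auto)
    ultimately have "norm (matrix_inv (f x)) \<le> 2 * norm ?X"
      using d by linarith
    then have "norm (matrix_inv (f x)) * ?\<delta> \<le> 2 * norm ?X * ?\<delta>"
      by (rule mult_right_mono) auto
    with d show ?case by linarith
  qed
  then have "((\<lambda>x. matrix_inv (f x) - ?X) \<longlongrightarrow> 0) F"
    by (rule Lim_null_comparison) (use tendsto_mult_right_zero[OF lim0] in simp)
  then show ?thesis by (simp add: LIM_zero_iff)
qed

lemma has_vector_derivative_slope_iff:
  fixes f :: "real \<Rightarrow> 'a::real_normed_vector"
  shows "(f has_vector_derivative D) (at y within T) \<longleftrightarrow>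
    ((\<lambda>x. (f x - f y) /\<^sub>R (x - y)) \<longlongrightarrow> D) (at y within T)"
proof -
  have eq: "norm (f x - f y - (x - y) *\<^sub>R D) / norm (x - y) = norm ((f x - f y) /\<^sub>R (x - y) - D)"
    if "x \<noteq> y" for x
  proof -
    have "(f x - f y) /\<^sub>R (x - y) - D = (f x - f y - (x - y) *\<^sub>R D) /\<^sub>R (x - y)"
      using that by (simp add: scaleR_diff_right)
    then show ?thesis
      by (simp add: divide_inverse_commute)
  qed
  have "(f has_vector_derivative D) (at y within T) \<longleftrightarrow>
    ((\<lambda>x. norm (f x - f y - (x - y) *\<^sub>R D) / norm (x - y)) \<longlongrightarrow> 0) (at y within T)"
    unfolding has_vector_derivative_def has_derivative_iff_norm
    by (simp add: bounded_linear_scaleR_left)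
  also have "\<dots> \<longleftrightarrow> ((\<lambda>x. norm ((f x - f y) /\<^sub>R (x - y) - D)) \<longlongrightarrow> 0) (at y within T)"
    by (rule Lim_cong_within) (use eq in auto)
  finally show ?thesis
    by (simp add: tendsto_norm_zero_iff LIM_zero_iff)
qed

text \<open>\<open>matrix_inv_diff\<close> writes the difference quotient of the inverse as minus
  the product of the inverse at x, the quotient of h and the inverse at y; by continuity of
  inversion the limit is taken factor by factor. Working within T admits one-sided derivatives at
  the ends of an interval.\<close>

lemma has_vector_derivative_matrix_inv:
  fixes h :: "real \<Rightarrow> real^'r^'r"
  assumes h: "(h has_vector_derivative h') (at y within T)" and y: "y \<in> T"
    and inv: "\<And>x. x \<in> T \<Longrightarrow> invertible (h x)"
  shows "((\<lambda>x. matrix_inv (h x)) has_vector_derivative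
           - (matrix_inv (h y) ** h' ** matrix_inv (h y))) (at y within T)"
proof -
  have cont: "(h \<longlongrightarrow> h y) (at y within T)"
    using has_vector_derivative_continuous[OF h] by (simp add: continuous_within)
  have ev: "\<forall>\<^sub>F x in at y within T. invertible (h x)"
    using inv by (auto simp: eventually_at_filter)
  have l: "((\<lambda>x. matrix_inv (h x)) \<longlongrightarrow> matrix_inv (h y)) (at y within T)"
    by (rule tendsto_matrix_inv[OF cont inv[OF y] ev])
  have "((\<lambda>x. - (matrix_inv (h x) ** ((h x - h y) /\<^sub>R (x - y)) ** matrix_inv (h y)))
      \<longlongrightarrow> - (matrix_inv (h y) ** h' ** matrix_inv (h y))) (at y within T)"
    using h unfolding has_vector_derivative_slope_iff
    by (intro tendsto_minus mm.tendsto l tendsto_const)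
  moreover have "\<forall>\<^sub>F x in at y within T. - (matrix_inv (h x) ** ((h x - h y) /\<^sub>R (x - y)) ** matrix_inv (h y))
     = (matrix_inv (h x) - matrix_inv (h y)) /\<^sub>R (x - y)"
    using ev
  proof eventually_elim
    case (elim x)
    have "matrix_inv (h x) - matrix_inv (h y) = - (matrix_inv (h x) ** (h x - h y) ** matrix_inv (h y))"
      by (subst matrix_inv_diff[OF inv[OF y] elim])
        (metis minus_diff_eq mm.minus_left mm.minus_right)
    then show ?case
      by (simp add: mm.scaleR_right mm.scaleR_left)
  qed
  ultimately show ?thesis
    unfolding has_vector_derivative_slope_iff by (rule Lim_transform_eventually)
qed

section \<open>Twice continuously differentiable functions in coordinates\<close>

text \<open>The coefficients are named because later they are cut off, integrated and passed to the
  limit one at a time; \<open>q j k\<close> is the derivative of \<open>p j\<close> in direction k.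
  Their values at indices outside \<open>Basis\<close> are unconstrained.\<close>

definition C2_partials ::
  "'a::euclidean_space set \<Rightarrow> ('a \<Rightarrow> 'b::real_normed_vector) \<Rightarrow> ('a \<Rightarrow> 'a \<Rightarrow> 'b) \<Rightarrow> ('a \<Rightarrow> 'a \<Rightarrow> 'a \<Rightarrow> 'b) \<Rightarrow> bool"
  where "C2_partials S f p q \<longleftrightarrow>
    (\<forall>x\<in>S. (f has_derivative (\<lambda>h. \<Sum>j\<in>Basis. (h \<bullet> j) *\<^sub>R p j x)) (at x)) \<and>
    (\<forall>j\<in>Basis. \<forall>x\<in>S. (p j has_derivative (\<lambda>h. \<Sum>k\<in>Basis. (h \<bullet> k) *\<^sub>R q j k x)) (at x)) \<and>
    (\<forall>j\<in>Basis. \<forall>k\<in>Basis. continuous_on S (q j k))"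

lemma C2_partialsD:
  assumes "C2_partials S f p q"
  shows "x \<in> S \<Longrightarrow> (f has_derivative (\<lambda>h. \<Sum>j\<in>Basis. (h \<bullet> j) *\<^sub>R p j x)) (at x)"
    and "x \<in> S \<Longrightarrow> j \<in> Basis \<Longrightarrow> (p j has_derivative (\<lambda>h. \<Sum>k\<in>Basis. (h \<bullet> k) *\<^sub>R q j k x)) (at x)"
    and "j \<in> Basis \<Longrightarrow> k \<in> Basis \<Longrightarrow> continuous_on S (q j k)"
  using assms by (auto simp: C2_partials_def)

lemma C2_partials_continuous:
  assumes "C2_partials S f p q"
  shows "continuous_on S f" "j \<in> Basis \<Longrightarrow> continuous_on S (p j)"
  by (rule has_derivative_continuous_on, rule has_derivative_at_withinI, rule C2_partialsD[OF assms]; assumption)+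

lemma C2_partials_subset: "C2_partials S f p q \<Longrightarrow> T \<subseteq> S \<Longrightarrow> C2_partials T f p q"
  unfolding C2_partials_def by (meson continuous_on_subset in_mono)

lemma sum_Basis_delta:
  fixes f :: "'a::euclidean_space \<Rightarrow> 'b::real_vector"
  assumes "j \<in> Basis"
  shows "(\<Sum>k\<in>Basis. (j \<bullet> k) *\<^sub>R f k) = f j"
proof -
  have "(\<Sum>k\<in>Basis. (j \<bullet> k) *\<^sub>R f k) = (\<Sum>k\<in>Basis. if k = j then f k else 0)"
    using assms by (intro sum.cong) (auto simp: inner_Basis)
  then show ?thesis using assms by simp
qed

lemma has_derivative_line:
  fixes f :: "'a::euclidean_space \<Rightarrow> 'b::real_normed_vector"
  assumes f: "(f has_derivative (\<lambda>h. \<Sum>k\<in>Basis. (h \<bullet> k) *\<^sub>R p k)) (at (a + y *\<^sub>R v))"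
  shows "((\<lambda>y. f (a + y *\<^sub>R v)) has_vector_derivative (\<Sum>k\<in>Basis. (v \<bullet> k) *\<^sub>R p k)) (at y)"
proof -
  have "((\<lambda>y. a + y *\<^sub>R v) has_derivative (\<lambda>h. h *\<^sub>R v)) (at y)"
    by (auto intro!: derivative_eq_intros)
  from has_derivative_compose[OF this f] show ?thesis
    by (simp add: has_vector_derivative_def scaleR_sum_right)
qed

lemma has_derivative_line_Basis:
  fixes f :: "'a::euclidean_space \<Rightarrow> 'b::real_normed_vector"
  assumes "(f has_derivative (\<lambda>h. \<Sum>k\<in>Basis. (h \<bullet> k) *\<^sub>R p k)) (at (a + y *\<^sub>R j))" "j \<in> Basis"
  shows "((\<lambda>y. f (a + y *\<^sub>R j)) has_vector_derivative p j) (at y)"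
  using has_derivative_line[OF assms(1)] sum_Basis_delta[OF assms(2), of p] by simp

lemma partial_deriv_eq:
  assumes f: "(f has_derivative (\<lambda>h. \<Sum>k\<in>Basis. (h \<bullet> k) *\<^sub>R p k)) (at x)" and j: "j \<in> Basis"
  shows "partial_deriv j f x = p j"
  unfolding partial_deriv_def
  by (rule vector_derivative_at) (use has_derivative_line_Basis[OF _ j, of f p x 0] f in simp)

lemma partial_deriv_cong_open:
  assumes "open S" "s \<in> S" "\<And>x. x \<in> S \<Longrightarrow> f x = g x"
  shows "partial_deriv k f s = partial_deriv k g s"
proof -
  have "((\<lambda>h. s + h *\<^sub>R k) \<longlongrightarrow> s + 0 *\<^sub>R k) (nhds 0)"
    by (intro tendsto_intros) (simp add: filterlim_ident)
  then have ev: "\<forall>\<^sub>F h in nhds 0. s + h *\<^sub>R k \<in> S"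
    using topological_tendstoD[OF _ assms(1)] assms(2) by force
  have "(((\<lambda>h. f (s + h *\<^sub>R k)) has_vector_derivative D) (at 0)) =
        (((\<lambda>h. g (s + h *\<^sub>R k)) has_vector_derivative D) (at 0))" for D
    by (rule has_vector_derivative_cong_ev) (use ev assms in \<open>auto elim!: eventually_mono\<close>)
  then show ?thesis
    unfolding partial_deriv_def vector_derivative_def by simp
qed

text \<open>A rank one operator. Being bounded linear in b, it transfers continuity, derivatives and
  integrals of coefficients to the operators assembled from them.\<close>

lift_definition coord_blinfun :: "'a::euclidean_space \<Rightarrow> 'b::real_normed_vector \<Rightarrow> 'a \<Rightarrow>\<^sub>L 'b"
  is "\<lambda>j b h. (h \<bullet> j) *\<^sub>R b"
  by (intro bounded_linear_intros)

lemma bounded_linear_coord_blinfun: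
  assumes "j \<in> Basis"
  shows "bounded_linear (coord_blinfun j)"
proof (rule bounded_linear_intro[where K = 1])
  fix b :: 'b
  show "norm (coord_blinfun j b) \<le> norm b * 1"
  proof (rule norm_blinfun_bound)
    fix h
    have "\<bar>h \<bullet> j\<bar> \<le> norm h" using assms by (rule Basis_le_norm)
    then have "\<bar>h \<bullet> j\<bar> * norm b \<le> norm h * norm b"
      by (rule mult_right_mono) simp
    then show "norm (blinfun_apply (coord_blinfun j b) h) \<le> norm b * 1 * norm h"
      by (simp add: coord_blinfun.rep_eq mult.commute)
  qed simp
qed (auto intro!: blinfun_eqI simp: coord_blinfun.rep_eq blinfun.add_left blinfun.scaleR_left algebra_simps)

text \<open>Forward, the operators are evaluated on basis vectors; backward, they are reassembled
  from \<open>coord_blinfun\<close>. In \<open>q j k\<close> the second index is the direction of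
  the second differentiation, hence the outer argument of \<open>f''\<close>.\<close>

lemma C2_on_iff_partials:
  fixes f :: "'a::euclidean_space \<Rightarrow> 'b::real_normed_vector"
  shows "C2_on S f \<longleftrightarrow> (\<exists>p q. C2_partials S f p q)"
proof
  assume "C2_on S f"
  then obtain f' :: "'a \<Rightarrow> 'a \<Rightarrow>\<^sub>L 'b" and f'' :: "'a \<Rightarrow> 'a \<Rightarrow>\<^sub>L 'a \<Rightarrow>\<^sub>L 'b" where
    1: "\<And>x. x \<in> S \<Longrightarrow> (f has_derivative blinfun_apply (f' x)) (at x)" and
    2: "\<And>x. x \<in> S \<Longrightarrow> (f' has_derivative blinfun_apply (f'' x)) (at x)" and
    3: "continuous_on S f''"
    unfolding C2_on_def by auto
  have rep: "blinfun_apply L h = (\<Sum>j\<in>Basis. (h \<bullet> j) *\<^sub>R blinfun_apply L j)" for L :: "'a \<Rightarrow>\<^sub>L 'c::real_normed_vector" and h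
    by (subst euclidean_representation[of h, symmetric]) (simp only: blinfun.sum_right blinfun.scaleR_right)
  have "C2_partials S f (\<lambda>j x. blinfun_apply (f' x) j) (\<lambda>j k x. blinfun_apply (blinfun_apply (f'' x) k) j)"
    unfolding C2_partials_def
  proof (intro conjI ballI)
    fix x assume x: "x \<in> S"
    have "blinfun_apply (f' x) = (\<lambda>h. \<Sum>j\<in>Basis. (h \<bullet> j) *\<^sub>R blinfun_apply (f' x) j)"
      using rep[of "f' x"] by (intro ext)
    from has_derivative_eq_rhs[OF 1[OF x] this]
    show "(f has_derivative (\<lambda>h. \<Sum>j\<in>Basis. (h \<bullet> j) *\<^sub>R blinfun_apply (f' x) j)) (at x)" .
    fix j :: 'a
    have "((\<lambda>x. blinfun_apply (f' x) j) has_derivative (\<lambda>h. blinfun_apply (blinfun_apply (f'' x) h) j)) (at x)"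
      by (rule bounded_linear.has_derivative[OF blinfun.bounded_linear_left 2[OF x]])
    moreover have "(\<lambda>h. blinfun_apply (blinfun_apply (f'' x) h) j) =
        (\<lambda>h. \<Sum>k\<in>Basis. (h \<bullet> k) *\<^sub>R blinfun_apply (blinfun_apply (f'' x) k) j)"
      by (subst rep[of "f'' x"]) (simp add: blinfun.sum_left blinfun.scaleR_left)
    ultimately show "((\<lambda>x. blinfun_apply (f' x) j) has_derivative
        (\<lambda>h. \<Sum>k\<in>Basis. (h \<bullet> k) *\<^sub>R blinfun_apply (blinfun_apply (f'' x) k) j)) (at x)"
      by (rule has_derivative_eq_rhs)
  next
    fix j k :: 'a
    show "continuous_on S (\<lambda>x. blinfun_apply (blinfun_apply (f'' x) k) j)"
      by (rule bounded_linear.continuous_on[OF blinfun.bounded_linear_left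
            bounded_linear.continuous_on[OF blinfun.bounded_linear_left 3]])
  qed
  then show "\<exists>p q. C2_partials S f p q" by blast
next
  assume "\<exists>p q. C2_partials S f p q"
  then obtain p q where pq: "C2_partials S f p q" by blast
  define f' where "f' x = (\<Sum>j\<in>Basis. coord_blinfun j (p j x))" for x
  define f'' where "f'' x = (\<Sum>k\<in>Basis. coord_blinfun k (\<Sum>j\<in>Basis. coord_blinfun j (q j k x)))" for x
  have "blinfun_apply (f' x) = (\<lambda>h. \<Sum>j\<in>Basis. (h \<bullet> j) *\<^sub>R p j x)" for x
    by (auto simp: f'_def blinfun.sum_left coord_blinfun.rep_eq)
  then have 1: "(f has_derivative blinfun_apply (f' x)) (at x)" if "x \<in> S" for x
    using C2_partialsD(1)[OF pq that] by simp
  have 2: "(f' has_derivative blinfun_apply (f'' x)) (at x)" if x: "x \<in> S" for x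
  proof -
    have "(f' has_derivative (\<lambda>h. \<Sum>j\<in>Basis. coord_blinfun j (\<Sum>k\<in>Basis. (h \<bullet> k) *\<^sub>R q j k x))) (at x)"
      unfolding f'_def
      by (intro has_derivative_sum bounded_linear.has_derivative[OF bounded_linear_coord_blinfun]
          C2_partialsD(2)[OF pq x])
    moreover have "(\<Sum>j\<in>Basis. coord_blinfun j (\<Sum>k\<in>Basis. (h \<bullet> k) *\<^sub>R q j k x)) = blinfun_apply (f'' x) h" for h
    proof (rule blinfun_eqI)
      fix i
      have "blinfun_apply (\<Sum>j\<in>Basis. coord_blinfun j (\<Sum>k\<in>Basis. (h \<bullet> k) *\<^sub>R q j k x)) i
        = (\<Sum>j\<in>Basis. \<Sum>k\<in>Basis. (i \<bullet> j) *\<^sub>R (h \<bullet> k) *\<^sub>R q j k x)"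
        by (simp add: blinfun.sum_left coord_blinfun.rep_eq scaleR_sum_right)
      also have "\<dots> = (\<Sum>k\<in>Basis. \<Sum>j\<in>Basis. (i \<bullet> j) *\<^sub>R (h \<bullet> k) *\<^sub>R q j k x)"
        by (rule sum.swap)
      also have "\<dots> = blinfun_apply (blinfun_apply (f'' x) h) i"
        by (simp add: f''_def blinfun.sum_left coord_blinfun.rep_eq scaleR_sum_right blinfun.scaleR_left mult.commute)
      finally show "blinfun_apply (\<Sum>j\<in>Basis. coord_blinfun j (\<Sum>k\<in>Basis. (h \<bullet> k) *\<^sub>R q j k x)) i
        = blinfun_apply (blinfun_apply (f'' x) h) i" .
    qed
    ultimately show ?thesis by simp
  qed
  have "continuous_on S f''"
    unfolding f''_def
    by (intro continuous_on_sum bounded_linear.continuous_on[OF bounded_linear_coord_blinfun] C2_partialsD(3)[OF pq])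
  with 1 2 show "C2_on S f"
    unfolding C2_on_def by blast
qed

text \<open>\<open>leibniz_rule\<close> asks for one operator-valued derivative; it is assembled
  from the coefficients, and the integral is pulled back inside \<open>coord_blinfun\<close> by
  linearity.\<close>

lemma leibniz_partials:
  fixes f :: "'a::euclidean_space \<Rightarrow> real \<Rightarrow> 'c::banach"
  assumes U: "open U" "convex U"
    and d: "\<And>x y. x \<in> U \<Longrightarrow> y \<in> {a..b} \<Longrightarrow>
      ((\<lambda>x. f x y) has_derivative (\<lambda>h. \<Sum>j\<in>Basis. (h \<bullet> j) *\<^sub>R p j x y)) (at x)"
    and c: "\<And>x. x \<in> U \<Longrightarrow> continuous_on {a..b} (f x)"
    and cp: "\<And>j. j \<in> Basis \<Longrightarrow> continuous_on (U \<times> {a..b}) (\<lambda>(x, y). p j x y)"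
    and x: "x \<in> U"
  shows "((\<lambda>x. integral {a..b} (f x)) has_derivative
      (\<lambda>h. \<Sum>j\<in>Basis. (h \<bullet> j) *\<^sub>R integral {a..b} (p j x))) (at x)"
proof -
  define F where "F x y = (\<Sum>j\<in>Basis. coord_blinfun j (p j x y))" for x y
  have F: "blinfun_apply (F x y) = (\<lambda>h. \<Sum>j\<in>Basis. (h \<bullet> j) *\<^sub>R p j x y)" for x y
    by (auto simp: F_def blinfun.sum_left coord_blinfun.rep_eq)
  have A: "((\<lambda>x. f x y) has_derivative blinfun_apply (F z y)) (at z within U)"
    if "z \<in> U" "y \<in> cbox a b" for z y
    unfolding F using d[of z y] that by (simp add: has_derivative_at_withinI)
  have B: "f z integrable_on cbox a b" if "z \<in> U" for z
    using integrable_continuous_real[OF c[OF that]] by simp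
  have "continuous_on (U \<times> cbox a b) (\<lambda>z. \<Sum>j\<in>Basis. coord_blinfun j ((\<lambda>(x, y). p j x y) z))"
    by (intro continuous_on_sum bounded_linear.continuous_on[OF bounded_linear_coord_blinfun])
      (use cp in simp_all)
  then have C: "continuous_on (U \<times> cbox a b) (\<lambda>(x, y). F x y)"
    by (simp add: F_def case_prod_beta)
  have 1: "((\<lambda>x. integral (cbox a b) (f x)) has_derivative integral (cbox a b) (F x)) (at x within U)"
    by (rule leibniz_rule[OF A B C x U(2)])
  have ci: "p j x integrable_on {a..b}" if "j \<in> Basis" for j
  proof (rule integrable_continuous_real)
    have "continuous_on {a..b} ((\<lambda>(x, y). p j x y) \<circ> (\<lambda>y. (x, y)))"
      by (intro continuous_on_compose continuous_intros continuous_on_subset[OF cp[OF that]])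
        (use x in auto)
    then show "continuous_on {a..b} (p j x)" by (simp add: o_def)
  qed
  have "integral {a..b} (F x) = (\<Sum>j\<in>Basis. coord_blinfun j (integral {a..b} (p j x)))"
  proof -
    have "integral {a..b} (F x) = (\<Sum>j\<in>Basis. integral {a..b} (coord_blinfun j \<circ> p j x))"
      unfolding F_def o_def
      using integrable_linear[OF ci bounded_linear_coord_blinfun]
      by (intro integral_sum) (auto simp: o_def)
    also have "\<dots> = (\<Sum>j\<in>Basis. coord_blinfun j (integral {a..b} (p j x)))"
      by (intro sum.cong refl integral_linear ci bounded_linear_coord_blinfun)
    finally show ?thesis .
  qed
  then have "blinfun_apply (integral (cbox a b) (F x)) = (\<lambda>h. \<Sum>j\<in>Basis. (h \<bullet> j) *\<^sub>R integral {a..b} (p j x))"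
    by (auto simp: blinfun.sum_left coord_blinfun.rep_eq)
  with 1 show ?thesis
    unfolding at_within_open[OF x U(1)] by simp
qed

text \<open>The increment of f in direction k is an integral of \<open>p k\<close>; differentiating
  it in direction j under the integral shows that the increment of \<open>p j\<close> in direction k
  is an integral of \<open>q k j\<close>. Its one-sided derivative at t = 0 compares the two mixed
  derivatives.\<close>

lemma C2_partials_symmetric:
  fixes f :: "'a::euclidean_space \<Rightarrow> 'b::banach"
  assumes f: "C2_partials S f p q" and S: "open S" and x: "x \<in> S" and j: "j \<in> Basis" and k: "k \<in> Basis"
  shows "q j k x = q k j x"
proof -
  obtain e where e: "e > 0" "cball x e \<subseteq> S"
    using S x open_contains_cball by blast
  define r where "r = e / 2"
  have r: "r > 0" using e by (simp add: r_def)
  have inS: "x + s *\<^sub>R j + t *\<^sub>R k \<in> S" if "\<bar>s\<bar> \<le> r" "\<bar>t\<bar> \<le> r" for s t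
  proof -
    have "norm (s *\<^sub>R j + t *\<^sub>R k) \<le> \<bar>s\<bar> + \<bar>t\<bar>"
      using norm_triangle_ineq[of "s *\<^sub>R j" "t *\<^sub>R k"] j k by simp
    also have "\<dots> \<le> e" using that by (simp add: r_def)
    finally have "dist x (x + s *\<^sub>R j + t *\<^sub>R k) \<le> e"
      by (simp add: dist_norm add.assoc norm_minus_commute) (simp add: add.commute)
    with e show ?thesis by auto
  qed
  have D: "((\<lambda>s. g (a + s *\<^sub>R i)) has_vector_derivative g' i (a + s *\<^sub>R i)) (at s within T)"
    if "a + s *\<^sub>R i \<in> S" "i \<in> Basis"
      "\<And>x. x \<in> S \<Longrightarrow> (g has_derivative (\<lambda>h. \<Sum>j\<in>Basis. (h \<bullet> j) *\<^sub>R g' j x)) (at x)"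
    for g :: "'a \<Rightarrow> 'b" and g' a s i T
    by (rule has_vector_derivative_at_within, rule has_derivative_line_Basis[OF that(3)[OF that(1)] that(2)])
  have eq: "p j (x + t *\<^sub>R k) - p j x = integral {0..t} (\<lambda>\<tau>. q k j (x + \<tau> *\<^sub>R k))" if t: "t \<in> {0..r}" for t
  proof -
    let ?U = "{-r<..<r}"
    have F: "f (x + s *\<^sub>R j + t *\<^sub>R k) - f (x + s *\<^sub>R j) = integral {0..t} (\<lambda>\<tau>. p k (x + s *\<^sub>R j + \<tau> *\<^sub>R k))"
      if s: "s \<in> ?U" for s
    proof -
      have "((\<lambda>\<tau>. p k (x + s *\<^sub>R j + \<tau> *\<^sub>R k)) has_integral
         f (x + s *\<^sub>R j + t *\<^sub>R k) - f (x + s *\<^sub>R j + 0 *\<^sub>R k)) {0..t}"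
        using t s by (intro fundamental_theorem_of_calculus D[OF inS k C2_partialsD(1)[OF f]]) auto
      then show ?thesis by (simp add: integral_unique)
    qed
    have cont: "continuous_on A (\<lambda>z. g (c z))"
      if "continuous_on S g" "continuous_on A c" "c ` A \<subseteq> S" for g :: "'a \<Rightarrow> 'b" and c and A :: "'z::topological_space set"
      by (rule continuous_on_compose2[OF that])
    have "((\<lambda>s. integral (cbox 0 t) (\<lambda>\<tau>. p k (x + s *\<^sub>R j + \<tau> *\<^sub>R k))) has_vector_derivative
        integral (cbox 0 t) (\<lambda>\<tau>. q k j (x + 0 *\<^sub>R j + \<tau> *\<^sub>R k))) (at 0 within ?U)"
    proof (rule leibniz_rule_vector_derivative)
      fix s \<tau> assume s: "s \<in> ?U" "\<tau> \<in> cbox 0 t"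
      have "((\<lambda>s. p k ((x + \<tau> *\<^sub>R k) + s *\<^sub>R j)) has_vector_derivative q k j ((x + \<tau> *\<^sub>R k) + s *\<^sub>R j)) (at s within ?U)"
        using inS[of s \<tau>] s t
        by (intro D j C2_partialsD(2)[OF f _ k]) (auto simp: algebra_simps)
      then show "((\<lambda>s. p k (x + s *\<^sub>R j + \<tau> *\<^sub>R k)) has_vector_derivative q k j (x + s *\<^sub>R j + \<tau> *\<^sub>R k)) (at s within ?U)"
        by (simp add: algebra_simps)
    next
      fix s assume "s \<in> ?U"
      then show "(\<lambda>\<tau>. p k (x + s *\<^sub>R j + \<tau> *\<^sub>R k)) integrable_on cbox 0 t"
        using t by (intro integrable_continuous cont[OF C2_partials_continuous(2)[OF f k]] continuous_intros)
          (auto intro!: inS)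
    next
      show "continuous_on (?U \<times> cbox 0 t) (\<lambda>(s, \<tau>). q k j (x + s *\<^sub>R j + \<tau> *\<^sub>R k))"
        unfolding case_prod_beta
        using t by (intro cont[OF C2_partialsD(3)[OF f k j]] continuous_intros) (auto intro!: inS)
    qed (use r in auto)
    then have "((\<lambda>s. integral {0..t} (\<lambda>\<tau>. p k (x + s *\<^sub>R j + \<tau> *\<^sub>R k))) has_vector_derivative
        integral {0..t} (\<lambda>\<tau>. q k j (x + \<tau> *\<^sub>R k))) (at 0)"
      using r by (simp add: at_within_open[of 0 "?U"])
    then have 1: "((\<lambda>s. f (x + s *\<^sub>R j + t *\<^sub>R k) - f (x + s *\<^sub>R j)) has_vector_derivative
        integral {0..t} (\<lambda>\<tau>. q k j (x + \<tau> *\<^sub>R k))) (at 0)"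
      by (rule has_vector_derivative_transform_within_open[where S = "?U"]) (use r F in auto)
    have "((\<lambda>s. f ((x + t *\<^sub>R k) + s *\<^sub>R j)) has_vector_derivative p j ((x + t *\<^sub>R k) + 0 *\<^sub>R j)) (at 0)"
      using inS[of 0 t] t r by (intro D j C2_partialsD(1)[OF f]) auto
    moreover have "((\<lambda>s. f (x + s *\<^sub>R j)) has_vector_derivative p j (x + 0 *\<^sub>R j)) (at 0)"
      using x by (intro D j C2_partialsD(1)[OF f]) auto
    ultimately have "((\<lambda>s. f ((x + t *\<^sub>R k) + s *\<^sub>R j) - f (x + s *\<^sub>R j)) has_vector_derivative
        p j ((x + t *\<^sub>R k) + 0 *\<^sub>R j) - p j (x + 0 *\<^sub>R j)) (at 0)"
      by (rule has_vector_derivative_diff)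
    then have "((\<lambda>s. f (x + s *\<^sub>R j + t *\<^sub>R k) - f (x + s *\<^sub>R j)) has_vector_derivative p j (x + t *\<^sub>R k) - p j x) (at 0)"
      by (simp add: algebra_simps)
    from vector_derivative_unique_at[OF this 1] show ?thesis .
  qed
  have "continuous_on {0..r} (\<lambda>\<tau>. q k j (x + \<tau> *\<^sub>R k))"
    by (rule continuous_on_compose2[OF C2_partialsD(3)[OF f k j]])
      (use inS[of 0] r in \<open>auto intro!: continuous_intros\<close>)
  from integral_has_vector_derivative[OF this, of 0]
  have A: "((\<lambda>t. integral {0..t} (\<lambda>\<tau>. q k j (x + \<tau> *\<^sub>R k))) has_vector_derivative q k j x) (at 0 within {0..r})"
    using r by simp
  have "((\<lambda>t. p j (x + t *\<^sub>R k)) has_vector_derivative q j k (x + 0 *\<^sub>R k)) (at 0 within {0..r})"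
    using x by (intro D k C2_partialsD(2)[OF f _ j]) auto
  then have "((\<lambda>t. p j (x + t *\<^sub>R k) - p j x) has_vector_derivative q j k x) (at 0 within {0..r})"
    by (simp add: has_vector_derivative_diff_const)
  then have B: "((\<lambda>t. integral {0..t} (\<lambda>\<tau>. q k j (x + \<tau> *\<^sub>R k))) has_vector_derivative q j k x) (at 0 within {0..r})"
    by (rule has_vector_derivative_transform[rotated 2]) (use r eq in auto)
  show ?thesis
    by (rule vector_derivative_unique_within[OF _ B A]) (use r in \<open>simp add: trivial_limit_within islimpt_Icc\<close>)
qed

text \<open>Meant for L the transposition, so that derivatives of a symmetric matrix function are
  symmetric: L commutes with differentiation along a line, and L f = f on the part of the line
  inside S.\<close>

lemma partial_linear_fixed:
  fixes f :: "'a::euclidean_space \<Rightarrow> 'b::real_normed_vector"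
  assumes L: "bounded_linear L" and S: "open S" "x \<in> S" and fxd: "\<And>x. x \<in> S \<Longrightarrow> L (f x) = f x"
    and f: "(f has_derivative (\<lambda>h. \<Sum>k\<in>Basis. (h \<bullet> k) *\<^sub>R p k)) (at x)" and j: "j \<in> Basis"
  shows "L (p j) = p j"
proof -
  have 1: "((\<lambda>y. f (x + y *\<^sub>R j)) has_vector_derivative p j) (at 0)"
    using has_derivative_line_Basis[of f p x 0 j] f j by simp
  have 2: "((\<lambda>y. L (f (x + y *\<^sub>R j))) has_vector_derivative L (p j)) (at 0)"
    by (rule bounded_linear.has_vector_derivative[OF L 1])
  have "open ((\<lambda>y. x + y *\<^sub>R j) -` S)"
    by (rule open_vimage[OF S(1)]) (intro continuous_intros)
  then have "((\<lambda>y. f (x + y *\<^sub>R j)) has_vector_derivative L (p j)) (at 0)"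
    by (rule has_vector_derivative_transform_within_open[OF 2]) (use S fxd in auto)
  from vector_derivative_unique_at[OF this 1] show ?thesis .
qed

lemma bounded_linear_transpose: "bounded_linear (transpose :: real^'r^'s \<Rightarrow> real^'s^'r)"
  unfolding linear_conv_bounded_linear[symmetric]
  by (rule linearI) (auto simp: transpose_def vec_eq_iff)

lemma C2_partials_transpose:
  fixes g :: "'a::euclidean_space \<Rightarrow> real^'r^'r"
  assumes g: "C2_partials S g p q" and S: "open S" "x \<in> S" and sym: "\<And>x. x \<in> S \<Longrightarrow> transpose (g x) = g x"
    and j: "j \<in> Basis" and k: "k \<in> Basis"
  shows "transpose (p j x) = p j x" "transpose (q j k x) = q j k x"
proof -
  have P: "transpose (p j x) = p j x" if "x \<in> S" for x
    by (rule partial_linear_fixed[OF bounded_linear_transpose S(1) that sym C2_partialsD(1)[OF g that] j])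
  then show "transpose (p j x) = p j x" using S by blast
  show "transpose (q j k x) = q j k x"
    using partial_linear_fixed[OF bounded_linear_transpose S P C2_partialsD(2)[OF g S(2) j] k] .
qed

text \<open>The local coefficients depend on T. Iterated \<open>partial_deriv\<close> is one choice
  for all points and agrees with each local one, so it glues them.\<close>

lemma C2_on_locally:
  fixes f :: "'a::euclidean_space \<Rightarrow> 'b::real_normed_vector"
  assumes loc: "\<And>x. x \<in> S \<Longrightarrow> \<exists>T. open T \<and> x \<in> T \<and> C2_on T f"
  shows "C2_on S f"
proof -
  let ?p = "\<lambda>j. partial_deriv j f"
  let ?q = "\<lambda>j k. partial_deriv k (partial_deriv j f)"
  have key: "(f has_derivative (\<lambda>h. \<Sum>j\<in>Basis. (h \<bullet> j) *\<^sub>R ?p j x)) (at x) \<and>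
     (\<forall>j\<in>Basis. (?p j has_derivative (\<lambda>h. \<Sum>k\<in>Basis. (h \<bullet> k) *\<^sub>R ?q j k x)) (at x)) \<and>
     (\<forall>j\<in>Basis. \<forall>k\<in>Basis. continuous (at x) (?q j k))" if xS: "x \<in> S" for x
  proof -
    obtain T p q where T: "open T" "x \<in> T" and pq: "C2_partials T f p q"
      using loc[OF xS] by (auto simp: C2_on_iff_partials)
    have p: "?p j y = p j y" if "j \<in> Basis" "y \<in> T" for j y
      by (rule partial_deriv_eq[where p = "\<lambda>j. p j y", OF C2_partialsD(1)[OF pq that(2)] that(1)])
    have q: "?q j k y = q j k y" if "j \<in> Basis" "k \<in> Basis" "y \<in> T" for j k y
    proof -
      have "?q j k y = partial_deriv k (p j) y"
        by (rule partial_deriv_cong_open[OF T(1) that(3)]) (rule p[OF that(1)])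
      then show ?thesis
        using partial_deriv_eq[where p = "\<lambda>k. q j k y", OF C2_partialsD(2)[OF pq that(3,1)] that(2)] by simp
    qed
    have "(?p j has_derivative (\<lambda>h. \<Sum>k\<in>Basis. (h \<bullet> k) *\<^sub>R q j k x)) (at x)" if "j \<in> Basis" for j
      by (rule has_derivative_transform_within_open[OF C2_partialsD(2)[OF pq T(2) that] T])
        (simp add: p that)
    moreover have "continuous (at x) (?q j k)" if "j \<in> Basis" "k \<in> Basis" for j k
    proof -
      have "continuous_on T (?q j k)"
        using C2_partialsD(3)[OF pq that] by (rule continuous_on_eq) (simp add: q that)
      then show ?thesis using T continuous_on_eq_continuous_at by blast
    qed
    ultimately show ?thesis
      using C2_partialsD(1)[OF pq T(2)] p q T by (simp cong: sum.cong)
  qed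
  then have "C2_partials S f ?p ?q"
    unfolding C2_partials_def by (auto intro!: continuous_at_imp_continuous_on)
  then show ?thesis using C2_on_iff_partials by blast
qed

section \<open>Nakano positivity without inverse matrices\<close>

text \<open>
  With \<open>h w = \<Sum>\<^sub>j h\<^sub>j u\<^sub>j\<close>, the Nakano form of \<open>h\<close> at \<open>u\<close> equals
  \<open>h(w, w) - \<Sum>\<^sub>j\<^sub>k h\<^sub>j\<^sub>k(u\<^sub>j, u\<^sub>k)\<close>, where subscripts of \<open>h\<close> denote derivatives.
\<close>

definition nakano_ge ::
  "'i set \<Rightarrow> real^'r^'r \<Rightarrow> ('i \<Rightarrow> real^'r^'r) \<Rightarrow> ('i \<Rightarrow> 'i \<Rightarrow> real^'r^'r) \<Rightarrow> real \<Rightarrow> bool" where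
  "nakano_ge M h p q \<kappa> \<longleftrightarrow> (\<forall>u w. h *v w = (\<Sum>j\<in>M. p j *v u j) \<longrightarrow>
     (\<Sum>j\<in>M. \<Sum>k\<in>M. (q j k *v u j) \<bullet> u k) + \<kappa> * (\<Sum>j\<in>M. (norm (u j))\<^sup>2) \<le> (h *v w) \<bullet> w)"

text \<open>Differentiating the inverse gives \<open>g \<Theta>\<^sub>j\<^sub>k = g\<^sub>k
  g\<^sup>-\<^sup>1 g\<^sub>j - g\<^sub>j\<^sub>k\<close>. By symmetry \<open>g\<^sub>k\<close>
  moves over to \<open>u\<^sub>k\<close>, and the double sum of the first terms factors into w
  \<bullet> g w, since w is the sum of the vectors
  \<open>g\<^sup>-\<^sup>1 g\<^sub>j u\<^sub>j\<close>.\<close>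

lemma nakano_form_eq:
  fixes g :: "'a::euclidean_space \<Rightarrow> real^'r^'r"
  assumes g: "C2_partials S g p q" and S: "open S" "s \<in> S" and pos: "\<And>s. s \<in> S \<Longrightarrow> pos_def (g s)"
    and w: "g s *v w = (\<Sum>j\<in>Basis. p j s *v u j)"
  shows "nakano_form g s u = (g s *v w) \<bullet> w - (\<Sum>j\<in>Basis. \<Sum>k\<in>Basis. (q j k s *v u j) \<bullet> u k)"
proof -
  have sym: "\<And>s. s \<in> S \<Longrightarrow> transpose (g s) = g s"
    using pos by (simp add: pos_def_def)
  have inv: "invertible (g s)" if "s \<in> S" for s
    using pos[OF that] by (rule pos_def_invertible)
  let ?Y = "matrix_inv (g s)"
  have curv: "curvature g j k s = - (?Y ** q j k s + - (?Y ** p k s ** ?Y) ** p j s)"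
    if j: "j \<in> Basis" and k: "k \<in> Basis" for j k
  proof -
    have "curvature g j k s = - partial_deriv k (\<lambda>s'. matrix_inv (g s') ** p j s') s"
      unfolding curvature_def
      by (intro arg_cong[of _ _ uminus] partial_deriv_cong_open[OF S])
        (simp add: partial_deriv_eq[where p = "\<lambda>j. p j _", OF C2_partialsD(1)[OF g] j])
    moreover have "partial_deriv k (\<lambda>s'. matrix_inv (g s') ** p j s') s = ?Y ** q j k s + - (?Y ** p k s ** ?Y) ** p j s"
      unfolding partial_deriv_def
    proof (rule vector_derivative_at)
      let ?T = "(\<lambda>y. s + y *\<^sub>R k) -` S"
      have T: "open ?T" "0 \<in> ?T"
        using S by (auto intro!: open_vimage continuous_intros)
      have 1: "((\<lambda>y. g (s + y *\<^sub>R k)) has_vector_derivative p k s) (at 0 within ?T)"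
        using has_vector_derivative_at_within[OF has_derivative_line_Basis[of g "\<lambda>k. p k s" s 0 k]]
          C2_partialsD(1)[OF g S(2)] k by simp
      have 2: "((\<lambda>y. p j (s + y *\<^sub>R k)) has_vector_derivative q j k s) (at 0 within ?T)"
        using has_vector_derivative_at_within[OF has_derivative_line_Basis[of "p j" "\<lambda>k. q j k s" s 0 k]]
          C2_partialsD(2)[OF g S(2) j] k by simp
      have 3: "((\<lambda>y. matrix_inv (g (s + y *\<^sub>R k))) has_vector_derivative - (?Y ** p k s ** ?Y)) (at 0 within ?T)"
        using has_vector_derivative_matrix_inv[OF 1 T(2)] inv by simp
      from mm.has_vector_derivative[OF 3 2]
      show "((\<lambda>y. matrix_inv (g (s + y *\<^sub>R k)) ** p j (s + y *\<^sub>R k)) has_vector_derivative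
          ?Y ** q j k s + - (?Y ** p k s ** ?Y) ** p j s) (at 0)"
        unfolding at_within_open[OF T(2,1)] by simp
    qed
    ultimately show ?thesis by simp
  qed
  have trm: "(g s *v (curvature g j k s *v u j)) \<bullet> u k =
      (?Y *v (p j s *v u j)) \<bullet> (p k s *v u k) - (q j k s *v u j) \<bullet> u k"
    if j: "j \<in> Basis" and k: "k \<in> Basis" for j k
  proof -
    have "g s *v (curvature g j k s *v u j) =
        p k s *v (?Y *v (p j s *v u j)) - q j k s *v u j"
      by (simp add: curv[OF j k] matrix_vector_mul_assoc[symmetric] mm.minus_left mm.minus_right mm.add_right
          mv.diff_left mv.diff_right mv.add_left mv.minus_left matrix_inv_mult_vector[OF inv[OF S(2)]])
    then show ?thesis
      using inner_symmetric_matrix[OF C2_partials_transpose(1)[OF g S sym k k], of "?Y *v (p j s *v u j)" "u k"]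
      by (simp add: inner_diff_left inner_commute inner_diff_right)
  qed
  have w': "?Y *v (\<Sum>j\<in>Basis. p j s *v u j) = w"
    unfolding w[symmetric] by (rule matrix_inv_mult_vector(2)[OF inv[OF S(2)]])
  have "nakano_form g s u = (\<Sum>j\<in>Basis. \<Sum>k\<in>Basis.
      (?Y *v (p j s *v u j)) \<bullet> (p k s *v u k) - (q j k s *v u j) \<bullet> u k)"
    unfolding nakano_form_def by (intro sum.cong refl trm)
  then have eq1: "nakano_form g s u = (\<Sum>j\<in>Basis. \<Sum>k\<in>Basis. (?Y *v (p j s *v u j)) \<bullet> (p k s *v u k))
      - (\<Sum>j\<in>Basis. \<Sum>k\<in>Basis. (q j k s *v u j) \<bullet> u k)"
    by (simp add: sum_subtractf)
  have eq2: "(\<Sum>j\<in>Basis. \<Sum>k\<in>Basis. (?Y *v (p j s *v u j)) \<bullet> (p k s *v u k)) = w \<bullet> (g s *v w)"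
  proof -
    have "w \<bullet> (g s *v w) = (\<Sum>j\<in>Basis. ?Y *v (p j s *v u j)) \<bullet> (\<Sum>k\<in>Basis. p k s *v u k)"
      unfolding w[symmetric] mv.sum_right[symmetric] by (simp only: w' w)
    also have "\<dots> = (\<Sum>j\<in>Basis. \<Sum>k\<in>Basis. (?Y *v (p j s *v u j)) \<bullet> (p k s *v u k))"
      by (simp only: inner_sum_left inner_sum_right) (rule sum.swap)
    finally show ?thesis by simp
  qed
  show ?thesis unfolding eq1 eq2 inner_commute[of w] ..
qed

section \<open>The one-dimensional direct image\<close>

lemma integral_matrix_vector:
  fixes h :: "real \<Rightarrow> real^'r^'s"
  assumes "h integrable_on T"
  shows "integral T (\<lambda>y. h y *v c) = integral T h *v c"
  using integral_linear[OF assms mv.bounded_linear_left] by (simp add: o_def)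

lemma integral_inner_right:
  fixes f :: "real \<Rightarrow> 'a::real_inner"
  assumes "f integrable_on T"
  shows "integral T (\<lambda>y. f y \<bullet> c) = integral T f \<bullet> c"
  using integral_linear[OF assms bounded_linear_inner_left] by (simp add: o_def)

lemma pos_def_integral:
  fixes h :: "real \<Rightarrow> real^'r^'r"
  assumes ab: "a < b" and cont: "continuous_on {a..b} h"
    and pos: "\<And>y. y \<in> {a..b} \<Longrightarrow> pos_def (h y) \<or> h y = 0"
    and x: "x \<in> {a..b}" "pos_def (h x)"
  shows "pos_def (integral {a..b} h)"
  unfolding pos_def_def
proof (intro conjI allI impI)
  have int: "h integrable_on {a..b}"
    by (rule integrable_continuous_real[OF cont])
  have "transpose (h y) = h y" if "y \<in> {a..b}" for y
    using pos[OF that] linear_0[OF bounded_linear.linear[OF bounded_linear_transpose]] by (auto simp: pos_def_def)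
  then have "integral {a..b} (transpose \<circ> h) = integral {a..b} h"
    by (intro integral_cong) auto
  then show "transpose (integral {a..b} h) = integral {a..b} h"
    using integral_linear[OF int bounded_linear_transpose] by simp
next
  fix u :: "real^'r" assume u: "u \<noteq> 0"
  let ?f = "\<lambda>y. (h y *v u) \<bullet> u"
  have int: "h integrable_on {a..b}"
    by (rule integrable_continuous_real[OF cont])
  have cf: "continuous_on {a..b} ?f"
    by (intro continuous_intros mv.continuous_on cont)
  have nn: "?f y \<ge> 0" if "y \<in> {a..b}" for y
    using pos[OF that] pos_def_nonneg by (auto simp: mv.zero_left)
  have "integral {a..b} ?f \<noteq> 0"
  proof
    assume "integral {a..b} ?f = 0"
    then have "?f x = 0"
      using integral_eq_0_iff[OF cf ab nn] x(1) by blast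
    with x(2) u show False unfolding pos_def_def by (metis less_irrefl)
  qed
  moreover have "integral {a..b} ?f \<ge> 0"
    by (rule integral_nonneg[OF integrable_continuous_real[OF cf]]) (use nn in auto)
  moreover have "integral {a..b} ?f = (integral {a..b} h *v u) \<bullet> u"
    using integral_linear[OF int bounded_linear_compose[OF bounded_linear_inner_left mv.bounded_linear_left], of u u]
    by (simp add: o_def)
  ultimately show "(integral {a..b} h *v u) \<bullet> u > 0" by linarith
qed

text \<open>
  The vector field \<open>v = h\<^sup>-\<^sup>1 F\<close> with \<open>F(y) = \<integral>\<^sub>\<alpha>\<^sup>y (h c - b)\<close> vanishes at both endpoints by the choice of
  \<open>c\<close>, and \<open>w = c - v'\<close> satisfies \<open>h w = b + h\<^sub>x v\<close>.  Up to the derivative of \<open>2 b\<cdot>v + h\<^sub>x v\<cdot>v\<close>, the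
  hypothesis for this choice reads \<open>s \<le> h c\<cdot>c - h v'\<cdot>v'\<close>.
\<close>

lemma nakano_interval:
  fixes h hx hxx :: "real \<Rightarrow> real^'r^'r" and b b' :: "real \<Rightarrow> real^'r"
  assumes \<alpha>\<beta>: "\<alpha> < \<beta>"
    and h: "\<And>y. y \<in> {\<alpha>..\<beta>} \<Longrightarrow> (h has_vector_derivative hx y) (at y within {\<alpha>..\<beta>})"
    and hx: "\<And>y. y \<in> {\<alpha>..\<beta>} \<Longrightarrow> (hx has_vector_derivative hxx y) (at y within {\<alpha>..\<beta>})"
    and b: "\<And>y. y \<in> {\<alpha>..\<beta>} \<Longrightarrow> (b has_vector_derivative b' y) (at y within {\<alpha>..\<beta>})"
    and pos: "\<And>y. y \<in> {\<alpha>..\<beta>} \<Longrightarrow> pos_def (h y)"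
    and sym: "\<And>y. y \<in> {\<alpha>..\<beta>} \<Longrightarrow> transpose (hx y) = hx y"
    and s: "continuous_on {\<alpha>..\<beta>} s"
    and N: "\<And>y v w. y \<in> {\<alpha>..\<beta>} \<Longrightarrow> h y *v w = b y + hx y *v v \<Longrightarrow>
      s y + 2 * (b' y \<bullet> v) + (hxx y *v v) \<bullet> v \<le> (h y *v w) \<bullet> w"
    and c: "integral {\<alpha>..\<beta>} h *v c = integral {\<alpha>..\<beta>} b"
  shows "integral {\<alpha>..\<beta>} s \<le> (integral {\<alpha>..\<beta>} h *v c) \<bullet> c"
proof -
  have ch: "continuous_on {\<alpha>..\<beta>} h" and cb: "continuous_on {\<alpha>..\<beta>} b"
    using continuous_on_vector_derivative[OF h] continuous_on_vector_derivative[OF b] by auto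
  define f where "f y = h y *v c - b y" for y
  have cf: "continuous_on {\<alpha>..\<beta>} f"
    unfolding f_def by (intro continuous_intros mv.continuous_on ch cb)
  define F where "F y = integral {\<alpha>..y} f" for y
  define v where "v y = matrix_inv (h y) *v F y" for y
  define v' where "v' y = matrix_inv (h y) *v (f y - hx y *v v y)" for y
  have inv: "invertible (h y)" if "y \<in> {\<alpha>..\<beta>}" for y
    by (rule pos_def_invertible[OF pos[OF that]])
  have v: "(v has_vector_derivative v' y) (at y within {\<alpha>..\<beta>})" if y: "y \<in> {\<alpha>..\<beta>}" for y
  proof -
    have "(F has_vector_derivative f y) (at y within {\<alpha>..\<beta>})"
      unfolding F_def by (rule integral_has_vector_derivative[OF cf y])
    then have "((\<lambda>y. matrix_inv (h y) *v F y) has_vector_derivative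
        matrix_inv (h y) *v f y + - (matrix_inv (h y) ** hx y ** matrix_inv (h y)) *v F y) (at y within {\<alpha>..\<beta>})"
      by (intro mv.has_vector_derivative has_vector_derivative_matrix_inv h y inv)
    then show ?thesis
      unfolding v_def[abs_def, symmetric]
      by (rule has_vector_derivative_eq_rhs)
        (simp_all add: v_def[abs_def] v'_def mv.minus_left mv.diff_right matrix_vector_mul_assoc[symmetric])
  qed
  have hv': "h y *v v' y = f y - hx y *v v y" if "y \<in> {\<alpha>..\<beta>}" for y
    unfolding v'_def by (rule matrix_inv_mult_vector(1)[OF inv[OF that]])
  define R where "R y = 2 * (b y \<bullet> v y) + (hx y *v v y) \<bullet> v y" for y
  define R' where "R' y = 2 * (b y \<bullet> v' y + b' y \<bullet> v y) + ((hx y *v v y) \<bullet> v' y + (hx y *v v' y + hxx y *v v y) \<bullet> v y)" for y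
  have R: "(R has_vector_derivative R' y) (at y within {\<alpha>..\<beta>})" if y: "y \<in> {\<alpha>..\<beta>}" for y
    unfolding R_def R'_def
    by (intro has_vector_derivative_add has_vector_derivative_mult_right
        bounded_bilinear.has_vector_derivative[OF bounded_bilinear_inner]
        mv.has_vector_derivative b[OF y] v[OF y] hx[OF y])
  have F0: "F \<alpha> = 0" "F \<beta> = 0"
    using integrable_continuous_real[OF ch] integrable_continuous_real[OF cb] c
    by (simp_all add: F_def f_def[abs_def] integral_diff integrable_linear[OF _ mv.bounded_linear_left, unfolded o_def]
        integral_matrix_vector)
  have ends: "R \<alpha> = 0" "R \<beta> = 0"
    by (simp_all add: R_def v_def F0 mv.zero_right)
  have "(R' has_integral R \<beta> - R \<alpha>) {\<alpha>..\<beta>}"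
    by (rule fundamental_theorem_of_calculus) (use \<alpha>\<beta> R in auto)
  then have iR: "(R' has_integral 0) {\<alpha>..\<beta>}" by (simp add: ends)
  have ptw: "s y \<le> (h y *v c) \<bullet> c - R' y" if y: "y \<in> {\<alpha>..\<beta>}" for y
  proof -
    let ?w = "c - v' y"
    have hw: "h y *v ?w = b y + hx y *v v y"
      by (simp add: mv.diff_right hv'[OF y] f_def)
    have "s y + 2 * (b' y \<bullet> v y) + (hxx y *v v y) \<bullet> v y \<le> (h y *v ?w) \<bullet> ?w"
      by (rule N[OF y hw])
    moreover have "(h y *v ?w) \<bullet> ?w = (h y *v c) \<bullet> c - 2 * ((h y *v c) \<bullet> v' y) + (h y *v v' y) \<bullet> v' y"
      using pos_def_symD[OF pos[OF y], of "v' y" c]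
      unfolding mv.diff_right inner_diff_left inner_diff_right by linarith
    moreover have "(b y + hx y *v v y) \<bullet> v' y = (h y *v c) \<bullet> v' y - (h y *v v' y) \<bullet> v' y"
      unfolding hw[symmetric] mv.diff_right inner_diff_left ..
    moreover have "(h y *v v' y) \<bullet> v' y \<ge> 0"
      by (rule pos_def_nonneg[OF pos[OF y]])
    moreover have "(hx y *v v' y) \<bullet> v y = (hx y *v v y) \<bullet> v' y"
      by (rule inner_symmetric_matrix[OF sym[OF y]])
    ultimately show ?thesis
      unfolding R'_def by (simp add: inner_add_left)
  qed
  have i1: "((\<lambda>y. (h y *v c) \<bullet> c) has_integral (integral {\<alpha>..\<beta>} h *v c) \<bullet> c) {\<alpha>..\<beta>}"
    using has_integral_linear[OF integrable_integral[OF integrable_continuous_real[OF ch]]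
        bounded_linear_compose[OF bounded_linear_inner_left mv.bounded_linear_left], of c c]
    by (simp add: o_def)
  have "((\<lambda>y. (h y *v c) \<bullet> c - R' y) has_integral (integral {\<alpha>..\<beta>} h *v c) \<bullet> c - 0) {\<alpha>..\<beta>}"
    by (rule has_integral_diff[OF i1 iR])
  from has_integral_le[OF integrable_integral[OF integrable_continuous_real[OF s]] this ptw]
  show ?thesis by simp
qed

text \<open>Continuity of the indefinite integral. The offset 3 keeps the amount removed at either
  end below half the length, so every subinterval is nondegenerate.\<close>

lemma integral_exhaust:
  fixes f :: "real \<Rightarrow> 'a::banach"
  assumes ab: "a < b" and f: "continuous_on {a..b} f"
  shows "(\<lambda>n. integral {a + (b - a) / (real n + 3)..b - (b - a) / (real n + 3)} f) \<longlonglongrightarrow> integral {a..b} f"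
proof -
  let ?\<Phi> = "\<lambda>x. integral {a..x} f"
  have int: "f integrable_on {a..b}" by (rule integrable_continuous_real[OF f])
  have c: "continuous_on {a..b} ?\<Phi>" by (rule indefinite_integral_continuous_1[OF int])
  define d where "d n = (b - a) / (real n + 3)" for n :: nat
  have d: "0 \<le> d n" "d n \<le> (b - a) / 2" for n
    using ab divide_left_mono[of 2 "real n + 3" "b - a"] by (auto simp: d_def)
  have "(\<lambda>n. (b - a) * inverse (real (n + 3))) \<longlonglongrightarrow> (b - a) * 0"
    by (intro tendsto_mult tendsto_const LIMSEQ_ignore_initial_segment[OF lim_inverse_n])
  then have d0: "d \<longlonglongrightarrow> 0"
    by (simp add: d_def[abs_def] divide_inverse add.commute)
  have eq: "integral {a + d n..b - d n} f = ?\<Phi> (b - d n) - ?\<Phi> (a + d n)" for n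
  proof -
    have o: "a \<le> a + d n" "a + d n \<le> b - d n" "b - d n \<le> b"
      using d[of n] by (auto simp: field_simps)
    have "f integrable_on {a..b - d n}"
      by (rule integrable_on_subinterval[OF int]) (use o in auto)
    from Henstock_Kurzweil_Integration.integral_combine[OF o(1,2) this] show ?thesis
      by (simp add: algebra_simps)
  qed
  have mem: "a + d n \<in> {a..b}" "b - d n \<in> {a..b}" for n
    using d[of n] ab by (auto simp: field_simps)
  have "(\<lambda>n. b - d n) \<longlonglongrightarrow> b - 0" "(\<lambda>n. a + d n) \<longlonglongrightarrow> a + 0"
    by (intro tendsto_intros d0)+
  then have "(\<lambda>n. b - d n) \<longlonglongrightarrow> b" "(\<lambda>n. a + d n) \<longlonglongrightarrow> a"
    by simp_all
  note tc = continuous_on_tendsto_compose[OF c _ _ always_eventually]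
  have l1: "(\<lambda>n. ?\<Phi> (b - d n)) \<longlonglongrightarrow> ?\<Phi> b"
    by (rule tc) (use ab mem \<open>(\<lambda>n. b - d n) \<longlonglongrightarrow> b\<close> in auto)
  have l2: "(\<lambda>n. ?\<Phi> (a + d n)) \<longlonglongrightarrow> ?\<Phi> a"
    by (rule tc) (use ab mem \<open>(\<lambda>n. a + d n) \<longlonglongrightarrow> a\<close> in auto)
  from tendsto_diff[OF l1 l2] show ?thesis
    by (simp add: eq[unfolded d_def] flip: d_def) (simp add: d_def[symmetric] eq)
qed

text \<open>At l and u the matrix h may be singular, so the vector field of
  \<open>nakano_interval\<close> need not exist there. On each compact subinterval the constant
  vector must be recomputed as \<open>cn\<close>, for the field to vanish at both new endpoints;
  since the total integral of h is invertible, \<open>cn\<close> tends to c and the inequalities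
  pass to the limit.\<close>

lemma nakano_open_interval:
  fixes h hx hxx :: "real \<Rightarrow> real^'r^'r" and b b' :: "real \<Rightarrow> real^'r"
  assumes lu: "l < u"
    and h: "\<And>y. y \<in> {l..u} \<Longrightarrow> (h has_vector_derivative hx y) (at y)"
    and hx: "\<And>y. y \<in> {l..u} \<Longrightarrow> (hx has_vector_derivative hxx y) (at y)"
    and b: "\<And>y. y \<in> {l..u} \<Longrightarrow> (b has_vector_derivative b' y) (at y)"
    and pos: "\<And>y. y \<in> {l<..<u} \<Longrightarrow> pos_def (h y)"
    and H: "pos_def (integral {l..u} h)"
    and sym: "\<And>y. y \<in> {l..u} \<Longrightarrow> transpose (hx y) = hx y"
    and s: "continuous_on {l..u} s"
    and N: "\<And>y v w. y \<in> {l<..<u} \<Longrightarrow> h y *v w = b y + hx y *v v \<Longrightarrow>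
      s y + 2 * (b' y \<bullet> v) + (hxx y *v v) \<bullet> v \<le> (h y *v w) \<bullet> w"
    and c: "integral {l..u} h *v c = integral {l..u} b"
  shows "integral {l..u} s \<le> (integral {l..u} h *v c) \<bullet> c"
proof -
  have ch: "continuous_on {l..u} h"
    by (rule continuous_on_vector_derivative) (rule has_vector_derivative_at_within[OF h])
  have cb: "continuous_on {l..u} b"
    by (rule continuous_on_vector_derivative) (rule has_vector_derivative_at_within[OF b])
  define \<alpha> where "\<alpha> n = l + (u - l) / (real n + 3)" for n :: nat
  define \<beta> where "\<beta> n = u - (u - l) / (real n + 3)" for n :: nat
  have o: "l < \<alpha> n" "\<alpha> n < \<beta> n" "\<beta> n < u" for n
  proof -
    define d where "d = (u - l) / (real n + 3)"
    have "d < (u - l) / 2"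
      unfolding d_def by (rule divide_strict_left_mono) (use lu in auto)
    moreover have "0 < d" using lu by (simp add: d_def)
    ultimately show "l < \<alpha> n" "\<alpha> n < \<beta> n" "\<beta> n < u"
      unfolding \<alpha>_def \<beta>_def d_def[symmetric] by auto
  qed
  have sub: "{\<alpha> n..\<beta> n} \<subseteq> {l<..<u}" for n using o[of n] by auto
  have sub': "{\<alpha> n..\<beta> n} \<subseteq> {l..u}" for n using o[of n] by auto
  define Hn where "Hn n = integral {\<alpha> n..\<beta> n} h" for n
  define bn where "bn n = integral {\<alpha> n..\<beta> n} b" for n
  define cn where "cn n = matrix_inv (Hn n) *v bn n" for n
  have limH: "Hn \<longlonglongrightarrow> integral {l..u} h"
    unfolding Hn_def[abs_def] \<alpha>_def \<beta>_def by (rule integral_exhaust[OF lu ch])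
  have limb: "bn \<longlonglongrightarrow> integral {l..u} b"
    unfolding bn_def[abs_def] \<alpha>_def \<beta>_def by (rule integral_exhaust[OF lu cb])
  have lims: "(\<lambda>n. integral {\<alpha> n..\<beta> n} s) \<longlonglongrightarrow> integral {l..u} s"
    unfolding \<alpha>_def \<beta>_def by (rule integral_exhaust[OF lu s])
  have posH: "pos_def (Hn n)" for n
    unfolding Hn_def
    by (rule pos_def_integral[OF o(2)[of n] continuous_on_subset[OF ch sub'], where x = "\<alpha> n"])
      (use pos sub[of n] o[of n] in auto)
  have c': "c = matrix_inv (integral {l..u} h) *v integral {l..u} b"
    unfolding c[symmetric] by (rule matrix_inv_mult_vector(2)[OF pos_def_invertible[OF H], symmetric])
  have "cn \<longlonglongrightarrow> c"
    unfolding cn_def[abs_def] c'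
    by (intro mv.tendsto tendsto_matrix_inv limH limb pos_def_invertible[OF H] always_eventually allI
        pos_def_invertible[OF posH])
  then have lim: "(\<lambda>n. (Hn n *v cn n) \<bullet> cn n) \<longlonglongrightarrow> (integral {l..u} h *v c) \<bullet> c"
    by (intro tendsto_inner mv.tendsto limH)
  have "integral {\<alpha> n..\<beta> n} s \<le> (Hn n *v cn n) \<bullet> cn n" for n
    unfolding Hn_def
  proof (rule nakano_interval[OF o(2)[of n], where hx = hx and hxx = hxx and b = b and b' = b'])
    show "integral {\<alpha> n..\<beta> n} h *v cn n = integral {\<alpha> n..\<beta> n} b"
      unfolding cn_def Hn_def[symmetric] bn_def[symmetric]
      by (rule matrix_inv_mult_vector(1)[OF pos_def_invertible[OF posH]])
    show "continuous_on {\<alpha> n..\<beta> n} s"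
      by (rule continuous_on_subset[OF s sub'])
    fix y assume "y \<in> {\<alpha> n..\<beta> n}"
    then have y: "y \<in> {l<..<u}" and y': "y \<in> {l..u}"
      using sub sub' by blast+
    show "(h has_vector_derivative hx y) (at y within {\<alpha> n..\<beta> n})"
      by (rule has_vector_derivative_at_within[OF h[OF y']])
    show "(hx has_vector_derivative hxx y) (at y within {\<alpha> n..\<beta> n})"
      by (rule has_vector_derivative_at_within[OF hx[OF y']])
    show "(b has_vector_derivative b' y) (at y within {\<alpha> n..\<beta> n})"
      by (rule has_vector_derivative_at_within[OF b[OF y']])
    show "pos_def (h y)" by (rule pos[OF y])
    show "transpose (hx y) = hx y" by (rule sym[OF y'])
    fix v w assume "h y *v w = b y + hx y *v v"
    then show "s y + 2 * (b' y \<bullet> v) + (hxx y *v v) \<bullet> v \<le> (h y *v w) \<bullet> w"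
      by (rule N[OF y])
  qed
  then show ?thesis
    using tendsto_le[OF sequentially_bot lim lims] by simp
qed

section \<open>Integration along a coordinate direction\<close>

text \<open>
  For functions supported in \<open>{z. \<bar>z \<bullet> e\<bar> < R}\<close> this is the integral over the line through \<open>z\<close> in
  direction \<open>e\<close>; the result does not depend on the coordinate \<open>z \<bullet> e\<close>.
\<close>

definition fint :: "real \<Rightarrow> 'a::euclidean_space \<Rightarrow> ('a \<Rightarrow> 'c::banach) \<Rightarrow> 'a \<Rightarrow> 'c" where
  "fint R e f z = integral {-R..R} (\<lambda>y. f (z - (z \<bullet> e) *\<^sub>R e + y *\<^sub>R e))"

definition translation_closed :: "'a::real_vector set \<Rightarrow> 'a \<Rightarrow> bool" where
  "translation_closed S e \<longleftrightarrow> (\<forall>z\<in>S. \<forall>y. z + y *\<^sub>R e \<in> S)"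

lemma translation_closed_line:
  assumes "translation_closed S e" "z \<in> S"
  shows "z - x *\<^sub>R e + y *\<^sub>R e \<in> S"
proof -
  have "z + (y - x) *\<^sub>R e \<in> S" using assms by (auto simp: translation_closed_def)
  then show ?thesis by (simp add: algebra_simps)
qed

lemma continuous_on_line_map:
  assumes "continuous_on S f" "translation_closed S e"
  shows "continuous_on (S \<times> T) (\<lambda>(z, y). f (z - (z \<bullet> e) *\<^sub>R e + y *\<^sub>R e))"
  unfolding case_prod_beta
  by (rule continuous_on_compose2[OF assms(1)])
    (auto intro!: continuous_intros translation_closed_line[OF assms(2)])

lemma continuous_on_fint:
  assumes "continuous_on S f" "translation_closed S e"
  shows "continuous_on S (fint R e f)"
  using integral_continuous_on_param[of S "-R" R "\<lambda>z y. f (z - (z \<bullet> e) *\<^sub>R e + y *\<^sub>R e)"]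
    continuous_on_line_map[OF assms]
  by (simp add: fint_def[abs_def])

text \<open>The value depends on z only through the projection z - (z \<bullet> e) e, which kills
  the e-component of an increment. So the coefficient at e is 0, and every other one is the integral
  of the corresponding coefficient of f.\<close>

lemma has_derivative_fint:
  fixes f :: "'a::euclidean_space \<Rightarrow> 'c::banach"
  assumes S: "open S" "convex S" "translation_closed S e" and e: "e \<in> Basis"
    and f: "\<And>z. z \<in> S \<Longrightarrow> (f has_derivative (\<lambda>h. \<Sum>j\<in>Basis. (h \<bullet> j) *\<^sub>R p j z)) (at z)"
    and p: "\<And>j. j \<in> Basis \<Longrightarrow> continuous_on S (p j)"
    and z: "z \<in> S"
  shows "(fint R e f has_derivative
    (\<lambda>h. \<Sum>j\<in>Basis. (h \<bullet> j) *\<^sub>R (if j = e then 0 else fint R e (p j) z))) (at z)"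
proof -
  let ?L = "\<lambda>z y. z - (z \<bullet> e) *\<^sub>R e + y *\<^sub>R e"
  define P where "P j z y = (if j = e then 0 else p j (?L z y))" for j z y
  have cf: "continuous_on S f"
    by (rule has_derivative_continuous_on[OF has_derivative_at_withinI[OF f]])
  have "((\<lambda>z. integral {-R..R} (\<lambda>y. f (?L z y))) has_derivative
    (\<lambda>h. \<Sum>j\<in>Basis. (h \<bullet> j) *\<^sub>R integral {-R..R} (P j z))) (at z)"
  proof (rule leibniz_partials[OF S(1,2) _ _ _ z])
    fix z y assume z: "z \<in> S"
    have "((\<lambda>z. ?L z y) has_derivative (\<lambda>h. h - (h \<bullet> e) *\<^sub>R e)) (at z)"
      by (auto intro!: derivative_eq_intros)
    from has_derivative_compose[OF this f[OF translation_closed_line[OF S(3) z]]]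
    have "((\<lambda>z. f (?L z y)) has_derivative
      (\<lambda>h. \<Sum>j\<in>Basis. ((h - (h \<bullet> e) *\<^sub>R e) \<bullet> j) *\<^sub>R p j (?L z y))) (at z)" .
    moreover have "(\<Sum>j\<in>Basis. ((h - (h \<bullet> e) *\<^sub>R e) \<bullet> j) *\<^sub>R p j (?L z y)) =
        (\<Sum>j\<in>Basis. (h \<bullet> j) *\<^sub>R P j z y)" for h
      by (rule sum.cong) (use e in \<open>auto simp: P_def inner_diff_left inner_Basis\<close>)
    ultimately show "((\<lambda>z. f (?L z y)) has_derivative (\<lambda>h. \<Sum>j\<in>Basis. (h \<bullet> j) *\<^sub>R P j z y)) (at z)"
      by simp
  next
    fix z assume z: "z \<in> S"
    show "continuous_on {- R..R} (\<lambda>y. f (?L z y))"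
      by (rule continuous_on_compose2[OF cf])
        (auto intro!: continuous_intros translation_closed_line[OF S(3) z])
  next
    fix j :: 'a assume "j \<in> Basis"
    then show "continuous_on (S \<times> {- R..R}) (\<lambda>(z, y). P j z y)"
      using continuous_on_line_map[OF p S(3)] by (cases "j = e") (auto simp: P_def)
  qed
  moreover have "integral {-R..R} (P j z) = (if j = e then 0 else fint R e (p j) z)" for j
    by (auto simp: P_def[abs_def] fint_def)
  ultimately show ?thesis
    by (simp add: fint_def[abs_def])
qed

lemma C2_partials_fint:
  fixes h :: "'a::euclidean_space \<Rightarrow> 'c::banach"
  assumes S: "open S" "convex S" "translation_closed S e" and e: "e \<in> Basis"
    and h: "C2_partials S h p q"
  shows "C2_partials S (fint R e h) (\<lambda>j z. if j = e then 0 else fint R e (p j) z)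
    (\<lambda>j k z. if j = e \<or> k = e then 0 else fint R e (q j k) z)"
  unfolding C2_partials_def
proof (intro conjI ballI)
  fix z assume z: "z \<in> S"
  show "(fint R e h has_derivative (\<lambda>h. \<Sum>j\<in>Basis. (h \<bullet> j) *\<^sub>R (if j = e then 0 else fint R e (p j) z))) (at z)"
    by (rule has_derivative_fint[OF S e C2_partialsD(1)[OF h] C2_partials_continuous(2)[OF h] z])
  fix j :: 'a assume j: "j \<in> Basis"
  show "((\<lambda>z. if j = e then 0 else fint R e (p j) z) has_derivative
      (\<lambda>h. \<Sum>k\<in>Basis. (h \<bullet> k) *\<^sub>R (if j = e \<or> k = e then 0 else fint R e (q j k) z))) (at z)"
    using has_derivative_fint[OF S e C2_partialsD(2)[OF h _ j] C2_partialsD(3)[OF h j] z]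
    by (cases "j = e") auto
next
  fix j k :: 'a assume "j \<in> Basis" "k \<in> Basis"
  then show "continuous_on S (\<lambda>z. if j = e \<or> k = e then 0 else fint R e (q j k) z)"
    using continuous_on_fint[OF C2_partialsD(3)[OF h] S(3), of j k R] by (cases "j = e \<or> k = e") auto
qed

lemma open_convex_real_interval:
  fixes I :: "real set"
  assumes "open I" "convex I" "I \<noteq> {}" "I \<subseteq> {A<..<B}"
  obtains l u where "l < u" "I = {l<..<u}" "A \<le> l" "u \<le> B"
proof -
  have bdd: "bdd_below I" "bdd_above I"
    using assms(4) by (auto intro!: bdd_belowI[of _ A] bdd_aboveI[of _ B] dest!: subsetD)
  have mem: "Inf I < y \<and> y < Sup I" if yI: "y \<in> I" for y
  proof -
    obtain d where d: "d > 0" "cball y d \<subseteq> I"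
      using assms(1) yI open_contains_cball by blast
    then have "y - d \<in> I" "y + d \<in> I" by (auto simp: dist_real_def)
    then have "Inf I \<le> y - d" "y + d \<le> Sup I"
      using bdd by (auto intro: cInf_lower cSup_upper)
    with d show ?thesis by auto
  qed
  moreover have "y \<in> I" if y: "Inf I < y" "y < Sup I" for y
  proof -
    obtain y1 where "y1 \<in> I" "y1 < y"
      using cInf_lessD[OF assms(3) y(1)] by blast
    moreover obtain y2 where "y2 \<in> I" "y < y2"
      using less_cSupD[OF assms(3) y(2)] by blast
    ultimately show ?thesis
      using assms(2) unfolding is_interval_convex_1[symmetric] is_interval_1
      by (meson less_imp_le)
  qed
  ultimately have eq: "I = {Inf I<..<Sup I}" by auto
  moreover have "Inf I < Sup I" using mem assms(3) by fastforce
  moreover have "A \<le> Inf I"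
    by (rule cInf_greatest[OF assms(3)]) (use assms(4) in force)
  moreover have "Sup I \<le> B"
    by (rule cSup_least[OF assms(3)]) (use assms(4) in force)
  ultimately show ?thesis using that by blast
qed

section \<open>Nakano positivity is preserved by integration along a direction\<close>

text \<open>
  \<open>P\<close> is the positivity set of \<open>h\<close>, \<open>M\<close> the set of directions in which Nakano positivity is known, and
  \<open>J\<close> the set of directions that remain to be integrated.
\<close>

definition nakano_admissible ::
  "'a::euclidean_space set \<Rightarrow> real \<Rightarrow> 'a set \<Rightarrow> 'a set \<Rightarrow> 'a set \<Rightarrow> ('a \<Rightarrow> real^'r^'r) \<Rightarrow>
   ('a \<Rightarrow> 'a \<Rightarrow> real^'r^'r) \<Rightarrow> ('a \<Rightarrow> 'a \<Rightarrow> 'a \<Rightarrow> real^'r^'r) \<Rightarrow> ('a \<Rightarrow> real) \<Rightarrow> bool" where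
  "nakano_admissible S R M J P h p q \<kappa> \<longleftrightarrow>
     C2_partials S h p q \<and> open P \<and> convex P \<and> P \<subseteq> S \<and>
     (\<forall>z\<in>P. pos_def (h z) \<and> nakano_ge M (h z) (\<lambda>j. p j z) (\<lambda>j k. q j k z) (\<kappa> z) \<and> (\<forall>e\<in>J. \<bar>z \<bullet> e\<bar> < R)) \<and>
     (\<forall>z\<in>S - P. h z = 0 \<and> \<kappa> z = 0 \<and> (\<forall>j\<in>Basis. p j z = 0) \<and> (\<forall>j\<in>Basis. \<forall>k\<in>Basis. q j k z = 0)) \<and>
     continuous_on S \<kappa> \<and> (\<forall>z\<in>S. \<kappa> z \<ge> 0)"

text \<open>The hypothesis is applied to u with its value at e replaced by v. Symmetry merges the
  two cross terms into one with factor 2, and the share \<kappa> |v|^2 of the slack is dropped. The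
  result has the shape of premise \<open>N\<close> of the interval lemmas, v being the vector in the
  integrated direction.\<close>

lemma nakano_ge_split:
  fixes H :: "real^'r^'r"
  assumes N: "nakano_ge M H p q \<kappa>" and \<kappa>: "\<kappa> \<ge> 0" and e: "e \<in> M" and M: "finite M"
    and q: "\<And>j. j \<in> M \<Longrightarrow> q e j = q j e" "\<And>j. j \<in> M \<Longrightarrow> transpose (q j e) = q j e"
    and w: "H *v w = (\<Sum>j\<in>M - {e}. p j *v u j) + p e *v v"
  shows "((\<Sum>j\<in>M - {e}. \<Sum>k\<in>M - {e}. (q j k *v u j) \<bullet> u k) + \<kappa> * (\<Sum>j\<in>M - {e}. (norm (u j))\<^sup>2))
      + 2 * ((\<Sum>j\<in>M - {e}. q j e *v u j) \<bullet> v) + (q e e *v v) \<bullet> v \<le> (H *v w) \<bullet> w"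
proof -
  define u' where "u' = u(e := v)"
  have u': "u' e = v" "\<And>j. j \<in> M - {e} \<Longrightarrow> u' j = u j" by (auto simp: u'_def)
  have split: "(\<Sum>j\<in>M. f j) = f e + (\<Sum>j\<in>M - {e}. f j)" for f :: "'a \<Rightarrow> 'b::comm_monoid_add"
    by (rule sum.remove[OF M e])
  have "H *v w = (\<Sum>j\<in>M. p j *v u' j)"
    unfolding split w using u' by (simp add: add.commute)
  then have "(\<Sum>j\<in>M. \<Sum>k\<in>M. (q j k *v u' j) \<bullet> u' k) + \<kappa> * (\<Sum>j\<in>M. (norm (u' j))\<^sup>2) \<le> (H *v w) \<bullet> w"
    using N by (auto simp: nakano_ge_def)
  moreover have "(\<Sum>j\<in>M. \<Sum>k\<in>M. (q j k *v u' j) \<bullet> u' k) =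
      (\<Sum>j\<in>M - {e}. \<Sum>k\<in>M - {e}. (q j k *v u j) \<bullet> u k) + 2 * ((\<Sum>j\<in>M - {e}. q j e *v u j) \<bullet> v) + (q e e *v v) \<bullet> v"
  proof -
    have "(q e k *v v) \<bullet> u k = (q k e *v u k) \<bullet> v" if "k \<in> M" for k
      using q(1)[OF that] inner_symmetric_matrix[OF q(2)[OF that], of v "u k"] by simp
    then have "(\<Sum>k\<in>M - {e}. (q e k *v v) \<bullet> u' k) = (\<Sum>k\<in>M - {e}. (q k e *v u k) \<bullet> v)"
      by (intro sum.cong) (auto simp: u')
    then show ?thesis
      unfolding split using u' by (simp add: sum.distrib inner_sum_left)
  qed
  moreover have "\<kappa> * (\<Sum>j\<in>M - {e}. (norm (u j))\<^sup>2) \<le> \<kappa> * (\<Sum>j\<in>M. (norm (u' j))\<^sup>2)"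
    unfolding split using u' \<kappa> by (intro mult_left_mono) auto
  ultimately show ?thesis by linarith
qed

text \<open>Convexity of P makes its slice by a line in direction e a single interval from l to u,
  and everything vanishes on the rest of the line, so integrals over [-R, R] reduce to [l, u]. There
  \<open>nakano_open_interval\<close> applies with \<open>b\<close> built from the
  \<open>p j\<close> and \<open>b'\<close> from the \<open>q j e\<close>. The new positivity set is
  the projection of P along e, again open and convex, which is what allows iteration.\<close>

lemma nakano_admissible_fint:
  fixes h :: "'a::euclidean_space \<Rightarrow> real^'r^'r"
  assumes S: "open S" "convex S" "translation_closed S e"
    and e: "e \<in> J" and J: "J \<subseteq> M" "M \<subseteq> Basis"
    and adm: "nakano_admissible S R M J P h p q \<kappa>"
  shows "nakano_admissible S R (M - {e}) (J - {e}) {z. \<exists>y. z + y *\<^sub>R e \<in> P} (fint R e h)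
    (\<lambda>j z. if j = e then 0 else fint R e (p j) z)
    (\<lambda>j k z. if j = e \<or> k = e then 0 else fint R e (q j k) z) (fint R e \<kappa>)"
proof -
  have eB: "e \<in> Basis" and eM: "e \<in> M" using e J by auto
  have fin: "finite M" using finite_subset[OF J(2) finite_Basis] .
  have h: "C2_partials S h p q" and P: "open P" "convex P" "P \<subseteq> S"
    and inP: "\<And>z. z \<in> P \<Longrightarrow> pos_def (h z)"
      "\<And>z. z \<in> P \<Longrightarrow> nakano_ge M (h z) (\<lambda>j. p j z) (\<lambda>j k. q j k z) (\<kappa> z)"
      "\<And>z e. z \<in> P \<Longrightarrow> e \<in> J \<Longrightarrow> \<bar>z \<bullet> e\<bar> < R"
    and outP: "\<And>z. z \<in> S - P \<Longrightarrow> h z = 0" "\<And>z. z \<in> S - P \<Longrightarrow> \<kappa> z = 0"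
      "\<And>z j. z \<in> S - P \<Longrightarrow> j \<in> Basis \<Longrightarrow> p j z = 0"
      "\<And>z j k. z \<in> S - P \<Longrightarrow> j \<in> Basis \<Longrightarrow> k \<in> Basis \<Longrightarrow> q j k z = 0"
    and \<kappa>: "continuous_on S \<kappa>" "\<And>z. z \<in> S \<Longrightarrow> \<kappa> z \<ge> 0"
    using adm unfolding nakano_admissible_def by auto
  let ?P = "{z. \<exists>y. z + y *\<^sub>R e \<in> P}"
  have oP: "open ?P"
  proof -
    have "?P = (\<Union>y. (\<lambda>z. z + y *\<^sub>R e) -` P)" by auto
    also have "open \<dots>"
      by (intro open_UN ballI open_vimage P continuous_intros)
    finally show ?thesis .
  qed
  have cP: "convex ?P"
  proof (rule convexI)
    fix x z and a b :: real assume "x \<in> ?P" "z \<in> ?P" and ab: "0 \<le> a" "0 \<le> b" "a + b = 1"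
    then obtain s t where "x + s *\<^sub>R e \<in> P" "z + t *\<^sub>R e \<in> P" by auto
    then have "a *\<^sub>R (x + s *\<^sub>R e) + b *\<^sub>R (z + t *\<^sub>R e) \<in> P"
      using convexD[OF P(2) _ _ ab] by blast
    then have "(a *\<^sub>R x + b *\<^sub>R z) + (a * s + b * t) *\<^sub>R e \<in> P"
      by (simp add: algebra_simps)
    then show "a *\<^sub>R x + b *\<^sub>R z \<in> ?P" by blast
  qed
  have PS: "?P \<subseteq> S"
  proof
    fix z assume "z \<in> ?P"
    then obtain y where "z + y *\<^sub>R e \<in> S" using P by auto
    from translation_closed_line[OF S(3) this, of y 0] show "z \<in> S" by simp
  qed
  have bd: "\<bar>z \<bullet> e'\<bar> < R" if zP: "z \<in> ?P" and e': "e' \<in> J - {e}" for z e'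
  proof -
    obtain y where "z + y *\<^sub>R e \<in> P" using zP by auto
    from inP(3)[OF this, of e'] e' J eB show ?thesis
      by (auto simp: inner_add_left inner_Basis split: if_splits)
  qed
  let ?L = "\<lambda>z y. z - (z \<bullet> e) *\<^sub>R e + y *\<^sub>R e"
  have LS: "?L z y \<in> S" if "z \<in> S" for z y
    by (rule translation_closed_line[OF S(3) that])
  have LP: "?L z y \<notin> P" if "z \<notin> ?P" for z y
  proof -
    have "?L z y = z + (y - z \<bullet> e) *\<^sub>R e" by (simp add: algebra_simps)
    then show ?thesis using that by (metis mem_Collect_eq)
  qed
  have zero: "fint R e f z = 0" if "z \<in> S - ?P" "\<And>z. z \<in> S - P \<Longrightarrow> f z = 0" for z and f :: "'a \<Rightarrow> 'c::banach"
  proof -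
    have "f (?L z y) = 0" for y using that(1) LS LP by (intro that(2)) blast
    then show ?thesis by (simp add: fint_def)
  qed
  have sym: "transpose (h z) = h z" if "z \<in> S" for z
    using inP(1)[of z] outP(1)[of z] that linear_0[OF bounded_linear.linear[OF bounded_linear_transpose]]
    by (cases "z \<in> P") (auto simp: pos_def_def)
  have main: "pos_def (fint R e h z) \<and> nakano_ge (M - {e}) (fint R e h z)
      (\<lambda>j. if j = e then 0 else fint R e (p j) z) (\<lambda>j k. if j = e \<or> k = e then 0 else fint R e (q j k) z) (fint R e \<kappa> z)"
    if z: "z \<in> ?P" for z
  proof -
    have zS: "z \<in> S" using z PS by blast
    let ?l = "?L z"
    have le: "?l y \<bullet> e = y" for y using eB by (simp add: inner_diff_left inner_add_left)
    define I where "I = ?l -` P"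
    have I: "open I" "convex I" "I \<noteq> {}" "I \<subseteq> {-R<..<R}"
    proof -
      show "open I" unfolding I_def by (intro open_vimage P continuous_intros)
      show "convex I"
      proof (rule convexI)
        fix s t and a b :: real assume "s \<in> I" "t \<in> I" and ab: "0 \<le> a" "0 \<le> b" "a + b = 1"
        then have "a *\<^sub>R ?l s + b *\<^sub>R ?l t \<in> P"
          using convexD[OF P(2) _ _ ab] by (auto simp: I_def)
        moreover have "a *\<^sub>R ?l s + b *\<^sub>R ?l t = (a + b) *\<^sub>R (z - (z \<bullet> e) *\<^sub>R e) + (a *\<^sub>R s + b *\<^sub>R t) *\<^sub>R e"
          by (simp add: algebra_simps)
        ultimately show "a *\<^sub>R s + b *\<^sub>R t \<in> I" using ab by (simp add: I_def)
      qed
      obtain y where "z + y *\<^sub>R e \<in> P" using z by auto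
      moreover have "z + y *\<^sub>R e = ?l (y + z \<bullet> e)" by (simp add: algebra_simps)
      ultimately show "I \<noteq> {}" by (auto simp: I_def)
      show "I \<subseteq> {-R<..<R}"
        using inP(3)[OF _ e] le by (fastforce simp: I_def abs_less_iff)
    qed
    obtain l u where lu: "l < u" "I = {l<..<u}" "-R \<le> l" "u \<le> R"
      using open_convex_real_interval[OF I] by blast
    have cl: "continuous_on A (\<lambda>y. f (?l y))" if "continuous_on S f" for f :: "'a \<Rightarrow> 'c::topological_space" and A
      by (rule continuous_on_compose2[OF that]) (auto intro!: continuous_intros LS[OF zS])
    have fint: "fint R e f z = integral {l..u} (\<lambda>y. f (?l y))"
      if "continuous_on S f" "\<And>z. z \<in> S - P \<Longrightarrow> f z = 0" for f :: "'a \<Rightarrow> 'c::banach"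
    proof -
      have "((\<lambda>y. f (?l y)) has_integral integral {l..u} (\<lambda>y. f (?l y))) {l..u}"
        by (intro integrable_integral integrable_continuous_real cl that)
      then have "((\<lambda>y. f (?l y)) has_integral integral {l..u} (\<lambda>y. f (?l y))) {-R..R}"
      proof (rule has_integral_on_superset)
        fix y assume "y \<notin> {l..u}"
        then have "y \<notin> I" unfolding lu(2) by auto
        then show "f (?l y) = 0" using LS[OF zS] by (intro that(2)) (auto simp: I_def)
      qed (use lu in auto)
      then show ?thesis unfolding fint_def by (rule integral_unique)
    qed
    note ch = C2_partials_continuous(1)[OF h]
    have fh: "fint R e h z = integral {l..u} (\<lambda>y. h (?l y))"
      by (rule fint[OF ch outP(1)])
    have fp: "fint R e (p j) z = integral {l..u} (\<lambda>y. p j (?l y))" if "j \<in> Basis" for j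
      by (rule fint[OF C2_partials_continuous(2)[OF h that] outP(3)[OF _ that]])
    have fq: "fint R e (q j k) z = integral {l..u} (\<lambda>y. q j k (?l y))" if "j \<in> Basis" "k \<in> Basis" for j k
      by (rule fint[OF C2_partialsD(3)[OF h that] outP(4)[OF _ that]])
    have fk: "fint R e \<kappa> z = integral {l..u} (\<lambda>y. \<kappa> (?l y))"
      by (rule fint[OF \<kappa>(1) outP(2)])
    have posI: "pos_def (h (?l y))" if "y \<in> {l<..<u}" for y
    proof -
      have "y \<in> I" using that lu(2) by simp
      then show ?thesis using inP(1) by (simp add: I_def)
    qed
    \<comment> \<open>At l and u the line leaves P and h is 0; the midpoint serves as the point of
      definiteness.\<close>
    have H: "pos_def (fint R e h z)"
      unfolding fh
    proof (rule pos_def_integral[OF lu(1) cl[OF ch], where x = "(l + u) / 2"])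
      fix y show "pos_def (h (?l y)) \<or> h (?l y) = 0"
        using inP(1)[of "?l y"] outP(1)[of "?l y"] LS[OF zS, of y] by blast
    qed (use lu posI in auto)
    moreover have "nakano_ge (M - {e}) (fint R e h z) (\<lambda>j. if j = e then 0 else fint R e (p j) z)
        (\<lambda>j k. if j = e \<or> k = e then 0 else fint R e (q j k) z) (fint R e \<kappa> z)"
      unfolding nakano_ge_def
    proof (intro allI impI)
      fix v :: "'a \<Rightarrow> real^'r" and c
      assume c: "fint R e h z *v c = (\<Sum>j\<in>M - {e}. (if j = e then 0 else fint R e (p j) z) *v v j)"
      let ?M = "M - {e}"
      have MB: "j \<in> Basis" if "j \<in> ?M" for j using that J by auto
      define b where "b y = (\<Sum>j\<in>?M. p j (?l y) *v v j)" for y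
      define b' where "b' y = (\<Sum>j\<in>?M. q j e (?l y) *v v j)" for y
      define s where "s y = (\<Sum>j\<in>?M. \<Sum>k\<in>?M. (q j k (?l y) *v v j) \<bullet> v k) + \<kappa> (?l y) * (\<Sum>j\<in>?M. (norm (v j))\<^sup>2)" for y
      have D: "((\<lambda>y. f (?l y)) has_vector_derivative f' e (?l y)) (at y)"
        if "\<And>z. z \<in> S \<Longrightarrow> (f has_derivative (\<lambda>h. \<Sum>j\<in>Basis. (h \<bullet> j) *\<^sub>R f' j z)) (at z)"
        for f :: "'a \<Rightarrow> real^'r^'r" and f' y
        by (rule has_derivative_line_Basis[OF that[OF LS[OF zS]] eB])
      note iM = integrable_continuous_real[OF cl]
      have ib: "integral {l..u} b = (\<Sum>j\<in>?M. fint R e (p j) z *v v j)"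
      proof -
        have "integral {l..u} b = (\<Sum>j\<in>?M. integral {l..u} (\<lambda>y. p j (?l y) *v v j))"
          unfolding b_def[abs_def] using fin MB
          by (intro integral_sum) (auto intro!: integrable_continuous_real mv.continuous_on cl C2_partials_continuous(2)[OF h])
        also have "\<dots> = (\<Sum>j\<in>?M. fint R e (p j) z *v v j)"
          using MB by (intro sum.cong refl)
            (simp add: fp integral_matrix_vector iM C2_partials_continuous(2)[OF h])
        finally show ?thesis .
      qed
      have isum: "integral {l..u} s = (\<Sum>j\<in>?M. \<Sum>k\<in>?M. (fint R e (q j k) z *v v j) \<bullet> v k) + fint R e \<kappa> z * (\<Sum>j\<in>?M. (norm (v j))\<^sup>2)"
      proof -
        have iq: "(\<lambda>y. (q j k (?l y) *v v j) \<bullet> v k) integrable_on {l..u}"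
          "integral {l..u} (\<lambda>y. (q j k (?l y) *v v j) \<bullet> v k) = (fint R e (q j k) z *v v j) \<bullet> v k"
          if "j \<in> ?M" "k \<in> ?M" for j k
        proof -
          note c1 = cl[OF C2_partialsD(3)[OF h MB[OF that(1)] MB[OF that(2)]]]
          show "(\<lambda>y. (q j k (?l y) *v v j) \<bullet> v k) integrable_on {l..u}"
            by (intro integrable_continuous_real continuous_intros mv.continuous_on c1)
          show "integral {l..u} (\<lambda>y. (q j k (?l y) *v v j) \<bullet> v k) = (fint R e (q j k) z *v v j) \<bullet> v k"
            using c1 by (simp add: fq MB[OF that(1)] MB[OF that(2)] integral_inner_right integral_matrix_vector
              integrable_continuous_real mv.continuous_on)
        qed
        have i2: "(\<lambda>y. \<kappa> (?l y) * (\<Sum>j\<in>?M. (norm (v j))\<^sup>2)) integrable_on {l..u}"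
          by (intro integrable_continuous_real continuous_intros cl \<kappa>)
        have "integral {l..u} s = integral {l..u} (\<lambda>y. \<Sum>j\<in>?M. \<Sum>k\<in>?M. (q j k (?l y) *v v j) \<bullet> v k)
           + integral {l..u} (\<lambda>y. \<kappa> (?l y) * (\<Sum>j\<in>?M. (norm (v j))\<^sup>2))"
          unfolding s_def[abs_def] using fin
          by (intro Henstock_Kurzweil_Integration.integral_add i2 integrable_sum) (auto intro!: iq(1))
        also have "integral {l..u} (\<lambda>y. \<Sum>j\<in>?M. \<Sum>k\<in>?M. (q j k (?l y) *v v j) \<bullet> v k)
            = (\<Sum>j\<in>?M. \<Sum>k\<in>?M. integral {l..u} (\<lambda>y. (q j k (?l y) *v v j) \<bullet> v k))"
        proof -
          have "integral {l..u} (\<lambda>y. \<Sum>j\<in>?M. \<Sum>k\<in>?M. (q j k (?l y) *v v j) \<bullet> v k)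
            = (\<Sum>j\<in>?M. integral {l..u} (\<lambda>y. \<Sum>k\<in>?M. (q j k (?l y) *v v j) \<bullet> v k))"
            using fin by (intro integral_sum integrable_sum iq(1)) auto
          also have "\<dots> = (\<Sum>j\<in>?M. \<Sum>k\<in>?M. integral {l..u} (\<lambda>y. (q j k (?l y) *v v j) \<bullet> v k))"
            using fin by (intro sum.cong refl integral_sum iq(1)) auto
          finally show ?thesis .
        qed
        finally show ?thesis
          by (simp add: iq(2) fk)
      qed
      have "integral {l..u} s \<le> (integral {l..u} (\<lambda>y. h (?l y)) *v c) \<bullet> c"
      proof (rule nakano_open_interval[OF lu(1), where b = b and b' = b'
            and hx = "\<lambda>y. p e (?l y)" and hxx = "\<lambda>y. q e e (?l y)"])
        fix y
        show "((\<lambda>y. h (?l y)) has_vector_derivative p e (?l y)) (at y)"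
          by (rule D[OF C2_partialsD(1)[OF h]])
        show "((\<lambda>y. p e (?l y)) has_vector_derivative q e e (?l y)) (at y)"
          by (rule D[OF C2_partialsD(2)[OF h _ eB]])
        show "(b has_vector_derivative b' y) (at y)"
          unfolding b_def[abs_def] b'_def
          using MB by (intro has_vector_derivative_sum bounded_linear.has_vector_derivative[OF mv.bounded_linear_left]
              D[OF C2_partialsD(2)[OF h]]) auto
        show "transpose (p e (?l y)) = p e (?l y)"
          by (rule C2_partials_transpose(1)[OF h S(1) LS[OF zS] sym eB eB])
        show "continuous_on {l..u} s"
          unfolding s_def[abs_def] using MB
          by (intro continuous_intros mv.continuous_on cl \<kappa> C2_partialsD(3)[OF h]) auto
        show "integral {l..u} (\<lambda>y. h (?l y)) *v c = integral {l..u} b"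
          using c unfolding ib fh by simp
        show "pos_def (integral {l..u} (\<lambda>y. h (?l y)))"
          using H unfolding fh .
      next
        fix y v' w assume y: "y \<in> {l<..<u}" and w: "h (?l y) *v w = b y + p e (?l y) *v v'"
        have "y \<in> I" using y lu(2) by simp
        then have yP: "?l y \<in> P" by (simp add: I_def)
        show "s y + 2 * (b' y \<bullet> v') + (q e e (?l y) *v v') \<bullet> v' \<le> (h (?l y) *v w) \<bullet> w"
          unfolding s_def b'_def
        proof (rule nakano_ge_split[OF inP(2)[OF yP] \<kappa>(2)[OF LS[OF zS]] eM fin])
          fix j assume "j \<in> M"
          then have j: "j \<in> Basis" using J by auto
          show "q e j (?l y) = q j e (?l y)"
            by (rule C2_partials_symmetric[OF h S(1) LS[OF zS] eB j])
          show "transpose (q j e (?l y)) = q j e (?l y)"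
            by (rule C2_partials_transpose(2)[OF h S(1) LS[OF zS] sym j eB])
        qed (use w in \<open>simp add: b_def\<close>)
      qed (rule posI)
      then show "(\<Sum>j\<in>?M. \<Sum>k\<in>?M. ((if j = e \<or> k = e then 0 else fint R e (q j k) z) *v v j) \<bullet> v k) +
          fint R e \<kappa> z * (\<Sum>j\<in>?M. (norm (v j))\<^sup>2) \<le> (fint R e h z *v c) \<bullet> c"
        unfolding isum fh by simp
    qed
    ultimately show ?thesis ..
  qed
  show ?thesis
    unfolding nakano_admissible_def
  proof (intro conjI ballI)
    show "C2_partials S (fint R e h) (\<lambda>j z. if j = e then 0 else fint R e (p j) z)
      (\<lambda>j k z. if j = e \<or> k = e then 0 else fint R e (q j k) z)"
      by (rule C2_partials_fint[OF S eB h])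
    show "continuous_on S (fint R e \<kappa>)"
      by (rule continuous_on_fint[OF \<kappa>(1) S(3)])
    fix z assume "z \<in> S"
    \<comment> \<open>An integral that does not exist is 0 by convention, so the sign is right in
      either case.\<close>
    then show "fint R e \<kappa> z \<ge> 0"
      unfolding fint_def using \<kappa>(2) LS
      by (cases "(\<lambda>y. \<kappa> (?L z y)) integrable_on {-R..R}")
        (auto intro!: integral_nonneg simp: not_integrable_integral)
  next
    fix z assume z: "z \<in> S - ?P"
    show "fint R e h z = 0" by (rule zero[OF z outP(1)])
    show "fint R e \<kappa> z = 0" by (rule zero[OF z outP(2)])
    fix j :: 'a assume j: "j \<in> Basis"
    show "(if j = e then 0 else fint R e (p j) z) = 0"
      using zero[OF z outP(3)[OF _ j]] by simp
    fix k :: 'a assume k: "k \<in> Basis"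
    show "(if j = e \<or> k = e then 0 else fint R e (q j k) z) = 0"
      using zero[OF z outP(4)[OF _ j k]] by simp
  qed (use oP cP PS bd main in auto)
qed

section \<open>Iterated integration and Lebesgue measure\<close>

primrec fints :: "real \<Rightarrow> 'a::euclidean_space list \<Rightarrow> ('a \<Rightarrow> 'c::banach) \<Rightarrow> 'a \<Rightarrow> 'c" where
  "fints R [] f = f"
| "fints R (e # es) f = fints R es (fint R e f)"

text \<open>Besides positivity the conclusion keeps what identifies the result later: coefficients
  in the remaining directions are iterated integrals of the original ones, and P' contains P and is
  invariant in all integrated directions, so it contains every point lying over the projection of
  P.\<close>

lemma nakano_admissible_fints:
  fixes h :: "'a::euclidean_space \<Rightarrow> real^'r^'r"
  assumes "open S" "convex S" "\<And>e. e \<in> set es \<Longrightarrow> translation_closed S e"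
    and "distinct es" "set es \<subseteq> J" "J \<subseteq> M" "M \<subseteq> Basis"
    and "nakano_admissible S R M J P h p q \<kappa>"
  shows "\<exists>P' p' q'. nakano_admissible S R (M - set es) (J - set es) P' (fints R es h) p' q' (fints R es \<kappa>) \<and>
    (\<forall>j. j \<notin> set es \<longrightarrow> p' j = fints R es (p j)) \<and>
    (\<forall>j k. j \<notin> set es \<longrightarrow> k \<notin> set es \<longrightarrow> q' j k = fints R es (q j k)) \<and>
    P \<subseteq> P' \<and> (\<forall>e. translation_closed P e \<or> e \<in> set es \<longrightarrow> translation_closed P' e)"
  using assms
proof (induction es arbitrary: h p q \<kappa> M J P)
  case Nil
  then show ?case by auto
next
  case (Cons e es)
  let ?P = "{z. \<exists>y. z + y *\<^sub>R e \<in> P}"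
  have *: "nakano_admissible S R (M - {e}) (J - {e}) ?P (fint R e h)
    (\<lambda>j z. if j = e then 0 else fint R e (p j) z)
    (\<lambda>j k z. if j = e \<or> k = e then 0 else fint R e (q j k) z) (fint R e \<kappa>)"
    using Cons.prems by (intro nakano_admissible_fint) auto
  have "\<exists>P' p' q'. nakano_admissible S R (M - {e} - set es) (J - {e} - set es) P'
      (fints R es (fint R e h)) p' q' (fints R es (fint R e \<kappa>)) \<and>
    (\<forall>j. j \<notin> set es \<longrightarrow> p' j = fints R es (\<lambda>z. if j = e then 0 else fint R e (p j) z)) \<and>
    (\<forall>j k. j \<notin> set es \<longrightarrow> k \<notin> set es \<longrightarrow>
      q' j k = fints R es (\<lambda>z. if j = e \<or> k = e then 0 else fint R e (q j k) z)) \<and>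
    ?P \<subseteq> P' \<and> (\<forall>e'. translation_closed ?P e' \<or> e' \<in> set es \<longrightarrow> translation_closed P' e')"
    using Cons.prems by (intro Cons.IH *) auto
  then obtain P' p' q' where all: "nakano_admissible S R (M - {e} - set es) (J - {e} - set es) P'
      (fints R es (fint R e h)) p' q' (fints R es (fint R e \<kappa>)) \<and>
    (\<forall>j. j \<notin> set es \<longrightarrow> p' j = fints R es (\<lambda>z. if j = e then 0 else fint R e (p j) z)) \<and>
    (\<forall>j k. j \<notin> set es \<longrightarrow> k \<notin> set es \<longrightarrow>
      q' j k = fints R es (\<lambda>z. if j = e \<or> k = e then 0 else fint R e (q j k) z)) \<and>
    ?P \<subseteq> P' \<and> (\<forall>e'. translation_closed ?P e' \<or> e' \<in> set es \<longrightarrow> translation_closed P' e')"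
    by (elim exE)
  note 1 = all[THEN conjunct1]
    and p' = all[THEN conjunct2, THEN conjunct1, rule_format]
    and q' = all[THEN conjunct2, THEN conjunct2, THEN conjunct1, rule_format]
    and P' = all[THEN conjunct2, THEN conjunct2, THEN conjunct2, THEN conjunct1]
      all[THEN conjunct2, THEN conjunct2, THEN conjunct2, THEN conjunct2, rule_format]
  have "translation_closed ?P e"
    unfolding translation_closed_def
  proof (intro ballI allI)
    fix z y assume "z \<in> ?P"
    then obtain s where "z + s *\<^sub>R e \<in> P" by auto
    moreover have "z + s *\<^sub>R e = (z + y *\<^sub>R e) + (s - y) *\<^sub>R e" by (simp add: algebra_simps)
    ultimately have "(z + y *\<^sub>R e) + (s - y) *\<^sub>R e \<in> P" by simp
    then show "z + y *\<^sub>R e \<in> ?P" by blast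
  qed
  moreover have "translation_closed ?P e'" if tc: "translation_closed P e'" for e'
    unfolding translation_closed_def
  proof (intro ballI allI)
    fix z y assume "z \<in> ?P"
    then obtain s where "z + s *\<^sub>R e \<in> P" by auto
    then have "(z + s *\<^sub>R e) + y *\<^sub>R e' \<in> P" using tc by (auto simp: translation_closed_def)
    then have "(z + y *\<^sub>R e') + s *\<^sub>R e \<in> P" by (simp add: add_ac)
    then show "z + y *\<^sub>R e' \<in> ?P" by blast
  qed
  moreover have "P \<subseteq> ?P"
  proof
    fix z assume "z \<in> P"
    then have "z + 0 *\<^sub>R e \<in> P" by simp
    then show "z \<in> ?P" by blast
  qed
  moreover have "M - set (e # es) = M - {e} - set es" "J - set (e # es) = J - {e} - set es" by auto
  ultimately show ?case
    using 1 p' q' P' by (intro exI[of _ P'] exI[of _ p'] exI[of _ q']) auto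
qed

lemma fint_Pair: "(\<lambda>x. fint R (0, e) f (t, x)) = fint R e (\<lambda>x. f (t, x))"
  by (simp add: fint_def fun_eq_iff)

lemma fints_Pair: "fints R (map (Pair 0) es) f (t, x) = fints R es (\<lambda>x. f (t, x)) x"
  by (induction es arbitrary: f) (simp_all add: fint_Pair)

lemma fints_zero: "fints R es (\<lambda>_::'a::euclidean_space. 0::'c::banach) = (\<lambda>_. 0)"
proof (induction es)
  case (Cons e es)
  have "fint R e (\<lambda>_. 0::'c) = (\<lambda>_. 0)" by (simp add: fint_def fun_eq_iff)
  with Cons show ?case by simp
qed simp

lemma lborel_integral_eq_integral:
  fixes g :: "real \<Rightarrow> 'c::euclidean_space"
  assumes g: "continuous_on UNIV g" and supp: "\<And>y. g y \<noteq> 0 \<Longrightarrow> \<bar>y\<bar> \<le> R"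
  shows "(\<integral>y. g y \<partial>lborel) = integral {-R..R} g"
proof -
  have "set_integrable lborel {-R..R} g"
    by (rule borel_integrable_atLeastAtMost') (rule continuous_on_subset[OF g], simp)
  then have "(LINT y:{-R..R}|lborel. g y) = integral {-R..R} g"
    by (rule set_borel_integral_eq_integral)
  moreover have "(LINT y:{-R..R}|lborel. g y) = (\<integral>y. g y \<partial>lborel)"
    unfolding set_lebesgue_integral_def
  proof (rule Bochner_Integration.integral_cong)
    fix y show "indicator {-R..R} y *\<^sub>R g y = g y"
      using supp[of y] by (cases "g y = 0") (auto simp: abs_le_iff)
  qed simp
  ultimately show ?thesis by simp
qed

lemma inner_Basis_sum:
  fixes y :: "'a::euclidean_space \<Rightarrow> real"
  assumes "I \<subseteq> Basis" "e \<in> Basis"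
  shows "(\<Sum>b\<in>I. y b *\<^sub>R b) \<bullet> e = (if e \<in> I then y e else 0)"
proof -
  have fin: "finite I" using assms(1) finite_Basis by (rule finite_subset)
  have "(\<Sum>b\<in>I. y b *\<^sub>R b) \<bullet> e = (\<Sum>b\<in>I. if b = e then y b else 0)"
    unfolding inner_sum_left using assms by (intro sum.cong) (auto simp: inner_Basis)
  then show ?thesis using fin by (simp add: sum.delta)
qed

text \<open>Fubini, one coordinate at a time: the head of the list is the innermost variable. As c
  has no component along \<open>es\<close>, the point c plus a combination of the basis vectors has
  exactly the prescribed coordinates, so the support condition bounds y to a box; boundedness on it
  gives integrability.\<close>

lemma fints_eq_PiM_integral:
  fixes f :: "'a::euclidean_space \<Rightarrow> 'c::euclidean_space"
  assumes "distinct es" "set es \<subseteq> Basis" "continuous_on UNIV f"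
    and "\<And>x e. e \<in> set es \<Longrightarrow> f x \<noteq> 0 \<Longrightarrow> \<bar>x \<bullet> e\<bar> \<le> R" and "\<And>e. e \<in> set es \<Longrightarrow> c \<bullet> e = 0"
  shows "fints R es f c = (\<integral>y. f (c + (\<Sum>b\<in>set es. y b *\<^sub>R b)) \<partial>(\<Pi>\<^sub>M b\<in>set es. lborel))"
  using assms
proof (induction es arbitrary: f)
  case Nil
  show ?case
    by (simp add: PiM_empty lebesgue_integral_count_space_finite)
next
  case (Cons e es)
  let ?I = "set es"
  interpret product_sigma_finite "\<lambda>b::'a. lborel :: real measure"
    by standard
  have e: "e \<in> Basis" "e \<notin> ?I" and I: "?I \<subseteq> Basis" "finite ?I" using Cons.prems by auto
  note cf = Cons.prems(3) and supp = Cons.prems(4)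
  define F where "F y = f (c + (\<Sum>b\<in>insert e ?I. y b *\<^sub>R b))" for y
  have comp: "(c + (\<Sum>b\<in>insert e ?I. y b *\<^sub>R b)) \<bullet> b = y b" if "b \<in> insert e ?I" for y b
    using that Cons.prems(5)[of b] e I by (subst inner_add_left, subst inner_Basis_sum) auto
  have int: "integrable (\<Pi>\<^sub>M b\<in>insert e ?I. lborel) F"
  proof -
    let ?A = "Pi\<^sub>E (insert e ?I) (\<lambda>_. {-R..R})"
    \<comment> \<open>This ball contains the image of the box: each summand of the combination has
      norm at most |R|.\<close>
    have "bounded (f ` cball c (\<bar>R\<bar> * card (insert e ?I)))"
      by (intro compact_imp_bounded compact_continuous_image continuous_on_subset[OF cf]) auto
    then obtain B where B: "\<And>x. x \<in> cball c (\<bar>R\<bar> * card (insert e ?I)) \<Longrightarrow> norm (f x) \<le> B"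
      unfolding bounded_iff by blast
    show ?thesis
    proof (rule integrableI_bounded_set[where A = ?A and B = B])
      show "?A \<in> sets (\<Pi>\<^sub>M b\<in>insert e ?I. lborel)"
        by (intro sets_PiM_I_finite) (use I in auto)
      have "(\<lambda>y. c + (\<Sum>b\<in>insert e ?I. y b *\<^sub>R b)) \<in> borel_measurable (\<Pi>\<^sub>M b\<in>insert e ?I. lborel)"
        by measurable
      from measurable_compose[OF this borel_measurable_continuous_onI[OF cf]]
      show "F \<in> borel_measurable (\<Pi>\<^sub>M b\<in>insert e ?I. lborel)"
        by (simp add: F_def[abs_def])
      have "emeasure (\<Pi>\<^sub>M b\<in>insert e ?I. lborel) ?A = (\<Prod>b\<in>insert e ?I. emeasure lborel {-R..R})"
        by (rule emeasure_PiM) (use I in auto)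
      also have "\<dots> < \<infinity>"
        by (simp add: emeasure_lborel_Icc_eq ennreal_prod_eq_top power_less_top_ennreal less_top[symmetric] ennreal_mult_eq_top_iff power_eq_top_ennreal I e)
      finally show "emeasure (\<Pi>\<^sub>M b\<in>insert e ?I. lborel) ?A < \<infinity>" .
      show "AE y in \<Pi>\<^sub>M b\<in>insert e ?I. lborel. y \<in> ?A \<longrightarrow> norm (F y) \<le> B"
      proof (intro AE_I2 impI)
        fix y assume y: "y \<in> ?A"
        have "norm (\<Sum>b\<in>insert e ?I. y b *\<^sub>R b) \<le> (\<Sum>b\<in>insert e ?I. \<bar>R\<bar>)"
        proof (rule sum_norm_le)
          fix b assume "b \<in> insert e ?I"
          moreover from this have "\<bar>y b\<bar> \<le> \<bar>R\<bar>" using y by (force simp: PiE_iff)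
          ultimately show "norm (y b *\<^sub>R b) \<le> \<bar>R\<bar>" using e I by auto
        qed
        then show "norm (F y) \<le> B"
          unfolding F_def by (intro B) (simp add: dist_norm norm_minus_commute mult.commute)
      qed
      show "AE y in \<Pi>\<^sub>M b\<in>insert e ?I. lborel. y \<notin> ?A \<longrightarrow> F y = 0"
      proof (intro AE_I2 impI)
        fix y assume y: "y \<in> space (\<Pi>\<^sub>M b\<in>insert e ?I. lborel)" "y \<notin> ?A"
        then have "\<exists>b\<in>insert e ?I. y b \<notin> {-R..R}"
          by (auto simp: space_PiM PiE_iff)
        then obtain b where b: "b \<in> insert e ?I" "\<not> \<bar>y b\<bar> \<le> R"
          by (auto simp: abs_le_iff minus_le_iff)
        show "F y = 0"
        proof (rule ccontr)
          assume "F y \<noteq> 0"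
          then have "\<bar>(c + (\<Sum>b\<in>insert e ?I. y b *\<^sub>R b)) \<bullet> b\<bar> \<le> R"
            using b(1) supp unfolding F_def by auto
          with b show False by (simp add: comp)
        qed
      qed
    qed
  qed
  have inner: "(\<integral>t. F (x(e := t)) \<partial>lborel) = fint R e f (c + (\<Sum>b\<in>?I. x b *\<^sub>R b))" for x
  proof -
    let ?z = "c + (\<Sum>b\<in>?I. x b *\<^sub>R b)"
    have ze: "?z \<bullet> e = 0"
      using e Cons.prems(5)[of e] by (simp add: inner_add_left inner_Basis_sum[OF I(1)])
    have eq: "F (x(e := t)) = f (?z + t *\<^sub>R e)" for t
    proof -
      have "(\<Sum>b\<in>insert e ?I. (x(e := t)) b *\<^sub>R b) = t *\<^sub>R e + (\<Sum>b\<in>?I. (x(e := t)) b *\<^sub>R b)"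
        using e I by (subst sum.insert) auto
      also have "(\<Sum>b\<in>?I. (x(e := t)) b *\<^sub>R b) = (\<Sum>b\<in>?I. x b *\<^sub>R b)"
        using e by (intro sum.cong) auto
      finally show ?thesis by (simp add: F_def add_ac)
    qed
    have "(\<integral>t. f (?z + t *\<^sub>R e) \<partial>lborel) = integral {-R..R} (\<lambda>t. f (?z + t *\<^sub>R e))"
    proof (rule lborel_integral_eq_integral)
      show "continuous_on UNIV (\<lambda>t. f (?z + t *\<^sub>R e))"
        by (rule continuous_on_compose2[OF cf]) (auto intro!: continuous_intros)
      fix t assume "f (?z + t *\<^sub>R e) \<noteq> 0"
      then have "\<bar>(?z + t *\<^sub>R e) \<bullet> e\<bar> \<le> R" by (intro supp) auto
      moreover have "(?z + t *\<^sub>R e) \<bullet> e = t"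
        using ze e by (simp only: inner_add_left[of ?z]) simp
      ultimately show "\<bar>t\<bar> \<le> R" by simp
    qed
    then show ?thesis unfolding eq fint_def ze by simp
  qed
  have "fints R (e # es) f c = (\<integral>x. fint R e f (c + (\<Sum>b\<in>?I. x b *\<^sub>R b)) \<partial>(\<Pi>\<^sub>M b\<in>?I. lborel))"
  proof (simp only: fints.simps, rule Cons.IH)
    show "continuous_on UNIV (fint R e f)"
      by (rule continuous_on_fint[OF cf]) (simp add: translation_closed_def)
    fix x b assume b: "b \<in> ?I" and nz: "fint R e f x \<noteq> 0"
    have "\<exists>y. f (x - (x \<bullet> e) *\<^sub>R e + y *\<^sub>R e) \<noteq> 0"
    proof (rule ccontr)
      assume "\<not> (\<exists>y. f (x - (x \<bullet> e) *\<^sub>R e + y *\<^sub>R e) \<noteq> 0)"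
      then have "fint R e f x = 0" by (simp add: fint_def)
      with nz show False ..
    qed
    then obtain y where "f (x - (x \<bullet> e) *\<^sub>R e + y *\<^sub>R e) \<noteq> 0" ..
    then have "\<bar>(x - (x \<bullet> e) *\<^sub>R e + y *\<^sub>R e) \<bullet> b\<bar> \<le> R"
      using b by (intro supp) auto
    moreover have "e \<bullet> b = 0" using b e I by (auto simp: inner_Basis)
    ultimately show "\<bar>x \<bullet> b\<bar> \<le> R" by (simp add: inner_add_left inner_diff_left)
  qed (use Cons.prems in auto)
  also have "\<dots> = (\<integral>x. (\<integral>t. F (x(e := t)) \<partial>lborel) \<partial>(\<Pi>\<^sub>M b\<in>?I. lborel))"
    unfolding inner ..
  also have "\<dots> = (\<integral>y. F y \<partial>(\<Pi>\<^sub>M b\<in>insert e ?I. lborel))"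
    by (rule product_integral_insert[OF I(2) e(2) int, symmetric])
  finally show ?case by (simp add: F_def)
qed

lemma fints_eq_lborel_integral:
  fixes f :: "'a::euclidean_space \<Rightarrow> 'c::euclidean_space"
  assumes es: "distinct es" "set es = Basis" and f: "continuous_on UNIV f"
    and supp: "\<And>x e. e \<in> Basis \<Longrightarrow> f x \<noteq> 0 \<Longrightarrow> \<bar>x \<bullet> e\<bar> \<le> R"
  shows "fints R es f 0 = (\<integral>x. f x \<partial>lborel)"
proof -
  have "fints R es f 0 = (\<integral>y. f (0 + (\<Sum>b\<in>set es. y b *\<^sub>R b)) \<partial>(\<Pi>\<^sub>M b\<in>set es. lborel))"
    using es f supp by (intro fints_eq_PiM_integral) auto
  also have "\<dots> = (\<integral>x. f x \<partial>(distr (\<Pi>\<^sub>M b\<in>Basis. lborel) borel (\<lambda>y. \<Sum>b\<in>Basis. y b *\<^sub>R b)))"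
    unfolding es(2) by (subst integral_distr) (auto intro!: borel_measurable_continuous_onI f)
  finally show ?thesis unfolding lborel_eq[symmetric] .
qed

text \<open>With e at the head of the list, the innermost integral is a difference of values of f at
  coordinate R and - R, and these vanish because the support bound is strict. For negative R the
  support condition on f' leaves only f' = 0.\<close>

lemma integral_partial_derivative_zero:
  fixes f :: "'a::euclidean_space \<Rightarrow> 'c::euclidean_space"
  assumes e: "e \<in> Basis" and f': "continuous_on UNIV f'"
    and d: "\<And>x y. ((\<lambda>y. f (x + y *\<^sub>R e)) has_vector_derivative f' (x + y *\<^sub>R e)) (at y)"
    and supp: "\<And>x b. b \<in> Basis \<Longrightarrow> f x \<noteq> 0 \<Longrightarrow> \<bar>x \<bullet> b\<bar> < R"
    and supp': "\<And>x b. b \<in> Basis \<Longrightarrow> f' x \<noteq> 0 \<Longrightarrow> \<bar>x \<bullet> b\<bar> < R"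
  shows "(\<integral>x. f' x \<partial>lborel) = 0"
proof (cases "R \<ge> 0")
  case True
  obtain es where es: "set es = Basis - {e}" "distinct es"
    using finite_distinct_list[of "Basis - {e}"] by auto
  have "fint R e f' x = 0" for x
  proof -
    let ?z = "x - (x \<bullet> e) *\<^sub>R e"
    have "((\<lambda>y. f' (?z + y *\<^sub>R e)) has_integral f (?z + R *\<^sub>R e) - f (?z + (-R) *\<^sub>R e)) {-R..R}"
      by (rule fundamental_theorem_of_calculus) (use True in \<open>auto intro: has_vector_derivative_at_within d\<close>)
    moreover have fz: "f (?z + y *\<^sub>R e) = 0" if "\<bar>y\<bar> = R" for y
    proof (rule ccontr)
      assume "f (?z + y *\<^sub>R e) \<noteq> 0"
      from supp[OF e this] e that show False by (simp add: inner_add_left inner_diff_left)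
    qed
    have "f (?z + R *\<^sub>R e) = 0" "f (?z + (-R) *\<^sub>R e) = 0"
      by (rule fz, use True in simp)+
    ultimately show ?thesis unfolding fint_def by (simp add: integral_unique)
  qed
  then have "fint R e f' = (\<lambda>_. 0)" by blast
  then have "fints R (e # es) f' 0 = 0" by (simp add: fints_zero)
  then show ?thesis
    using fints_eq_lborel_integral[of "e # es" f' R] es e f' supp' by (auto simp: less_imp_le insert_absorb)
next
  case False
  then have "f' x = 0" for x
    using supp'[OF e, of x] by (meson abs_ge_zero dual_order.trans less_imp_le)
  then show ?thesis by simp
qed

section \<open>A family of cutoff functions\<close>

lemma DERIV_max0_power:
  "((\<lambda>x::real. max 0 x ^ Suc (Suc n)) has_real_derivative real (n + 2) * max 0 x ^ Suc n) (at x)"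
proof -
  consider "x > 0" | "x < 0" | "x = 0" by linarith
  then show ?thesis
  proof cases
    case 1
    have "((\<lambda>x. x ^ Suc (Suc n)) has_real_derivative real (n + 2) * x ^ Suc n) (at x)"
      using DERIV_pow[of "Suc (Suc n)" x] by simp
    then have "((\<lambda>x. max 0 x ^ Suc (Suc n)) has_real_derivative real (n + 2) * x ^ Suc n) (at x)"
      by (rule has_field_derivative_transform_within_open[where S = "{0<..}"]) (use 1 in auto)
    then show ?thesis using 1 by simp
  next
    case 2
    have "((\<lambda>x::real. 0) has_real_derivative 0) (at x)" by simp
    then have "((\<lambda>x. max 0 x ^ Suc (Suc n)) has_real_derivative 0) (at x)"
      by (rule has_field_derivative_transform_within_open[where S = "{..<0}"]) (use 2 in auto)
    then show ?thesis using 2 by simp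
  next
    case 3
    have "((\<lambda>x::real. max 0 x ^ Suc n) \<longlongrightarrow> max 0 0 ^ Suc n) (at 0)"
      by (intro tendsto_intros)
    moreover have "\<forall>\<^sub>F x::real in at 0. max 0 x ^ Suc n = (max 0 x ^ Suc (Suc n) - max 0 0 ^ Suc (Suc n)) / (x - 0)"
      by (auto simp: eventually_at_filter max_def)
    ultimately have "((\<lambda>x::real. (max 0 x ^ Suc (Suc n) - max 0 0 ^ Suc (Suc n)) / (x - 0)) \<longlongrightarrow> max 0 0 ^ Suc n) (at 0)"
      by (rule Lim_transform_eventually)
    then show ?thesis using 3 by (simp add: has_field_derivative_iff)
  qed
qed

text \<open>
  For \<open>r < 0\<close> the function \<open>- ln (1 - exp (k r))\<close> is increasing and convex, and the third power makes
  the extension by zero to \<open>r \<ge> 0\<close> twice continuously differentiable.  The parameter is \<open>k = n + 1\<close>.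
\<close>

definition chi :: "nat \<Rightarrow> real \<Rightarrow> real" where
  "chi n r = max 0 (1 - exp ((real n + 1) * r)) ^ 3"

definition chi' :: "nat \<Rightarrow> real \<Rightarrow> real" where
  "chi' n r = - (3 * (real n + 1) * exp ((real n + 1) * r) * max 0 (1 - exp ((real n + 1) * r)) ^ 2)"

definition chi'' :: "nat \<Rightarrow> real \<Rightarrow> real" where
  "chi'' n r = 6 * (real n + 1)\<^sup>2 * exp ((real n + 1) * r) ^ 2 * max 0 (1 - exp ((real n + 1) * r))
     - 3 * (real n + 1)\<^sup>2 * exp ((real n + 1) * r) * max 0 (1 - exp ((real n + 1) * r)) ^ 2"

lemma DERIV_chi: "(chi n has_real_derivative chi' n r) (at r)"
proof -
  define k where "k = real n + 1"
  have E: "((\<lambda>r. 1 - exp (k * r)) has_real_derivative - (k * exp (k * r))) (at r)"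
    by (auto intro!: derivative_eq_intros)
  from DERIV_chain2[OF DERIV_max0_power[of 1] E]
  show ?thesis
    unfolding chi_def[abs_def] chi'_def k_def[symmetric]
    by (simp add: numeral_3_eq_3 numeral_2_eq_2 algebra_simps)
qed

lemma DERIV_chi': "(chi' n has_real_derivative chi'' n r) (at r)"
proof -
  define k where "k = real n + 1"
  have E: "((\<lambda>r. 1 - exp (k * r)) has_real_derivative - (k * exp (k * r))) (at r)"
    by (auto intro!: derivative_eq_intros)
  have A: "((\<lambda>r. max 0 (1 - exp (k * r)) ^ 2) has_real_derivative 2 * max 0 (1 - exp (k * r)) * - (k * exp (k * r))) (at r)"
    using DERIV_chain2[OF DERIV_max0_power[of 0] E] by (simp add: numeral_2_eq_2)
  have "((\<lambda>r. - (3 * k * exp (k * r) * max 0 (1 - exp (k * r)) ^ 2)) has_real_derivative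
      - ((3 * k * exp (k * r)) * (2 * max 0 (1 - exp (k * r)) * - (k * exp (k * r))) +
         (3 * k * (k * exp (k * r))) * max 0 (1 - exp (k * r)) ^ 2)) (at r)"
    by (rule DERIV_minus, rule DERIV_mult'[OF _ A]) (auto intro!: derivative_eq_intros)
  then show ?thesis
    unfolding chi'_def[abs_def] chi''_def k_def[symmetric]
    by (simp add: power2_eq_square algebra_simps)
qed

lemma continuous_chi: "continuous_on A (chi n)" "continuous_on A (chi' n)" "continuous_on A (chi'' n)"
  unfolding chi_def[abs_def] chi'_def[abs_def] chi''_def[abs_def] by (intro continuous_intros)+

lemma chi_nonneg_arg: "r \<ge> 0 \<Longrightarrow> chi n r = 0" "r \<ge> 0 \<Longrightarrow> chi' n r = 0" "r \<ge> 0 \<Longrightarrow> chi'' n r = 0"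
  by (simp_all add: chi_def chi'_def chi''_def)

lemma chi_bounds: "0 \<le> chi n r" "chi n r \<le> 1" "chi' n r \<le> 0"
  by (auto simp: chi_def chi'_def power_le_one)

lemma chi_pos: "r < 0 \<Longrightarrow> chi n r > 0"
  by (simp add: chi_def mult_pos_neg)

text \<open>This is \<chi>^2 times (ln \<chi>)'' \<le> 0. In this form it absorbs the term with
  \<chi>'' when a metric is multiplied by \<chi>(\<rho>).\<close>

lemma chi_log_concave: "r < 0 \<Longrightarrow> chi n r * chi'' n r \<le> (chi' n r)\<^sup>2"
proof -
  assume r: "r < 0"
  define k where "k = real n + 1"
  define E where "E = exp (k * r)"
  define m where "m = 1 - E"
  have E: "0 < E" "E < 1" using r by (auto simp: E_def k_def mult_pos_neg)
  then have m: "max 0 (1 - E) = m" "m > 0" by (auto simp: m_def)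
  have "(chi' n r)\<^sup>2 - chi n r * chi'' n r = 3 * k\<^sup>2 * E\<^sup>2 * m ^ 4 + 3 * k\<^sup>2 * E * m ^ 5"
    unfolding chi_def chi'_def chi''_def k_def[symmetric] E_def[symmetric] m(1)
    by (simp add: algebra_simps power2_eq_square power3_eq_cube power4_eq_xxxx numeral_eq_Suc)
  moreover have "\<dots> \<ge> 0" using E m by simp
  ultimately show ?thesis by linarith
qed

text \<open>The constant is 4^4, from the fourth power of s / 4 \<le> exp (s / 4).\<close>

lemma pow4_exp_bound:
  fixes s :: real
  assumes "s \<ge> 0"
  shows "s ^ 4 * exp (- s) \<le> 256"
proof -
  have "s / 4 \<le> exp (s / 4)"
    using exp_ge_add_one_self[of "s / 4"] by linarith
  then have "(s / 4) ^ 4 \<le> exp (s / 4) ^ 4"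
    using assms by (intro power_mono) auto
  also have "exp (s / 4) ^ 4 = exp s"
    by (simp add: exp_of_nat_mult[symmetric])
  finally have "s ^ 4 \<le> 256 * exp s" by (simp add: power_divide)
  then have "s ^ 4 * exp (- s) \<le> 256 * exp s * exp (- s)"
    by (intro mult_right_mono) auto
  moreover have "exp s * exp (- s) = 1" by (simp flip: exp_add)
  ultimately show ?thesis by (simp add: mult.assoc)
qed

text \<open>With k = n + 1 and s = - k r the exponential bound reads k^4 r^4 exp (k r) \<le> 256,
  whereas \<chi>' and \<chi>'' grow at most like k^2 exp (k r); the surplus powers of k give the
  decay. In \<chi>'' the remaining factor is at most 6 + 3, so the constant is 2304 = 9 *
  256.\<close>

lemma pow4_chi:
  shows "\<bar>r ^ 4 * chi' n r\<bar> \<le> 2304 / (real n + 1)" "\<bar>r ^ 4 * chi'' n r\<bar> \<le> 2304 / (real n + 1)"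
proof -
  define k where "k = real n + 1"
  have k: "k \<ge> 1" by (simp add: k_def)
  have "\<bar>r ^ 4 * chi' n r\<bar> \<le> 2304 / k \<and> \<bar>r ^ 4 * chi'' n r\<bar> \<le> 2304 / k"
  proof (cases "r < 0")
    case False
    then show ?thesis using k by (simp add: chi_nonneg_arg)
  next
    case True
    define E where "E = exp (k * r)"
    define m where "m = 1 - E"
    have E: "0 < E" "E < 1" using True k by (auto simp: E_def mult_pos_neg)
    then have m: "max 0 (1 - E) = m" "0 \<le> m" "m \<le> 1" by (auto simp: m_def)
    have m2: "0 \<le> m\<^sup>2" "m\<^sup>2 \<le> 1" using m by (auto simp: power_le_one)
    have "(- (k * r)) ^ 4 * exp (- (- (k * r))) \<le> 256"
      using True k by (intro pow4_exp_bound) (simp add: mult_nonneg_nonpos)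
    then have b: "k ^ 4 * (r ^ 4 * E) \<le> 256"
      by (simp add: power_mult_distrib E_def)
    define b where "b = r ^ 4 * E"
    have b0: "b \<ge> 0" using E by (simp add: b_def)
    have k34: "k * (k * b) \<le> 256 / k"
    proof -
      have "k * (k * (k * b)) \<le> k * (k * (k * (k * b)))"
        using k b0 mult_right_mono[of 1 k "k * (k * (k * b))"] by simp
      also have "\<dots> \<le> 256" using b by (simp add: b_def power4_eq_xxxx)
      finally show ?thesis using k by (simp add: field_simps)
    qed
    have "r ^ 4 * chi' n r = - (3 * k * b * m\<^sup>2)"
      unfolding chi'_def k_def[symmetric] E_def[symmetric] m(1) b_def by simp
    moreover have "3 * k * b * m\<^sup>2 \<le> 3 * k * b * 1"
      by (rule mult_left_mono) (use m2 k b0 in auto)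
    moreover have "k * b \<le> k * (k * b)" using k b0 mult_right_mono[of 1 k "k * b"] by simp
    moreover have "0 \<le> 3 * k * b * m\<^sup>2" using k b0 by simp
    ultimately have 1: "\<bar>r ^ 4 * chi' n r\<bar> \<le> 3 * (k * (k * b))" by simp
    have eq: "r ^ 4 * chi'' n r = k * (k * b) * (6 * E * m - 3 * m\<^sup>2)"
      unfolding chi''_def k_def[symmetric] E_def[symmetric] m(1) b_def by (simp add: power2_eq_square algebra_simps)
    have nine: "\<bar>6 * E * m - 3 * m\<^sup>2\<bar> \<le> 9"
    proof -
      have "E * m \<le> 1" "0 \<le> E * m" using E m mult_mono[of E 1 m 1] by auto
      moreover have "6 * E * m = 6 * (E * m)" by simp
      ultimately show ?thesis using m2 unfolding abs_le_iff by linarith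
    qed
    have kkb: "0 \<le> k * (k * b)" using k b0 by simp
    have 2: "\<bar>r ^ 4 * chi'' n r\<bar> \<le> k * (k * b) * 9"
      unfolding eq abs_mult[of "k * (k * b)"] abs_of_nonneg[OF kkb]
      by (rule mult_left_mono[OF nine kkb])
    have "9 * (k * (k * b)) \<le> 2304 / k"
      using k34 by (simp add: field_simps)
    then show ?thesis using 1 2 kkb by linarith
  qed
  then show "\<bar>r ^ 4 * chi' n r\<bar> \<le> 2304 / (real n + 1)" "\<bar>r ^ 4 * chi'' n r\<bar> \<le> 2304 / (real n + 1)"
    by (simp_all add: k_def)
qed

text \<open>Index and argument move together, as the sequential criterion for uniform convergence
  requires.\<close>

lemma chi_tendsto_1:
  assumes r: "r \<longlonglongrightarrow> l" "l < 0" and N: "filterlim N at_top sequentially"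
  shows "(\<lambda>i. chi (N i) (r i)) \<longlonglongrightarrow> 1"
proof -
  have "filterlim (\<lambda>i. real (N i) + 1) at_top sequentially"
    by (rule filterlim_at_top_mono[OF filterlim_compose[OF filterlim_real_sequentially N]]) simp
  from filterlim_tendsto_neg_mult_at_bot[OF r(1) r(2) this]
  have "filterlim (\<lambda>i. (real (N i) + 1) * r i) at_bot sequentially"
    by (simp add: mult.commute)
  then have "(\<lambda>i. exp ((real (N i) + 1) * r i)) \<longlonglongrightarrow> 0"
    by (rule filterlim_compose[OF exp_at_bot])
  then have "(\<lambda>i. max 0 (1 - exp ((real (N i) + 1) * r i)) ^ 3) \<longlonglongrightarrow> max 0 (1 - 0) ^ 3"
    by (intro tendsto_intros)
  then show ?thesis by (simp add: chi_def)
qed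

section \<open>Geometry of strictly convex families\<close>

locale convex_family =
  fixes U :: "'a::euclidean_space set" and D :: "('a \<times> 'b::euclidean_space) set"
    and \<rho> :: "'a \<times> 'b \<Rightarrow> real" and \<rho>1 \<rho>2
  assumes U: "open U" and open_D: "open D" and D_sub: "D \<subseteq> U \<times> UNIV"
    and fiber_ne: "\<And>t. t \<in> U \<Longrightarrow> fiber D t \<noteq> {}"
    and fiber_connected: "\<And>t. t \<in> U \<Longrightarrow> connected (fiber D t)"
    and fiber_bounded: "\<And>t. t \<in> U \<Longrightarrow> bounded (fiber D t)"
    and rho: "C2_partials (U \<times> UNIV) \<rho> \<rho>1 \<rho>2"
    and D_iff: "\<And>z. z \<in> U \<times> UNIV \<Longrightarrow> z \<in> D \<longleftrightarrow> \<rho> z < 0"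
    and grad: "\<And>t x. t \<in> U \<Longrightarrow> x \<in> frontier (fiber D t) \<Longrightarrow> \<exists>e\<in>Basis. \<rho>1 (0, e) (t, x) \<noteq> 0"
    and hess: "\<And>z v. z \<in> closure D \<inter> (U \<times> UNIV) \<Longrightarrow> v \<noteq> 0 \<Longrightarrow>
      (\<Sum>j\<in>Basis. \<Sum>k\<in>Basis. (v \<bullet> j) * (v \<bullet> k) * \<rho>2 j k z) > 0"
begin

abbreviation "S \<equiv> U \<times> (UNIV :: 'b set)"
abbreviation "Dc \<equiv> closure D \<inter> S"

lemma open_S: "open S"
  using U by (intro open_Times) auto

lemma D_sub_Dc: "D \<subseteq> Dc"
  using D_sub closure_subset by blast

lemma open_fiber: "open (fiber D t)"
proof -
  have "fiber D t = Pair t -` D" by (auto simp: fiber_def)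
  then show ?thesis by (simp add: open_vimage open_D continuous_intros)
qed

lemma rho_le_0: "z \<in> Dc \<Longrightarrow> \<rho> z \<le> 0"
proof -
  assume z: "z \<in> Dc"
  then obtain s where s: "\<And>n. s n \<in> D" "s \<longlonglongrightarrow> z" by (auto simp: closure_sequential)
  have "(\<lambda>n. \<rho> (s n)) \<longlonglongrightarrow> \<rho> z"
    by (rule continuous_on_tendsto_compose[OF C2_partials_continuous(1)[OF rho] s(2) _ always_eventually])
      (use z s D_sub in blast)+
  moreover have "\<rho> (s n) \<le> 0" for n using s(1)[of n] D_sub D_iff[of "s n"] by auto
  ultimately show ?thesis using LIMSEQ_le_const2[of "\<lambda>n. \<rho> (s n)" "\<rho> z" 0] by blast
qed

lemma rho_eq_0: "z \<in> Dc \<Longrightarrow> z \<notin> D \<Longrightarrow> \<rho> z = 0"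
  using rho_le_0[of z] D_iff[of z] by auto

text \<open>Convexity of \<rho> is available only on the closure of D, and a segment between two
  points of D might leave it, so the usual sublevel set argument does not start. Instead, for fixed
  p, the set of those q whose segment from p stays in the closure is clopen in a connected set:
  closed by definition, and open because such a segment is a compact subset of the open set
  D.\<close>

lemma convex_restrict:
  assumes B: "open B" "convex B" "B \<subseteq> U"
  shows "convex (D \<inter> (B \<times> UNIV))" (is "convex ?DB")
proof -
  have oDB: "open ?DB" using B open_D by (intro open_Int open_Times) auto
  have fim: "fst ` D = U"
  proof
    show "U \<subseteq> fst ` D"
    proof
      fix t assume "t \<in> U"
      then obtain x where "(t, x) \<in> D" using fiber_ne[of t] by (auto simp: fiber_def)
      then show "t \<in> fst ` D" by force
    qed
  qed (use D_sub in auto)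
  \<comment> \<open>The projection of D to U is open with connected fibres, so preimages of
    connected sets are connected.\<close>
  have "connected (D \<inter> fst -` B)"
  proof (rule connected_open_monotone_preimage[OF _ fim])
    show "continuous_on D fst" by (intro continuous_intros)
    fix C assume "openin (top_of_set D) C"
    then have "open C" using open_D openin_open_eq by blast
    moreover have "C \<subseteq> D" using \<open>openin (top_of_set D) C\<close> openin_imp_subset by blast
    ultimately show "openin (top_of_set U) (fst ` C)"
      using fim U by (auto simp: openin_open_eq open_image_fst)
  next
    fix t assume t: "t \<in> U"
    have "D \<inter> fst -` {t} = Pair t ` fiber D t" by (auto simp: fiber_def)
    then show "connected (D \<inter> fst -` {t})"
      using fiber_connected[OF t] by (simp add: connected_continuous_image continuous_intros)
  qed (use B convex_connected in auto)
  moreover have "D \<inter> fst -` B = ?DB" by auto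
  ultimately have conn: "connected ?DB" by simp
  \<comment> \<open>On a segment inside the closure \<rho> is convex and it is negative at both
    ends, hence negative throughout.\<close>
  have neg: "closed_segment p q \<subseteq> ?DB" if p: "p \<in> ?DB" and q: "q \<in> ?DB"
    and seg: "closed_segment p q \<subseteq> closure D" for p q
  proof
    fix z assume "z \<in> closed_segment p q"
    then obtain \<theta> where \<theta>: "0 \<le> \<theta>" "\<theta> \<le> 1" and z: "z = p + \<theta> *\<^sub>R (q - p)"
      by (auto simp: in_segment algebra_simps)
    let ?d = "q - p"
    have inDc: "p + s *\<^sub>R ?d \<in> Dc" and inB: "fst (p + s *\<^sub>R ?d) \<in> B" if "s \<in> {0..1}" for s
    proof -
      have eq: "p + s *\<^sub>R ?d = (1 - s) *\<^sub>R p + s *\<^sub>R q" by (simp add: algebra_simps)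
      then have "p + s *\<^sub>R ?d \<in> closed_segment p q" using that by (auto simp: in_segment)
      then have 1: "p + s *\<^sub>R ?d \<in> closure D" using seg by blast
      have "(1 - s) *\<^sub>R fst p + s *\<^sub>R fst q \<in> B"
        using p q that by (intro convexD[OF B(2)]) auto
      then show "fst (p + s *\<^sub>R ?d) \<in> B" unfolding eq by simp
      with 1 show "p + s *\<^sub>R ?d \<in> Dc" using B(3) by (auto simp: mem_Times_iff)
    qed
    define f where "f s = \<rho> (p + s *\<^sub>R ?d)" for s
    define f' where "f' s = (\<Sum>j\<in>Basis. (?d \<bullet> j) * \<rho>1 j (p + s *\<^sub>R ?d))" for s
    define f'' where "f'' s = (\<Sum>j\<in>Basis. (?d \<bullet> j) * (\<Sum>k\<in>Basis. (?d \<bullet> k) * \<rho>2 j k (p + s *\<^sub>R ?d)))" for s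
    have "convex_on {0..1} f"
    proof (rule f''_ge0_imp_convex)
      fix s :: real assume s: "s \<in> {0..1}"
      have inS: "p + s *\<^sub>R ?d \<in> S" using inDc[OF s] by blast
      show "(f has_real_derivative f' s) (at s)"
        using has_derivative_line[OF C2_partialsD(1)[OF rho inS]]
        unfolding f_def[abs_def] f'_def has_real_derivative_iff_has_vector_derivative by simp
      show "(f' has_real_derivative f'' s) (at s)"
        unfolding f'_def[abs_def] f''_def has_real_derivative_iff_has_vector_derivative
        using has_derivative_line[OF C2_partialsD(2)[OF rho inS]]
        by (intro has_vector_derivative_sum has_vector_derivative_mult_right) simp
      show "f'' s \<ge> 0"
      proof (cases "?d = 0")
        case False
        from hess[OF inDc[OF s] this] show ?thesis
          unfolding f''_def sum_distrib_left by (simp add: mult.assoc)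
      qed (simp add: f''_def)
    qed auto
    then have "f ((1 - \<theta>) *\<^sub>R 0 + \<theta> *\<^sub>R 1) \<le> (1 - \<theta>) * f 0 + \<theta> * f 1"
      using \<theta> by (intro convex_onD) auto
    moreover have "f 0 < 0" "f 1 < 0"
      using p q D_sub D_iff[of p] D_iff[of q] by (auto simp: f_def)
    then have "(1 - \<theta>) * f 0 + \<theta> * f 1 < 0"
    proof (cases "\<theta> = 0")
      case False
      then have "\<theta> * f 1 < 0" "(1 - \<theta>) * f 0 \<le> 0"
        using \<theta> \<open>f 0 < 0\<close> \<open>f 1 < 0\<close> by (auto simp: mult_pos_neg mult_nonneg_nonpos)
      then show ?thesis by linarith
    qed simp
    ultimately have "f \<theta> < 0" by simp
    then show "z \<in> ?DB"
      using \<theta> inDc[of \<theta>] inB[of \<theta>] D_iff[of z] unfolding z f_def by (auto simp: mem_Times_iff)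
  qed
  have "closed_segment p q \<subseteq> ?DB" if p: "p \<in> ?DB" and q: "q \<in> ?DB" for p q
  proof -
    define A where "A = {q \<in> ?DB. closed_segment p q \<subseteq> closure D}"
    have A_eq: "A = {q \<in> ?DB. closed_segment p q \<subseteq> ?DB}"
    proof -
      have "?DB \<subseteq> closure D" using closure_subset by blast
      then show ?thesis unfolding A_def using neg[OF p] by blast
    qed
    have "closedin (top_of_set ?DB) A"
    proof -
      have "closed_segment p q \<subseteq> closure D \<longleftrightarrow> (\<forall>s\<in>{0..1}. (1 - s) *\<^sub>R p + s *\<^sub>R q \<in> closure D)" for q
      proof (intro iffI ballI subsetI)
        fix s assume "closed_segment p q \<subseteq> closure D" "s \<in> {0..1::real}"
        then show "(1 - s) *\<^sub>R p + s *\<^sub>R q \<in> closure D"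
          by (meson in_segment(1) subsetD atLeastAtMost_iff)
      next
        fix x assume "\<forall>s\<in>{0..1}. (1 - s) *\<^sub>R p + s *\<^sub>R q \<in> closure D" "x \<in> closed_segment p q"
        then show "x \<in> closure D" by (metis in_segment(1) atLeastAtMost_iff)
      qed
      then have "A = ?DB \<inter> (\<Inter>s\<in>{0..1}. (\<lambda>q. (1 - s) *\<^sub>R p + s *\<^sub>R q) -` closure D)"
        unfolding A_def by blast
      moreover have "closed (\<Inter>s\<in>{0..1}. (\<lambda>q. (1 - s) *\<^sub>R p + s *\<^sub>R q) -` closure D)"
        by (intro closed_INT ballI closed_vimage continuous_intros closed_closure)
      ultimately show ?thesis by (simp add: closedin_closed_Int)
    qed
    moreover have "openin (top_of_set ?DB) A"
    proof -
      have "open A"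
        unfolding open_contains_ball
      proof (rule ballI)
        fix q assume q: "q \<in> A"
        then have seg: "closed_segment p q \<subseteq> ?DB" and qD: "q \<in> ?DB" by (auto simp: A_eq)
        obtain \<epsilon> where \<epsilon>: "\<epsilon> > 0" "(\<Union>x\<in>closed_segment p q. ball x \<epsilon>) \<subseteq> ?DB"
          using compact_subset_open_imp_ball_epsilon_subset[OF compact_segment oDB seg] by blast
        have "ball q \<epsilon> \<subseteq> A"
        proof
          fix q' assume q': "q' \<in> ball q \<epsilon>"
          have "closed_segment p q' \<subseteq> ?DB"
          proof
            fix z assume "z \<in> closed_segment p q'"
            then obtain s where s: "0 \<le> s" "s \<le> 1" and z: "z = (1 - s) *\<^sub>R p + s *\<^sub>R q'"
              by (auto simp: in_segment)
            let ?x = "(1 - s) *\<^sub>R p + s *\<^sub>R q"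
            have "dist ?x z = norm (s *\<^sub>R (q - q'))"
              unfolding z dist_norm by (simp add: algebra_simps)
            also have "\<dots> \<le> norm (q - q')"
              using s mult_left_le_one_le[of "norm (q - q')" s] by simp
            also have "\<dots> < \<epsilon>" using q' by (simp add: dist_norm)
            finally have "z \<in> ball ?x \<epsilon>" by simp
            moreover have "?x \<in> closed_segment p q" using s by (auto simp: in_segment)
            ultimately show "z \<in> ?DB" using \<epsilon>(2) by blast
          qed
          then show "q' \<in> A" unfolding A_eq using ends_in_segment(2) by blast
        qed
        with \<epsilon>(1) show "\<exists>e>0. ball q e \<subseteq> A" by blast
      qed
      moreover have "A \<subseteq> ?DB" unfolding A_def by blast
      ultimately show ?thesis by (intro open_subset)
    qed
    moreover have "p \<in> A" using p by (auto simp: A_eq)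
    ultimately have "A = ?DB" using conn unfolding connected_clopen by blast
    then show ?thesis using q unfolding A_eq by blast
  qed
  then show ?thesis by (auto simp: convex_contains_segment)
qed

text \<open>A fibre of the closure could be larger than the closure of the fibre. Convexity over a
  ball excludes it: the open segment from a point of D over t to a closure point over the same t
  stays in D, hence in the fibre.\<close>

lemma closure_fiber:
  assumes "(t, x) \<in> Dc"
  shows "x \<in> closure (fiber D t)"
proof -
  have t: "t \<in> U" using assms by auto
  obtain r where r: "r > 0" "ball t r \<subseteq> U" using U t openE by blast
  let ?O = "ball t r \<times> (UNIV :: 'b set)"
  have O: "open ?O" by (intro open_Times) auto
  have cv: "convex (D \<inter> ?O)" by (rule convex_restrict) (use r in auto)
  have op: "interior (D \<inter> ?O) = D \<inter> ?O" using open_D O by (simp add: interior_open open_Int)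
  have b: "(t, x) \<in> closure (D \<inter> ?O)"
    using open_Int_closure_subset[OF O, of D] assms r by (auto simp: Int_commute)
  obtain x0 where x0: "x0 \<in> fiber D t" using fiber_ne[OF t] by auto
  then have a: "(t, x0) \<in> interior (D \<inter> ?O)" unfolding op using r by (auto simp: fiber_def)
  have seg: "open_segment x0 x \<subseteq> fiber D t"
  proof
    fix y assume "y \<in> open_segment x0 x"
    then obtain s where s: "0 < s" "s < 1" "x0 \<noteq> x" and y: "y = (1 - s) *\<^sub>R x0 + s *\<^sub>R x"
      by (auto simp: in_segment)
    have "(t, y) \<in> open_segment (t, x0) (t, x)"
      unfolding in_segment using s y by (intro conjI exI[of _ s]) (auto simp: algebra_simps)
    then have "(t, y) \<in> D"
      using in_interior_closure_convex_segment[OF cv a b] op by blast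
    then show "y \<in> fiber D t" by (simp add: fiber_def)
  qed
  show ?thesis
  proof (cases "x = x0")
    case True
    then show ?thesis using x0 closure_subset by blast
  next
    case False
    then have "closed_segment x0 x \<subseteq> closure (fiber D t)"
      using closure_mono[OF seg] by (simp add: closure_open_segment)
    then show ?thesis by auto
  qed
qed

lemma convex_fiber: "t \<in> U \<Longrightarrow> convex (fiber D t)"
proof -
  assume t: "t \<in> U"
  obtain r where r: "r > 0" "ball t r \<subseteq> U" using U t openE by blast
  have cv: "convex (D \<inter> (ball t r \<times> UNIV))" by (rule convex_restrict) (use r in auto)
  show ?thesis
  proof (rule convexI)
    fix x y and a b :: real assume xy: "x \<in> fiber D t" "y \<in> fiber D t" and ab: "0 \<le> a" "0 \<le> b" "a + b = 1"
    have "a *\<^sub>R (t, x) + b *\<^sub>R (t, y) \<in> D \<inter> (ball t r \<times> UNIV)"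
      using xy r by (intro convexD[OF cv _ _ ab]) (auto simp: fiber_def)
    then show "a *\<^sub>R x + b *\<^sub>R y \<in> fiber D t"
      using ab by (simp add: fiber_def flip: scaleR_left.add)
  qed
qed

definition N :: "'a \<times> 'b \<Rightarrow> real" where
  "N z = (\<Sum>e\<in>Basis. (\<rho>1 (0, e) z)\<^sup>2) + \<rho> z ^ 4"

text \<open>Inside D the term \<rho>^4 is positive. Elsewhere on \<open>Dc\<close>,
  \<open>closure_fiber\<close> puts x on the frontier of its fibre, where the fibre gradient is
  nonzero.\<close>

lemma N_pos: "z \<in> Dc \<Longrightarrow> N z > 0"
proof -
  assume z: "z \<in> Dc"
  obtain t x where tx: "z = (t, x)" by (cases z)
  show ?thesis
  proof (cases "z \<in> D")
    case True
    then have "\<rho> z < 0" using D_iff[of z] z by blast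
    then have "\<rho> z ^ 4 > 0" by (simp add: zero_less_power_eq)
    then show ?thesis unfolding N_def by (intro add_nonneg_pos sum_nonneg) auto
  next
    case False
    then have "x \<notin> fiber D t" by (simp add: fiber_def tx)
    then have "x \<in> frontier (fiber D t)"
      using closure_fiber[of t x] z by (simp add: frontier_def tx interior_open[OF open_fiber])
    then obtain e where e: "e \<in> Basis" "\<rho>1 (0, e) z \<noteq> 0" using grad[of t x] z tx by auto
    have "(\<Sum>e\<in>Basis. (\<rho>1 (0, e) z)\<^sup>2) > 0"
      by (rule sum_pos2[OF finite_Basis e(1)]) (use e in auto)
    moreover have "\<rho> z ^ 4 \<ge> 0" by simp
    ultimately show ?thesis unfolding N_def by linarith
  qed
qed

text \<open>Boundedness of single fibres does not control neighbouring ones. A sphere enclosing the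
  closure of the fibre over t0 has positive distance to the closure of D, so nearby fibres miss it;
  they contain the centre \<open>x0\<close> and are connected, so they stay inside.\<close>

lemma locally_bounded:
  assumes t0: "t0 \<in> U"
  obtains \<delta> R where "\<delta> > 0" "cball t0 \<delta> \<subseteq> U" "\<And>t x. t \<in> cball t0 \<delta> \<Longrightarrow> x \<in> fiber D t \<Longrightarrow> norm x < R"
proof -
  obtain x0 where x0: "x0 \<in> fiber D t0" using fiber_ne[OF t0] by auto
  obtain R1 where R1: "\<And>x. x \<in> fiber D t0 \<Longrightarrow> dist x0 x \<le> R1"
    using fiber_bounded[OF t0] unfolding bounded_any_center[of _ x0] by blast
  define R0 where "R0 = \<bar>R1\<bar> + 1"
  have R0: "R0 > 0" by (simp add: R0_def)
  have cl: "closure (fiber D t0) \<subseteq> cball x0 \<bar>R1\<bar>"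
  proof (rule closure_minimal)
    have "dist x0 x \<le> \<bar>R1\<bar>" if "x \<in> fiber D t0" for x using R1[OF that] by linarith
    then show "fiber D t0 \<subseteq> cball x0 \<bar>R1\<bar>" by auto
  qed simp
  let ?\<Sigma> = "{t0} \<times> sphere x0 R0"
  have "?\<Sigma> \<inter> closure D = {}"
  proof (rule ccontr)
    assume "?\<Sigma> \<inter> closure D \<noteq> {}"
    then obtain x where x: "(t0, x) \<in> closure D" "x \<in> sphere x0 R0" by blast
    then have "x \<in> closure (fiber D t0)" using t0 by (intro closure_fiber) auto
    then have "dist x0 x \<le> \<bar>R1\<bar>" using cl by auto
    then show False using x(2) by (simp add: R0_def)
  qed
  moreover have "compact ?\<Sigma>" by (intro compact_Times) auto
  ultimately obtain d where d: "d > 0" "\<And>x y. x \<in> ?\<Sigma> \<Longrightarrow> y \<in> closure D \<Longrightarrow> d \<le> dist x y"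
    using separate_compact_closed[of ?\<Sigma> "closure D"] by auto
  have "(t0, x0) \<in> D" using x0 by (simp add: fiber_def)
  then obtain d2 where d2: "d2 > 0" "ball (t0, x0) d2 \<subseteq> D" using open_D openE by blast
  obtain d3 where d3: "d3 > 0" "ball t0 d3 \<subseteq> U" using U t0 openE by blast
  define \<delta> where "\<delta> = min d (min d2 d3) / 2"
  have \<delta>: "\<delta> > 0" "\<delta> < d" "\<delta> < d2" "\<delta> < d3" using d d2 d3 by (auto simp: \<delta>_def)
  have "norm x < R0 + norm x0" if t: "t \<in> cball t0 \<delta>" and x: "x \<in> fiber D t" for t x
  proof -
    have tU: "t \<in> U" using t d3 \<delta> by auto
    have x0t: "x0 \<in> fiber D t"
      using t \<delta> d2 by (auto simp: fiber_def dist_Pair_Pair)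
    have "fiber D t \<inter> sphere x0 R0 = {}"
    proof (rule ccontr)
      assume "fiber D t \<inter> sphere x0 R0 \<noteq> {}"
      then obtain y where y: "(t, y) \<in> D" "y \<in> sphere x0 R0" unfolding fiber_def by blast
      then have "d \<le> dist (t0, y) (t, y)" using closure_subset by (intro d(2)) auto
      then show False using t \<delta> by (simp add: dist_Pair_Pair)
    qed
    then have "fiber D t \<inter> frontier (ball x0 R0) = {}" using R0 by simp
    then have "fiber D t \<subseteq> ball x0 R0"
      using connected_Int_frontier[OF fiber_connected[OF tU], of "ball x0 R0"] x0t R0 by force
    then have "dist x0 x < R0" using x by auto
    then show ?thesis using norm_triangle_sub[of x x0] by (simp add: dist_norm norm_minus_commute)
  qed
  moreover have "cball t0 \<delta> \<subseteq> U" using \<delta> d3 by (auto simp: subset_eq)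
  ultimately show ?thesis using that \<delta>(1) by blast
qed

lemma compact_Dc:
  assumes C: "compact C" "C \<subseteq> U" and R: "\<And>t x. t \<in> C \<Longrightarrow> x \<in> fiber D t \<Longrightarrow> norm x < R"
  shows "compact (Dc \<inter> (C \<times> UNIV))"
proof -
  have "Dc \<inter> (C \<times> UNIV) = (C \<times> cball 0 R) \<inter> closure D"
  proof -
    have "norm x \<le> R" if "t \<in> C" "(t, x) \<in> closure D" for t x
    proof -
      have "fiber D t \<subseteq> cball 0 R" using R[OF that(1)] less_imp_le by fastforce
      then have "closure (fiber D t) \<subseteq> cball 0 R" by (intro closure_minimal) auto
      moreover have "x \<in> closure (fiber D t)" using that C by (intro closure_fiber) auto
      ultimately show ?thesis by auto
    qed
    then show ?thesis using C by auto
  qed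
  then show ?thesis using C by (simp add: compact_Int_closed compact_Times)
qed

section \<open>Cut-off extensions by zero\<close>

text \<open>Only values of f on D enter, since f is controlled on \<open>Dc\<close> alone. With
  \<psi> = 1 it is plain extension by zero, so that fibre integrals over D and their approximations
  have a common form.\<close>

definition cut :: "(real \<Rightarrow> real) \<Rightarrow> ('a \<times> 'b \<Rightarrow> 'c::real_normed_vector) \<Rightarrow> 'a \<times> 'b \<Rightarrow> 'c" where
  "cut \<psi> f z = (if z \<in> D then \<psi> (\<rho> z) *\<^sub>R f z else 0)"

lemma continuous_on_cut:
  assumes \<psi>: "continuous_on UNIV \<psi>" "\<And>r. r \<ge> 0 \<Longrightarrow> \<psi> r = 0" and f: "continuous_on Dc f"
  shows "continuous_on S (cut \<psi> f)"
proof -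
  have S: "Dc \<union> (S - D) = S" using D_sub_Dc by blast
  have "continuous_on (Dc \<union> (S - D)) (\<lambda>z. if z \<in> D then \<psi> (\<rho> z) *\<^sub>R f z else 0)"
  proof (rule continuous_on_cases_local)
    show "closedin (top_of_set (Dc \<union> (S - D))) Dc"
      unfolding S by (subst Int_commute) (simp add: closedin_closed_Int)
    show "closedin (top_of_set (Dc \<union> (S - D))) (S - D)"
      unfolding S using open_D by (simp add: Diff_eq closedin_closed_Int closed_Compl)
    have "continuous_on Dc \<rho>"
      using continuous_on_subset[OF C2_partials_continuous(1)[OF rho]] by blast
    then show "continuous_on Dc (\<lambda>z. \<psi> (\<rho> z) *\<^sub>R f z)"
      by (intro continuous_intros f continuous_on_compose2[OF \<psi>(1)]) auto
  qed (use rho_eq_0 \<psi>(2) in auto)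
  then show ?thesis unfolding S cut_def[abs_def] .
qed

text \<open>Off the closure the cut-off is locally 0. On \<open>Dc\<close> the product rule applies
  even at boundary points, because f is differentiable there in the ambient space and \<psi>(\<rho>)
  f equals the cut-off nearby, \<psi> being 0 on [0, \<infinity>).\<close>

lemma has_derivative_cut:
  fixes f :: "'a \<times> 'b \<Rightarrow> 'c::real_normed_vector"
  assumes \<psi>: "\<And>r. (\<psi> has_real_derivative \<psi>' r) (at r)" "\<And>r. r \<ge> 0 \<Longrightarrow> \<psi> r = 0" "\<And>r. r \<ge> 0 \<Longrightarrow> \<psi>' r = 0"
    and f: "z \<in> Dc \<Longrightarrow> (f has_derivative (\<lambda>h. \<Sum>j\<in>Basis. (h \<bullet> j) *\<^sub>R f1 j z)) (at z)" and z: "z \<in> S"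
  shows "(cut \<psi> f has_derivative
    (\<lambda>h. \<Sum>j\<in>Basis. (h \<bullet> j) *\<^sub>R (cut \<psi> (f1 j) z + cut \<psi>' (\<lambda>z. \<rho>1 j z *\<^sub>R f z) z))) (at z)"
proof (cases "z \<in> closure D")
  case True
  then have zD: "z \<in> Dc" using z by blast
  have c: "((\<lambda>z. \<psi> (\<rho> z)) has_derivative (\<lambda>h. (\<Sum>j\<in>Basis. (h \<bullet> j) *\<^sub>R \<rho>1 j z) * \<psi>' (\<rho> z))) (at z)"
    using has_derivative_compose[OF C2_partialsD(1)[OF rho z] \<psi>(1)[of "\<rho> z", unfolded has_field_derivative_def]]
    by (simp add: mult.commute)
  have "((\<lambda>z. \<psi> (\<rho> z) *\<^sub>R f z) has_derivative
     (\<lambda>h. \<psi> (\<rho> z) *\<^sub>R (\<Sum>j\<in>Basis. (h \<bullet> j) *\<^sub>R f1 j z) +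
       ((\<Sum>j\<in>Basis. (h \<bullet> j) *\<^sub>R \<rho>1 j z) * \<psi>' (\<rho> z)) *\<^sub>R f z)) (at z)"
    by (rule has_derivative_scaleR[OF c f[OF zD]])
  moreover have "(\<lambda>h. \<psi> (\<rho> z) *\<^sub>R (\<Sum>j\<in>Basis. (h \<bullet> j) *\<^sub>R f1 j z) +
       ((\<Sum>j\<in>Basis. (h \<bullet> j) *\<^sub>R \<rho>1 j z) * \<psi>' (\<rho> z)) *\<^sub>R f z) =
     (\<lambda>h. \<Sum>j\<in>Basis. (h \<bullet> j) *\<^sub>R (cut \<psi> (f1 j) z + cut \<psi>' (\<lambda>z. \<rho>1 j z *\<^sub>R f z) z))"
  proof (cases "z \<in> D")
    case True
    show ?thesis
      unfolding cut_def if_P[OF True] scaleR_sum_right sum_distrib_right scaleR_sum_left sum.distrib[symmetric]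
      by (intro ext sum.cong refl) (simp add: scaleR_add_right mult_ac)
  next
    case False
    then show ?thesis using rho_eq_0[OF zD] \<psi>(2,3) by (simp add: cut_def)
  qed
  ultimately have "((\<lambda>z. \<psi> (\<rho> z) *\<^sub>R f z) has_derivative
    (\<lambda>h. \<Sum>j\<in>Basis. (h \<bullet> j) *\<^sub>R (cut \<psi> (f1 j) z + cut \<psi>' (\<lambda>z. \<rho>1 j z *\<^sub>R f z) z))) (at z)"
    by simp
  then show ?thesis
  proof (rule has_derivative_transform_within_open[OF _ open_S z])
    fix y assume "y \<in> S"
    then show "\<psi> (\<rho> y) *\<^sub>R f y = cut \<psi> f y"
      using D_iff[of y] \<psi>(2)[of "\<rho> y"] by (auto simp: cut_def not_less)
  qed
next
  case False
  then have "z \<in> - closure D" by blast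
  have "((\<lambda>_. 0) has_derivative (\<lambda>h. 0)) (at z)" by simp
  then have "(cut \<psi> f has_derivative (\<lambda>h. 0)) (at z)"
    by (rule has_derivative_transform_within_open[OF _ _ \<open>z \<in> - closure D\<close>])
      (use closure_subset in \<open>auto simp: cut_def\<close>)
  moreover have "z \<notin> D" using False closure_subset by blast
  ultimately show ?thesis by (simp add: cut_def)
qed

end

section \<open>Convergence of cut-off fibre integrals\<close>

text \<open>Continuous convergence on a compact set is uniform: points violating a bound \<epsilon>
  for arbitrarily large indices have a convergent subsequence, along which both sides tend to G
  l.\<close>

lemma uniform_limit_sequentiallyI:
  fixes F :: "nat \<Rightarrow> 'a::metric_space \<Rightarrow> 'b::metric_space"
  assumes C: "compact C"
    and F: "\<And>t N l. (\<And>i. t i \<in> C) \<Longrightarrow> t \<longlonglongrightarrow> l \<Longrightarrow> l \<in> C \<Longrightarrow> filterlim N at_top sequentially \<Longrightarrow>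
      (\<lambda>i. F (N i) (t i)) \<longlonglongrightarrow> G l"
    and G: "\<And>t l. (\<And>i. t i \<in> C) \<Longrightarrow> t \<longlonglongrightarrow> l \<Longrightarrow> l \<in> C \<Longrightarrow> (\<lambda>i. G (t i)) \<longlonglongrightarrow> G l"
  shows "uniform_limit C F G sequentially"
proof (rule ccontr)
  assume "\<not> uniform_limit C F G sequentially"
  then obtain \<epsilon> where \<epsilon>: "\<epsilon> > 0" "\<not> (\<forall>\<^sub>F n in sequentially. \<forall>t\<in>C. dist (F n t) (G t) < \<epsilon>)"
    by (auto simp: uniform_limit_iff)
  then have "\<forall>m. \<exists>n t. n \<ge> m \<and> t \<in> C \<and> \<not> dist (F n t) (G t) < \<epsilon>"
    unfolding eventually_sequentially by blast
  then obtain N t where Nt: "\<And>m. N m \<ge> m" "\<And>m. t m \<in> C" "\<And>m. \<not> dist (F (N m) (t m)) (G (t m)) < \<epsilon>"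
    by metis
  obtain l r where l: "l \<in> C" "strict_mono (r :: nat \<Rightarrow> nat)" "(t \<circ> r) \<longlonglongrightarrow> l"
    using C Nt(2) unfolding compact_def by metis
  have "filterlim r at_top sequentially" by (rule filterlim_subseq[OF l(2)])
  then have "filterlim (\<lambda>i. N (r i)) at_top sequentially"
    by (rule filterlim_at_top_mono) (simp add: Nt)
  then have "(\<lambda>i. F (N (r i)) ((t \<circ> r) i)) \<longlonglongrightarrow> G l"
    by (intro F l) (simp_all add: Nt)
  moreover have "(\<lambda>i. G ((t \<circ> r) i)) \<longlonglongrightarrow> G l"
    by (intro G l) (simp_all add: Nt)
  ultimately have "(\<lambda>i. dist (F (N (r i)) ((t \<circ> r) i)) (G ((t \<circ> r) i))) \<longlonglongrightarrow> dist (G l) (G l)"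
    by (rule tendsto_dist)
  then have "\<forall>\<^sub>F i in sequentially. dist (F (N (r i)) ((t \<circ> r) i)) (G ((t \<circ> r) i)) < \<epsilon>"
    using \<epsilon>(1) by (intro order_tendstoD(2)) auto
  then show False using Nt(3) by (auto simp: eventually_sequentially)
qed

locale convex_family_over = convex_family U D \<rho> \<rho>1 \<rho>2
  for U :: "'a::euclidean_space set" and D :: "('a \<times> 'b::euclidean_space) set" and \<rho> \<rho>1 \<rho>2 +
  fixes C :: "'a set" and R :: real
  assumes compact_C: "compact C" and C_sub: "C \<subseteq> U"
    and norm_less: "\<And>t x. t \<in> C \<Longrightarrow> x \<in> fiber D t \<Longrightarrow> norm x < R"
begin

abbreviation "K \<equiv> Dc \<inter> (C \<times> UNIV)"

lemma compact_K: "compact K"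
  by (rule compact_Dc[OF compact_C C_sub norm_less])

lemma bounded_on_K:
  fixes f :: "'a \<times> 'b \<Rightarrow> 'c::real_normed_vector"
  assumes "continuous_on Dc f"
  shows "\<exists>B>0. \<forall>z\<in>K. norm (f z) \<le> B"
proof -
  have "bounded (f ` K)"
    by (intro compact_imp_bounded compact_continuous_image compact_K continuous_on_subset[OF assms]) auto
  then show ?thesis unfolding bounded_pos by auto
qed

lemma in_K: "t \<in> C \<Longrightarrow> x \<in> fiber D t \<Longrightarrow> (t, x) \<in> K"
  using D_sub_Dc by (auto simp: fiber_def)

definition J :: "(real \<Rightarrow> real) \<Rightarrow> ('a \<times> 'b \<Rightarrow> 'c::euclidean_space) \<Rightarrow> 'a \<Rightarrow> 'c" where
  "J \<psi> f t = (\<integral>x. cut \<psi> f (t, x) \<partial>lborel)"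

lemma continuous_rho: "continuous_on Dc \<rho>"
  using continuous_on_subset[OF C2_partials_continuous(1)[OF rho]] by blast

lemma continuous_on_fiberwise: "continuous_on Dc f \<Longrightarrow> t \<in> C \<Longrightarrow> continuous_on (fiber D t) (\<lambda>x. f (t, x))"
  by (rule continuous_on_compose2) (auto intro!: continuous_intros dest: in_K)

lemma measurable_cut:
  fixes f :: "'a \<times> 'b \<Rightarrow> 'c::euclidean_space"
  assumes f: "continuous_on Dc f" and \<psi>: "continuous_on UNIV \<psi>" and t: "t \<in> C"
  shows "(\<lambda>x. cut \<psi> f (t, x)) \<in> borel_measurable borel"
proof -
  have "continuous_on Dc (\<lambda>z. \<psi> (\<rho> z) *\<^sub>R f z)"
    by (intro continuous_intros f continuous_on_compose2[OF \<psi>] continuous_rho) auto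
  then have "continuous_on (fiber D t) (\<lambda>x. \<psi> (\<rho> (t, x)) *\<^sub>R f (t, x))"
    by (rule continuous_on_fiberwise[OF _ t])
  then have "(\<lambda>x. indicator (fiber D t) x *\<^sub>R (\<psi> (\<rho> (t, x)) *\<^sub>R f (t, x))) \<in> borel_measurable borel"
    by (intro borel_measurable_continuous_on_indicator) (simp add: open_fiber)
  moreover have "indicator (fiber D t) x *\<^sub>R (\<psi> (\<rho> (t, x)) *\<^sub>R f (t, x)) = cut \<psi> f (t, x)" for x
    by (simp add: cut_def fiber_def indicator_def)
  ultimately show ?thesis by simp
qed

lemma norm_cut_le:
  assumes "t \<in> C" "c \<ge> 0" "\<And>x. x \<in> fiber D t \<Longrightarrow> norm (\<psi> (\<rho> (t, x)) *\<^sub>R f (t, x)) \<le> c"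
  shows "norm (cut \<psi> f (t, x)) \<le> c * indicator (cball 0 R) x"
  using assms norm_less[OF assms(1), of x] by (auto simp: cut_def fiber_def indicator_def)

lemma integrable_cut:
  fixes f :: "'a \<times> 'b \<Rightarrow> 'c::euclidean_space"
  assumes f: "continuous_on Dc f" and \<psi>: "continuous_on UNIV \<psi>" and t: "t \<in> C"
  shows "integrable lborel (\<lambda>x. cut \<psi> f (t, x))"
proof -
  have "continuous_on Dc (\<lambda>z. \<psi> (\<rho> z) *\<^sub>R f z)"
    by (intro continuous_intros f continuous_on_compose2[OF \<psi>] continuous_rho) auto
  then obtain B where B: "B > 0" "\<And>z. z \<in> K \<Longrightarrow> norm (\<psi> (\<rho> z) *\<^sub>R f z) \<le> B"
    using bounded_on_K by blast
  have nc: "norm (cut \<psi> f (t, x)) \<le> B * indicator (cball 0 R) x" for x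
    using B in_K[OF t] by (intro norm_cut_le t) auto
  have int: "integrable lborel (\<lambda>x::'b. B * indicator (cball 0 R) x)"
    using emeasure_lborel_cball_finite[of "0::'b" R] by simp
  have meas: "(\<lambda>x. cut \<psi> f (t, x)) \<in> borel_measurable lborel"
    using measurable_cut[OF f \<psi> t] by simp
  show ?thesis
  proof (rule Bochner_Integration.integrable_bound[OF int meas], rule AE_I2)
    fix x
    show "norm (cut \<psi> f (t, x)) \<le> norm (B * indicator (cball 0 R) x :: real)"
      by (rule order_trans[OF nc]) simp
  qed
qed

definition V :: real where "V = measure lborel (cball (0::'b) R)"

lemma norm_J_le:
  fixes f :: "'a \<times> 'b \<Rightarrow> 'c::euclidean_space"
  assumes f: "continuous_on Dc f" and \<psi>: "continuous_on UNIV \<psi>" and t: "t \<in> C"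
    and c: "c \<ge> 0" "\<And>x. x \<in> fiber D t \<Longrightarrow> norm (\<psi> (\<rho> (t, x)) *\<^sub>R f (t, x)) \<le> c"
  shows "norm (J \<psi> f t) \<le> c * V"
proof -
  have int: "integrable lborel (\<lambda>x::'b. c * indicator (cball 0 R) x)"
    using emeasure_lborel_cball_finite[of "0::'b" R] by simp
  have "norm (J \<psi> f t) \<le> (\<integral>x. norm (cut \<psi> f (t, x)) \<partial>lborel)"
    unfolding J_def by (rule integral_norm_bound)
  also have "\<dots> \<le> (\<integral>x. c * indicator (cball (0::'b) R) x \<partial>lborel)"
    by (intro integral_mono integrable_norm integrable_cut f \<psi> t int norm_cut_le c)
  also have "\<dots> = c * V"
    by (simp add: V_def)
  finally show ?thesis .
qed

lemma J_add:
  assumes "continuous_on Dc f" "continuous_on Dc g" "continuous_on UNIV \<psi>" "t \<in> C"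
  shows "J \<psi> (\<lambda>z. f z + g z) t = J \<psi> f t + J \<psi> g t"
proof -
  have "cut \<psi> (\<lambda>z. f z + g z) (t, x) = cut \<psi> f (t, x) + cut \<psi> g (t, x)" for x
    by (simp add: cut_def scaleR_add_right)
  then show ?thesis
    unfolding J_def using integrable_cut[OF assms(1,3,4)] integrable_cut[OF assms(2,3,4)] by simp
qed

lemma J_diff:
  assumes "continuous_on Dc f" "continuous_on Dc g" "continuous_on UNIV \<psi>" "t \<in> C"
  shows "J \<psi> (\<lambda>z. f z - g z) t = J \<psi> f t - J \<psi> g t"
proof -
  have "cut \<psi> (\<lambda>z. f z - g z) (t, x) = cut \<psi> f (t, x) - cut \<psi> g (t, x)" for x
    by (simp add: cut_def scaleR_diff_right)
  then show ?thesis
    unfolding J_def using integrable_cut[OF assms(1,3,4)] integrable_cut[OF assms(2,3,4)] by simp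
qed

lemma J_sum:
  assumes "\<And>i. i \<in> A \<Longrightarrow> continuous_on Dc (f i)" "continuous_on UNIV \<psi>" "t \<in> C"
  shows "J \<psi> (\<lambda>z. \<Sum>i\<in>A. f i z) t = (\<Sum>i\<in>A. J \<psi> (f i) t)"
proof -
  have "cut \<psi> (\<lambda>z. \<Sum>i\<in>A. f i z) (t, x) = (\<Sum>i\<in>A. cut \<psi> (f i) (t, x))" for x
    by (simp add: cut_def scaleR_sum_right)
  then show ?thesis
    unfolding J_def using integrable_cut[OF assms(1) assms(2,3)] by simp
qed

lemma J_cong:
  assumes "\<And>x. x \<in> fiber D t \<Longrightarrow> \<psi> (\<rho> (t, x)) *\<^sub>R f (t, x) = \<psi>' (\<rho> (t, x)) *\<^sub>R g (t, x)"
  shows "J \<psi> f t = J \<psi>' g t"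
  unfolding J_def cut_def using assms by (intro Bochner_Integration.integral_cong) (auto simp: fiber_def)

lemma J_pos:
  assumes f: "continuous_on Dc f" and t: "t \<in> C" and pos: "\<And>x. x \<in> fiber D t \<Longrightarrow> f (t, x) > (0::real)"
  shows "J (\<lambda>_. 1) f t > 0"
proof -
  let ?g = "\<lambda>x. cut (\<lambda>_. 1) f (t, x)"
  have int: "integrable lborel ?g" by (intro integrable_cut f t continuous_intros)
  have nn: "?g x \<ge> 0" for x using pos[of x] by (simp add: cut_def fiber_def less_imp_le)
  have "J (\<lambda>_. 1) f t \<noteq> 0"
  proof
    assume "J (\<lambda>_. 1) f t = 0"
    then have "AE x in lborel. ?g x = 0"
      unfolding J_def by (subst (asm) integral_nonneg_eq_0_iff_AE[OF int]) (use nn in auto)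
    then have "AE x in lborel. x \<notin> fiber D t"
    proof eventually_elim
      case (elim x)
      then show ?case using pos[of x] by (auto simp: cut_def fiber_def)
    qed
    then have "fiber D t \<in> null_sets lborel"
      by (subst (asm) AE_iff_null_sets[symmetric]) (simp_all add: open_fiber borel_open)
    then have "negligible (fiber D t)"
      by (simp add: negligible_iff_null_sets null_sets_completionI)
    then show False
      using open_not_negligible[OF open_fiber fiber_ne[of t]] t C_sub by blast
  qed
  moreover have "J (\<lambda>_. 1) f t \<ge> 0"
    unfolding J_def by (rule integral_nonneg_AE) (use nn in auto)
  ultimately show ?thesis by linarith
qed

text \<open>Dominated convergence with moving fibres. A point of the limit fibre eventually lies in
  the nearby fibres because D is open; a point outside its closure eventually lies in none, by
  \<open>closure_fiber\<close>. What remains is the frontier of a convex set, a null set.\<close>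

lemma J_tendsto:
  fixes f :: "'a \<times> 'b \<Rightarrow> 'c::euclidean_space"
  assumes t: "\<And>i. t i \<in> C" "t \<longlonglongrightarrow> l" "l \<in> C"
    and \<psi>: "\<And>i. continuous_on UNIV (\<psi> i)" "\<And>i r. \<bar>\<psi> i r\<bar> \<le> 1"
    and lim: "\<And>r s. r \<longlonglongrightarrow> s \<Longrightarrow> s < 0 \<Longrightarrow> (\<lambda>i. \<psi> i (r i)) \<longlonglongrightarrow> 1"
    and f: "continuous_on Dc f"
  shows "(\<lambda>i. J (\<psi> i) f (t i)) \<longlonglongrightarrow> J (\<lambda>_. 1) f l"
proof -
  obtain B where B: "B > 0" "\<And>z. z \<in> K \<Longrightarrow> norm (f z) \<le> B" using bounded_on_K[OF f] by blast
  let ?w = "\<lambda>x::'b. B * indicator (cball 0 R) x :: real"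
  show ?thesis
    unfolding J_def
  proof (rule integral_dominated_convergence[where w = ?w])
    show "integrable lborel ?w"
      using emeasure_lborel_cball_finite[of "0::'b" R] by simp
    show "(\<lambda>x. cut (\<lambda>_. 1) f (l, x)) \<in> borel_measurable lborel"
      using measurable_cut[OF f _ t(3)] by simp
    show "(\<lambda>x. cut (\<psi> i) f (t i, x)) \<in> borel_measurable lborel" for i
      using measurable_cut[OF f \<psi>(1) t(1)] by simp
    show "AE x in lborel. norm (cut (\<psi> i) f (t i, x)) \<le> ?w x" for i
    proof (intro AE_I2 norm_cut_le t)
      fix x assume "x \<in> fiber D (t i)"
      then have "norm (f (t i, x)) \<le> B" by (intro B in_K t)
      then have "\<bar>\<psi> i (\<rho> (t i, x))\<bar> * norm (f (t i, x)) \<le> 1 * B"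
        by (intro mult_mono \<psi>) auto
      then show "norm (\<psi> i (\<rho> (t i, x)) *\<^sub>R f (t i, x)) \<le> B" by simp
    qed (use B in auto)
    have "negligible (frontier (fiber D l))"
      using convex_fiber t(3) C_sub by (intro negligible_convex_frontier) auto
    then have "frontier (fiber D l) \<in> null_sets lborel"
      by (simp add: negligible_iff_null_sets null_sets_completion_iff)
    then have "AE x in lborel. x \<notin> frontier (fiber D l)"
      by (rule AE_not_in)
    then show "AE x in lborel. (\<lambda>i. cut (\<psi> i) f (t i, x)) \<longlonglongrightarrow> cut (\<lambda>_. 1) f (l, x)"
    proof eventually_elim
      case (elim x)
      have tx: "(\<lambda>i. (t i, x)) \<longlonglongrightarrow> (l, x)" by (intro tendsto_Pair t tendsto_const)
      show ?case
      proof (cases "x \<in> fiber D l")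
        case True
        then have lD: "(l, x) \<in> D" by (simp add: fiber_def)
        have ev: "\<forall>\<^sub>F i in sequentially. (t i, x) \<in> D"
          using topological_tendstoD[OF tx open_D lD] .
        then have ev': "\<forall>\<^sub>F i in sequentially. (t i, x) \<in> Dc"
          by (rule eventually_mono) (use D_sub_Dc in blast)
        have lDc: "(l, x) \<in> Dc" using lD D_sub_Dc by blast
        have "(\<lambda>i. \<rho> (t i, x)) \<longlonglongrightarrow> \<rho> (l, x)"
          by (rule continuous_on_tendsto_compose[OF continuous_rho tx lDc ev'])
        moreover have "\<rho> (l, x) < 0" using lD lDc D_iff by blast
        ultimately have "(\<lambda>i. \<psi> i (\<rho> (t i, x))) \<longlonglongrightarrow> 1" by (rule lim)
        moreover have "(\<lambda>i. f (t i, x)) \<longlonglongrightarrow> f (l, x)"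
          by (rule continuous_on_tendsto_compose[OF f tx lDc ev'])
        ultimately have "(\<lambda>i. \<psi> i (\<rho> (t i, x)) *\<^sub>R f (t i, x)) \<longlonglongrightarrow> 1 *\<^sub>R f (l, x)"
          by (rule tendsto_scaleR)
        moreover have "\<forall>\<^sub>F i in sequentially. \<psi> i (\<rho> (t i, x)) *\<^sub>R f (t i, x) = cut (\<psi> i) f (t i, x)"
          using ev by (rule eventually_mono) (simp add: cut_def)
        ultimately show ?thesis
          using lD by (simp add: cut_def[of "\<lambda>_. 1"]) (rule Lim_transform_eventually)
      next
        case False
        then have "x \<notin> closure (fiber D l)"
          using elim by (simp add: frontier_def interior_open[OF open_fiber])
        then have "(l, x) \<in> - closure D" using closure_fiber[of l x] t(3) C_sub by blast
        then have "\<forall>\<^sub>F i in sequentially. (t i, x) \<in> - closure D"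
          by (intro topological_tendstoD[OF tx]) auto
        then have ev: "\<forall>\<^sub>F i in sequentially. 0 = cut (\<psi> i) f (t i, x)"
          by (rule eventually_mono) (use closure_subset in \<open>auto simp: cut_def\<close>)
        have "cut (\<lambda>_. 1) f (l, x) = 0" using False by (simp add: cut_def fiber_def)
        then show ?thesis using Lim_transform_eventually[OF tendsto_const ev] by simp
      qed
    qed
  qed
qed

lemma J_chi_uniform_limit:
  fixes f :: "'a \<times> 'b \<Rightarrow> 'c::euclidean_space"
  assumes f: "continuous_on Dc f"
  shows "uniform_limit C (\<lambda>n. J (chi n) f) (J (\<lambda>_. 1) f) sequentially"
proof (rule uniform_limit_sequentiallyI[OF compact_C])
  fix t :: "nat \<Rightarrow> 'a" and l assume t: "\<And>i. t i \<in> C" "t \<longlonglongrightarrow> l" "l \<in> C"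
  show "(\<lambda>i. J (\<lambda>_. 1) f (t i)) \<longlonglongrightarrow> J (\<lambda>_. 1) f l"
    by (rule J_tendsto[OF t _ _ _ f]) auto
  fix ns :: "nat \<Rightarrow> nat" assume ns: "filterlim ns at_top sequentially"
  show "(\<lambda>i. J (chi (ns i)) f (t i)) \<longlonglongrightarrow> J (\<lambda>_. 1) f l"
  proof (rule J_tendsto[OF t _ _ _ f])
    show "\<bar>chi (ns i) r\<bar> \<le> 1" for i r using chi_bounds[of "ns i" r] by simp
  qed (use continuous_chi chi_tendsto_1[OF _ _ ns] in auto)
qed

lemma J_small_uniform_limit:
  fixes f :: "'a \<times> 'b \<Rightarrow> 'c::euclidean_space"
  assumes f: "continuous_on Dc f" and \<psi>: "\<And>n. continuous_on UNIV (\<psi> n)"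
    and b: "\<And>n r. \<bar>\<psi> n r\<bar> \<le> c / (real n + 1)"
  shows "uniform_limit C (\<lambda>n. J (\<psi> n) f) (\<lambda>_. 0) sequentially"
proof -
  obtain B where B: "B > 0" "\<And>z. z \<in> K \<Longrightarrow> norm (f z) \<le> B" using bounded_on_K[OF f] by blast
  have "(\<lambda>n. inverse (real (Suc n)) * (c * B * V)) \<longlonglongrightarrow> 0 * (c * B * V)"
    by (intro tendsto_mult tendsto_const LIMSEQ_inverse_real_of_nat)
  then have lim: "(\<lambda>n. c / (real n + 1) * B * V) \<longlonglongrightarrow> 0"
    by (simp add: field_simps)
  have c: "c / (real n + 1) \<ge> 0" for n using b[of n 0] by linarith
  show ?thesis
  proof (rule uniform_limitI)
    fix e :: real assume "e > 0"
    then have "\<forall>\<^sub>F n in sequentially. c / (real n + 1) * B * V < e"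
      using order_tendstoD(2)[OF lim] by blast
    then show "\<forall>\<^sub>F n in sequentially. \<forall>t\<in>C. dist (J (\<psi> n) f t) 0 < e"
    proof (rule eventually_mono, intro ballI)
      fix n t assume n: "c / (real n + 1) * B * V < e" and t: "t \<in> C"
      have cB: "0 \<le> c / (real n + 1) * B"
        by (rule mult_nonneg_nonneg[OF c]) (use B in simp)
      have "norm (J (\<psi> n) f t) \<le> c / (real n + 1) * B * V"
      proof (rule norm_J_le[OF f \<psi> t cB])
        fix x assume "x \<in> fiber D t"
        then have "norm (f (t, x)) \<le> B" by (intro B in_K t)
        then have "\<bar>\<psi> n (\<rho> (t, x))\<bar> * norm (f (t, x)) \<le> c / (real n + 1) * B"
          by (intro mult_mono b) (use c in auto)
        then show "norm (\<psi> n (\<rho> (t, x)) *\<^sub>R f (t, x)) \<le> c / (real n + 1) * B" by simp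
      qed
      with n show "dist (J (\<psi> n) f t) 0 < e" by simp
    qed
  qed
qed

end

section \<open>Integration by parts on the fibres and convergence of the boundary terms\<close>

context convex_family_over
begin

definition C1 :: "('a \<times> 'b \<Rightarrow> 'c::real_normed_vector) \<Rightarrow> ('a \<times> 'b \<Rightarrow> 'a \<times> 'b \<Rightarrow> 'c) \<Rightarrow> bool" where
  "C1 f f1 \<longleftrightarrow> (\<forall>z\<in>Dc. (f has_derivative (\<lambda>h. \<Sum>j\<in>Basis. (h \<bullet> j) *\<^sub>R f1 j z)) (at z)) \<and>
     (\<forall>j\<in>Basis. continuous_on Dc (f1 j))"

lemma C1D:
  assumes "C1 f f1"
  shows "z \<in> Dc \<Longrightarrow> (f has_derivative (\<lambda>h. \<Sum>j\<in>Basis. (h \<bullet> j) *\<^sub>R f1 j z)) (at z)"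
    and "j \<in> Basis \<Longrightarrow> continuous_on Dc (f1 j)"
    and "continuous_on Dc f"
proof -
  have *: "(f has_derivative (\<lambda>h. \<Sum>j\<in>Basis. (h \<bullet> j) *\<^sub>R f1 j z)) (at z)" if "z \<in> Dc" for z
    using assms that unfolding C1_def by blast
  show "continuous_on Dc f"
    by (rule has_derivative_continuous_on[OF has_derivative_at_withinI[OF *]])
  show "z \<in> Dc \<Longrightarrow> (f has_derivative (\<lambda>h. \<Sum>j\<in>Basis. (h \<bullet> j) *\<^sub>R f1 j z)) (at z)"
    by (rule *)
  show "j \<in> Basis \<Longrightarrow> continuous_on Dc (f1 j)"
    using assms unfolding C1_def by blast
qed

lemma C1_const: "C1 (\<lambda>_. c) (\<lambda>_ _. 0)"
  by (simp add: C1_def)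

lemma C1_add:
  assumes "C1 f f1" "C1 g g1"
  shows "C1 (\<lambda>z. f z + g z) (\<lambda>j z. f1 j z + g1 j z)"
  unfolding C1_def
proof (intro conjI ballI)
  fix z assume z: "z \<in> Dc"
  have "(\<lambda>h. (\<Sum>j\<in>Basis. (h \<bullet> j) *\<^sub>R f1 j z) + (\<Sum>j\<in>Basis. (h \<bullet> j) *\<^sub>R g1 j z))
    = (\<lambda>h. \<Sum>j\<in>Basis. (h \<bullet> j) *\<^sub>R (f1 j z + g1 j z))"
    by (simp only: scaleR_add_right sum.distrib)
  with has_derivative_add[OF C1D(1)[OF assms(1) z] C1D(1)[OF assms(2) z]]
  show "((\<lambda>z. f z + g z) has_derivative (\<lambda>h. \<Sum>j\<in>Basis. (h \<bullet> j) *\<^sub>R (f1 j z + g1 j z))) (at z)"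
    by simp
qed (intro continuous_intros C1D[OF assms(1)] C1D[OF assms(2)])

lemma C1_sum:
  assumes "\<And>i. i \<in> A \<Longrightarrow> C1 (f i) (f1 i)"
  shows "C1 (\<lambda>z. \<Sum>i\<in>A. f i z) (\<lambda>j z. \<Sum>i\<in>A. f1 i j z)"
  using assms
proof (induction A rule: infinite_finite_induct)
  case (insert x A)
  have "C1 (\<lambda>z. f x z + (\<Sum>i\<in>A. f i z)) (\<lambda>j z. f1 x j z + (\<Sum>i\<in>A. f1 i j z))"
    by (rule C1_add[OF insert.prems insert.IH]) (simp_all add: insert.prems)
  then show ?case using insert.hyps by simp
qed (simp_all add: C1_const)

lemma C1_scaleR:
  assumes a: "C1 a a1" and f: "C1 f f1"
  shows "C1 (\<lambda>z. a z *\<^sub>R f z) (\<lambda>j z. a z *\<^sub>R f1 j z + a1 j z *\<^sub>R f z)"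
  unfolding C1_def
proof (intro conjI ballI)
  fix z assume z: "z \<in> Dc"
  have "(\<lambda>h. a z *\<^sub>R (\<Sum>j\<in>Basis. (h \<bullet> j) *\<^sub>R f1 j z) + (\<Sum>j\<in>Basis. (h \<bullet> j) *\<^sub>R a1 j z) *\<^sub>R f z)
    = (\<lambda>h. \<Sum>j\<in>Basis. (h \<bullet> j) *\<^sub>R (a z *\<^sub>R f1 j z + a1 j z *\<^sub>R f z))"
    unfolding scaleR_sum_right scaleR_sum_left sum.distrib[symmetric]
    by (intro ext sum.cong refl) (simp add: scaleR_add_right mult_ac)
  with has_derivative_scaleR[OF C1D(1)[OF a z] C1D(1)[OF f z]]
  show "((\<lambda>z. a z *\<^sub>R f z) has_derivative (\<lambda>h. \<Sum>j\<in>Basis. (h \<bullet> j) *\<^sub>R (a z *\<^sub>R f1 j z + a1 j z *\<^sub>R f z))) (at z)"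
    by simp
qed (intro continuous_intros C1D[OF a] C1D[OF f])

lemma C1_inverse:
  fixes a :: "'a \<times> 'b \<Rightarrow> real"
  assumes a: "C1 a a1" and pos: "\<And>z. z \<in> Dc \<Longrightarrow> a z \<noteq> 0"
  shows "C1 (\<lambda>z. inverse (a z)) (\<lambda>j z. - (inverse (a z) * a1 j z * inverse (a z)))"
  unfolding C1_def
proof (intro conjI ballI)
  fix z assume z: "z \<in> Dc"
  have "(\<lambda>h. - (inverse (a z) * (\<Sum>j\<in>Basis. (h \<bullet> j) *\<^sub>R a1 j z) * inverse (a z))) =
     (\<lambda>h. \<Sum>j\<in>Basis. (h \<bullet> j) *\<^sub>R - (inverse (a z) * a1 j z * inverse (a z)))"
    unfolding sum_distrib_left sum_distrib_right sum_negf[symmetric] real_scaleR_def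
    by (intro ext sum.cong refl) algebra
  with Deriv.has_derivative_inverse[OF pos[OF z] C1D(1)[OF a z]]
  show "((\<lambda>z. inverse (a z)) has_derivative
      (\<lambda>h. \<Sum>j\<in>Basis. (h \<bullet> j) *\<^sub>R - (inverse (a z) * a1 j z * inverse (a z)))) (at z)"
    by simp
qed (use pos in \<open>intro continuous_intros C1D[OF a]; blast\<close>)

lemma C1_rho: "C1 \<rho> \<rho>1"
  unfolding C1_def using C2_partialsD(1)[OF rho] continuous_on_subset[OF C2_partials_continuous(2)[OF rho]] by auto

lemma C1_rho1: "e \<in> Basis \<Longrightarrow> C1 (\<rho>1 e) (\<rho>2 e)"
  unfolding C1_def using C2_partialsD(2)[OF rho] continuous_on_subset[OF C2_partialsD(3)[OF rho]] by auto

lemma C1_N: "\<exists>n1. C1 N n1"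
proof -
  have N: "N = (\<lambda>z. (\<Sum>e\<in>Basis. \<rho>1 (0, e) z *\<^sub>R \<rho>1 (0, e) z) + \<rho> z *\<^sub>R \<rho> z *\<^sub>R \<rho> z *\<^sub>R \<rho> z)"
    by (simp add: N_def fun_eq_iff power2_eq_square power4_eq_xxxx)
  have e: "(0, e) \<in> (Basis :: ('a \<times> 'b) set)" if "e \<in> Basis" for e :: 'b
    using that by (simp add: Basis_prod_def)
  have "C1 (\<lambda>z. \<Sum>e\<in>Basis. \<rho>1 (0, e) z *\<^sub>R \<rho>1 (0, e) z)
    (\<lambda>j z. \<Sum>e\<in>Basis. \<rho>1 (0, e) z *\<^sub>R \<rho>2 (0, e) j z + \<rho>2 (0, e) j z *\<^sub>R \<rho>1 (0, e) z)"
    by (intro C1_sum C1_scaleR C1_rho1 e)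
  from C1_add[OF this C1_scaleR[OF C1_rho C1_scaleR[OF C1_rho C1_scaleR[OF C1_rho C1_rho]]]]
  show ?thesis unfolding N by blast
qed

lemma cut_line:
  fixes f :: "'a \<times> 'b \<Rightarrow> 'c::euclidean_space"
  assumes \<psi>: "\<And>r. (\<psi> has_real_derivative \<psi>' r) (at r)" "\<And>r. r \<ge> 0 \<Longrightarrow> \<psi> r = 0" "\<And>r. r \<ge> 0 \<Longrightarrow> \<psi>' r = 0"
    and f: "C1 f f1" and t: "t \<in> U" and e: "e \<in> Basis"
  shows "((\<lambda>y. cut \<psi> f (t, x + y *\<^sub>R e)) has_vector_derivative
     cut \<psi> (f1 (0, e)) (t, x + y *\<^sub>R e) + cut \<psi>' (\<lambda>z. \<rho>1 (0, e) z *\<^sub>R f z) (t, x + y *\<^sub>R e)) (at y)"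
proof -
  have eq: "(t, x) + y *\<^sub>R (0, e) = (t, x + y *\<^sub>R e)" for y by simp
  have "((\<lambda>y. cut \<psi> f ((t, x) + y *\<^sub>R (0, e))) has_vector_derivative
     cut \<psi> (f1 (0, e)) ((t, x) + y *\<^sub>R (0, e)) + cut \<psi>' (\<lambda>z. \<rho>1 (0, e) z *\<^sub>R f z) ((t, x) + y *\<^sub>R (0, e))) (at y)"
  proof (rule has_derivative_line_Basis[where p = "\<lambda>j. cut \<psi> (f1 j) ((t, x) + y *\<^sub>R (0, e)) +
        cut \<psi>' (\<lambda>z. \<rho>1 j z *\<^sub>R f z) ((t, x) + y *\<^sub>R (0, e))"])
    show "(cut \<psi> f has_derivative (\<lambda>h. \<Sum>j\<in>Basis. (h \<bullet> j) *\<^sub>R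
        (cut \<psi> (f1 j) ((t, x) + y *\<^sub>R (0, e)) + cut \<psi>' (\<lambda>z. \<rho>1 j z *\<^sub>R f z) ((t, x) + y *\<^sub>R (0, e)))))
        (at ((t, x) + y *\<^sub>R (0, e)))"
    proof (rule has_derivative_cut[OF \<psi>])
      assume "(t, x) + y *\<^sub>R (0, e) \<in> Dc"
      then show "(f has_derivative (\<lambda>h. \<Sum>j\<in>Basis. (h \<bullet> j) *\<^sub>R f1 j ((t, x) + y *\<^sub>R (0, e)))) (at ((t, x) + y *\<^sub>R (0, e)))"
        by (rule C1D(1)[OF f])
    qed (use t in auto)
    show "(0, e) \<in> (Basis :: ('a \<times> 'b) set)" using e by (simp add: Basis_prod_def)
  qed
  then show ?thesis unfolding eq .
qed

lemma continuous_on_cut_fiber: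
  assumes "continuous_on UNIV \<psi>" "\<And>r. r \<ge> 0 \<Longrightarrow> \<psi> r = 0" "continuous_on Dc f" "t \<in> U"
  shows "continuous_on UNIV (\<lambda>x. cut \<psi> f (t, x))"
  by (rule continuous_on_compose2[OF continuous_on_cut[OF assms(1-3)]])
    (use assms(4) in \<open>auto intro!: continuous_intros\<close>)

lemma cut_support: "t \<in> C \<Longrightarrow> b \<in> Basis \<Longrightarrow> cut \<psi> f (t, x) \<noteq> 0 \<Longrightarrow> \<bar>x \<bullet> b\<bar> < R"
  using norm_less[of t x] Basis_le_norm[of b x] by (force simp: cut_def fiber_def split: if_splits)

text \<open>The fibre integral of the derivative of \<psi>(\<rho>) f in direction e is 0; this
  trades a derivative of \<psi> for one of f.\<close>

lemma J_partial:
  fixes f :: "'a \<times> 'b \<Rightarrow> 'c::euclidean_space"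
  assumes \<psi>: "\<And>r. (\<psi> has_real_derivative \<psi>' r) (at r)" "\<And>r. r \<ge> 0 \<Longrightarrow> \<psi> r = 0" "\<And>r. r \<ge> 0 \<Longrightarrow> \<psi>' r = 0"
    and \<psi>': "continuous_on UNIV \<psi>'" and f: "C1 f f1" and t: "t \<in> C" and e: "e \<in> Basis"
  shows "J \<psi>' (\<lambda>z. \<rho>1 (0, e) z *\<^sub>R f z) t = - J \<psi> (f1 (0, e)) t"
proof -
  have e': "(0, e) \<in> (Basis :: ('a \<times> 'b) set)" using e by (simp add: Basis_prod_def)
  have c\<psi>: "continuous_on UNIV \<psi>" using \<psi>(1) DERIV_isCont continuous_at_imp_continuous_on by blast
  have c1: "continuous_on Dc (f1 (0, e))" by (rule C1D(2)[OF f e'])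
  have c2: "continuous_on Dc (\<lambda>z. \<rho>1 (0, e) z *\<^sub>R f z)"
    by (intro continuous_intros C1D(3)[OF f] C1D(2)[OF C1_rho e'])
  have tU: "t \<in> U" using t C_sub by blast
  let ?f' = "\<lambda>x. cut \<psi> (f1 (0, e)) (t, x) + cut \<psi>' (\<lambda>z. \<rho>1 (0, e) z *\<^sub>R f z) (t, x)"
  have "(\<integral>x. ?f' x \<partial>lborel) = 0"
  proof (rule integral_partial_derivative_zero[OF e])
    show "continuous_on UNIV ?f'"
      by (intro continuous_intros continuous_on_cut_fiber c\<psi> \<psi> \<psi>' c1 c2 tU)
    show "((\<lambda>y. cut \<psi> f (t, x + y *\<^sub>R e)) has_vector_derivative ?f' (x + y *\<^sub>R e)) (at y)" for x y
      by (rule cut_line[OF \<psi> f tU e])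
    show "\<bar>x \<bullet> b\<bar> < R" if "b \<in> Basis" "cut \<psi> f (t, x) \<noteq> 0" for x b
      by (rule cut_support[OF t that])
    show "\<bar>x \<bullet> b\<bar> < R" if b: "b \<in> Basis" and nz: "?f' x \<noteq> 0" for x b
    proof -
      have "cut \<psi> (f1 (0, e)) (t, x) \<noteq> 0 \<or> cut \<psi>' (\<lambda>z. \<rho>1 (0, e) z *\<^sub>R f z) (t, x) \<noteq> 0"
        using nz by auto
      then show ?thesis using cut_support[OF t b] by blast
    qed
  qed
  moreover have "(\<integral>x. ?f' x \<partial>lborel) = J \<psi> (f1 (0, e)) t + J \<psi>' (\<lambda>z. \<rho>1 (0, e) z *\<^sub>R f z) t"
    unfolding J_def
    by (intro Bochner_Integration.integral_add integrable_cut c\<psi> \<psi>' c1 c2 t)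
  ultimately show ?thesis by (simp add: eq_neg_iff_add_eq_0 add.commute)
qed

text \<open>
  Dividing by \<open>N = \<bar>\<nabla>\<^sub>x \<rho>\<bar>\<^sup>2 + \<rho>\<^sup>4\<close> instead of \<open>\<bar>\<nabla>\<^sub>x \<rho>\<bar>\<^sup>2\<close> avoids the critical points of \<open>\<rho>\<close> in the interior;
  the resulting error term carries a factor \<open>\<rho>\<^sup>4\<close>, which compensates the growth of \<open>\<psi>'\<close>.
\<close>

lemma J_derivative_formula:
  fixes F :: "'a \<times> 'b \<Rightarrow> 'c::euclidean_space"
  assumes F: "C1 F F1"
  shows "\<exists>Y. continuous_on Dc Y \<and> (\<forall>\<psi> \<psi>' t. (\<forall>r. (\<psi> has_real_derivative \<psi>' r) (at r)) \<longrightarrow>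
     (\<forall>r\<ge>0. \<psi> r = 0 \<and> \<psi>' r = 0) \<longrightarrow> continuous_on UNIV \<psi>' \<longrightarrow> t \<in> C \<longrightarrow>
     J \<psi>' F t = - J \<psi> Y t + J (\<lambda>r. r ^ 4 * \<psi>' r) (\<lambda>z. inverse (N z) *\<^sub>R F z) t)"
proof -
  obtain n1 where n1: "C1 N n1" using C1_N by blast
  have Nz: "N z \<noteq> 0" if "z \<in> Dc" for z using N_pos[OF that] by simp
  have e': "(0, e) \<in> (Basis :: ('a \<times> 'b) set)" if "e \<in> Basis" for e :: 'b
    using that by (simp add: Basis_prod_def)
  \<comment> \<open>The fibre vector field F \<nabla>\<rho> / N; its divergence will be
    \<open>Y\<close>.\<close>
  define W where "W e z = \<rho>1 (0, e) z *\<^sub>R (inverse (N z) *\<^sub>R F z)" for e z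
  have "\<exists>w1. C1 (W e) w1" if "e \<in> Basis" for e
    unfolding W_def[abs_def]
    by (intro exI, rule C1_scaleR[OF C1_rho1[OF e'[OF that]] C1_scaleR[OF C1_inverse[OF n1 Nz] F]])
  then obtain w1 where w1: "\<And>e. e \<in> Basis \<Longrightarrow> C1 (W e) (w1 e)" by metis
  define Y where "Y z = (\<Sum>e\<in>Basis. w1 e (0, e) z)" for z
  have cY: "continuous_on Dc Y"
    unfolding Y_def by (intro continuous_intros C1D(2)[OF w1] e')
  have cF: "continuous_on Dc (\<lambda>z. inverse (N z) *\<^sub>R F z)"
    using Nz by (intro continuous_intros C1D(3)[OF n1] C1D(3)[OF F]) blast
  have cr: "continuous_on Dc (\<lambda>z. \<rho>1 (0, e) z *\<^sub>R W e z)" if "e \<in> Basis" for e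
    by (intro continuous_intros C1D(3)[OF w1[OF that]] C1D(2)[OF C1_rho e'[OF that]])
  show ?thesis
  proof (intro exI[of _ Y] conjI cY allI impI)
    fix \<psi> \<psi>' t
    assume "\<forall>r. (\<psi> has_real_derivative \<psi>' r) (at r)" "\<forall>r\<ge>0. \<psi> r = 0 \<and> \<psi>' r = 0"
      and \<psi>': "continuous_on UNIV \<psi>'" and t: "t \<in> C"
    then have \<psi>: "\<And>r. (\<psi> has_real_derivative \<psi>' r) (at r)" "\<And>r. r \<ge> 0 \<Longrightarrow> \<psi> r = 0" "\<And>r. r \<ge> 0 \<Longrightarrow> \<psi>' r = 0"
      by auto
    have c\<psi>: "continuous_on UNIV \<psi>" using \<psi>(1) DERIV_isCont continuous_at_imp_continuous_on by blast
    let ?G = "\<lambda>z. \<rho> z ^ 4 *\<^sub>R (inverse (N z) *\<^sub>R F z)"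
    have cG: "continuous_on Dc ?G" by (intro continuous_intros continuous_rho cF)
    \<comment> \<open>F is split by 1 = |\<nabla>\<rho>|^2 / N + \<rho>^4 / N with the fibre
      gradient of \<rho>: the first part is integrated by parts, the second is the error
      term.\<close>
    have "J \<psi>' F t = J \<psi>' (\<lambda>z. (\<Sum>e\<in>Basis. \<rho>1 (0, e) z *\<^sub>R W e z) + ?G z) t"
    proof (rule J_cong)
      fix x assume "x \<in> fiber D t"
      then have z: "(t, x) \<in> Dc" using in_K[OF t] by blast
      have "(\<Sum>e\<in>Basis. \<rho>1 (0, e) (t, x) *\<^sub>R W e (t, x)) + ?G (t, x) = (N (t, x) * inverse (N (t, x))) *\<^sub>R F (t, x)"
        by (simp add: W_def N_def scaleR_add_left scaleR_sum_left power2_eq_square mult_ac distrib_left distrib_right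
            sum_distrib_left sum_distrib_right)
      also have "\<dots> = F (t, x)" using Nz[OF z] by simp
      finally show "\<psi>' (\<rho> (t, x)) *\<^sub>R F (t, x) =
          \<psi>' (\<rho> (t, x)) *\<^sub>R ((\<Sum>e\<in>Basis. \<rho>1 (0, e) (t, x) *\<^sub>R W e (t, x)) + ?G (t, x))" by simp
    qed
    also have "\<dots> = (\<Sum>e\<in>Basis. J \<psi>' (\<lambda>z. \<rho>1 (0, e) z *\<^sub>R W e z) t) + J \<psi>' ?G t"
    proof -
      have "J \<psi>' (\<lambda>z. (\<Sum>e\<in>Basis. \<rho>1 (0, e) z *\<^sub>R W e z) + ?G z) t =
          J \<psi>' (\<lambda>z. \<Sum>e\<in>Basis. \<rho>1 (0, e) z *\<^sub>R W e z) t + J \<psi>' ?G t"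
        by (rule J_add[OF continuous_on_sum[OF cr] cG \<psi>' t])
      also have "J \<psi>' (\<lambda>z. \<Sum>e\<in>Basis. \<rho>1 (0, e) z *\<^sub>R W e z) t = (\<Sum>e\<in>Basis. J \<psi>' (\<lambda>z. \<rho>1 (0, e) z *\<^sub>R W e z) t)"
        by (rule J_sum[OF cr \<psi>' t])
      finally show ?thesis .
    qed
    also have "(\<Sum>e\<in>Basis. J \<psi>' (\<lambda>z. \<rho>1 (0, e) z *\<^sub>R W e z) t) = (\<Sum>e\<in>Basis. - J \<psi> (w1 e (0, e)) t)"
      by (intro sum.cong refl J_partial[OF \<psi> \<psi>' w1 t])
    also have "\<dots> = - J \<psi> Y t"
      unfolding Y_def by (subst J_sum[OF _ c\<psi> t]) (auto intro!: C1D(2)[OF w1] e' simp: sum_negf)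
    also have "J \<psi>' ?G t = J (\<lambda>r. r ^ 4 * \<psi>' r) (\<lambda>z. inverse (N z) *\<^sub>R F z) t"
      by (rule J_cong) (simp add: mult_ac)
    finally show "J \<psi>' F t = - J \<psi> Y t + J (\<lambda>r. r ^ 4 * \<psi>' r) (\<lambda>z. inverse (N z) *\<^sub>R F z) t" .
  qed
qed

text \<open>In the derivative formula with \<psi> = \<chi> the divergence term converges by
  dominated convergence and the error term is of order 1 / n.\<close>

lemma J_chi'_C1:
  fixes F :: "'a \<times> 'b \<Rightarrow> 'c::euclidean_space"
  assumes F: "C1 F F1"
  shows "uniformly_convergent_on C (\<lambda>n. J (chi' n) F)"
proof -
  obtain n1 where n1: "C1 N n1" using C1_N by blast
  have cF: "continuous_on Dc (\<lambda>z. inverse (N z) *\<^sub>R F z)"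
    using N_pos by (intro continuous_intros C1D(3)[OF n1] C1D(3)[OF F]) (metis less_irrefl)
  obtain Y where cY: "continuous_on Dc Y" and Y0: "\<forall>\<psi> \<psi>' t. (\<forall>r. (\<psi> has_real_derivative \<psi>' r) (at r)) \<longrightarrow>
     (\<forall>r\<ge>0. \<psi> r = 0 \<and> \<psi>' r = 0) \<longrightarrow> continuous_on UNIV \<psi>' \<longrightarrow> t \<in> C \<longrightarrow>
     J \<psi>' F t = - J \<psi> Y t + J (\<lambda>r. r ^ 4 * \<psi>' r) (\<lambda>z. inverse (N z) *\<^sub>R F z) t"
    using J_derivative_formula[OF F] by (elim exE conjE) (rule that)
  have Y: "J (chi' n) F t = - J (chi n) Y t + J (\<lambda>r. r ^ 4 * chi' n r) (\<lambda>z. inverse (N z) *\<^sub>R F z) t" if "t \<in> C" for n t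
    by (rule Y0[rule_format, of "chi n" "chi' n" t, OF DERIV_chi _ continuous_chi(2) that]) (simp add: chi_nonneg_arg)
  have "uniform_limit C (\<lambda>n t. - J (chi n) Y t + J (\<lambda>r. r ^ 4 * chi' n r) (\<lambda>z. inverse (N z) *\<^sub>R F z) t)
     (\<lambda>t. - J (\<lambda>_. 1) Y t + 0) sequentially"
    by (intro uniform_limit_intros J_chi_uniform_limit cY J_small_uniform_limit[OF cF, where c = 2304]
        pow4_chi continuous_intros continuous_chi)
  then have "uniformly_convergent_on C (\<lambda>n t. - J (chi n) Y t + J (\<lambda>r. r ^ 4 * chi' n r) (\<lambda>z. inverse (N z) *\<^sub>R F z) t)"
    by (rule uniformly_convergentI)
  then show ?thesis
    by (rule uniformly_convergent_cong[THEN iffD1, rotated 2]) (use Y in auto)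
qed

text \<open>As \<chi>' \<le> 0, this is a uniform bound for the mass of the positive measures -
  \<chi>'(\<rho>) dx on the fibres, read off from the derivative formula for F = 1.\<close>

lemma J_chi'_bounded: "\<exists>M. \<forall>n. \<forall>t\<in>C. - J (chi' n) (\<lambda>_. 1::real) t \<le> M"
proof -
  obtain n1 where n1: "C1 N n1" using C1_N by blast
  have cN: "continuous_on Dc (\<lambda>z. inverse (N z) *\<^sub>R (1::real))"
    using N_pos by (intro continuous_intros C1D(3)[OF n1]) (metis less_irrefl)
  obtain Y where cY: "continuous_on Dc Y" and Y0: "\<forall>\<psi> \<psi>' t. (\<forall>r. (\<psi> has_real_derivative \<psi>' r) (at r)) \<longrightarrow>
     (\<forall>r\<ge>0. \<psi> r = 0 \<and> \<psi>' r = 0) \<longrightarrow> continuous_on UNIV \<psi>' \<longrightarrow> t \<in> C \<longrightarrow>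
     J \<psi>' (\<lambda>_. 1::real) t = - J \<psi> Y t + J (\<lambda>r. r ^ 4 * \<psi>' r) (\<lambda>z. inverse (N z) *\<^sub>R 1) t"
    using J_derivative_formula[OF C1_const[of "1::real"]] by (elim exE conjE) (rule that)
  have Y: "J (chi' n) (\<lambda>_. 1::real) t = - J (chi n) Y t + J (\<lambda>r. r ^ 4 * chi' n r) (\<lambda>z. inverse (N z) *\<^sub>R 1) t" if "t \<in> C" for n t
    by (rule Y0[rule_format, of "chi n" "chi' n" t, OF DERIV_chi _ continuous_chi(2) that]) (simp add: chi_nonneg_arg)
  obtain B1 where B1: "B1 > 0" "\<And>z. z \<in> K \<Longrightarrow> norm (Y z) \<le> B1" using bounded_on_K[OF cY] by blast
  obtain B2 where B2: "B2 > 0" "\<And>z. z \<in> K \<Longrightarrow> norm (inverse (N z) *\<^sub>R (1::real)) \<le> B2"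
    using bounded_on_K[OF cN] by blast
  have "- J (chi' n) (\<lambda>_. 1::real) t \<le> B1 * V + 2304 * B2 * V" if t: "t \<in> C" for n t
  proof -
    have "norm (J (chi n) Y t) \<le> B1 * V"
    proof (rule norm_J_le[OF cY continuous_chi(1) t])
      fix x assume "x \<in> fiber D t"
      then have "norm (Y (t, x)) \<le> B1" by (intro B1 in_K t)
      then have "\<bar>chi n (\<rho> (t, x))\<bar> * norm (Y (t, x)) \<le> 1 * B1"
        using chi_bounds[of n "\<rho> (t, x)"] by (intro mult_mono) auto
      then show "norm (chi n (\<rho> (t, x)) *\<^sub>R Y (t, x)) \<le> B1" by (simp add: abs_mult)
    qed (use B1 in simp)
    moreover have "norm (J (\<lambda>r. r ^ 4 * chi' n r) (\<lambda>z. inverse (N z) *\<^sub>R (1::real)) t) \<le> 2304 * B2 * V"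
    proof (rule norm_J_le[OF cN _ t])
      fix x assume "x \<in> fiber D t"
      then have b: "norm (inverse (N (t, x)) *\<^sub>R (1::real)) \<le> B2" by (intro B2 in_K t)
      have "2304 / (real n + 1) \<le> 2304 / 1" by (intro divide_left_mono) auto
      then have "\<bar>\<rho> (t, x) ^ 4 * chi' n (\<rho> (t, x))\<bar> \<le> 2304"
        using pow4_chi(1)[of "\<rho> (t, x)" n] by linarith
      then have "\<bar>\<rho> (t, x) ^ 4 * chi' n (\<rho> (t, x))\<bar> * norm (inverse (N (t, x)) *\<^sub>R (1::real)) \<le> 2304 * B2"
        using b by (intro mult_mono) auto
      then show "norm ((\<rho> (t, x) ^ 4 * chi' n (\<rho> (t, x))) *\<^sub>R (inverse (N (t, x)) *\<^sub>R (1::real))) \<le> 2304 * B2"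
        by (simp add: abs_mult)
    qed (use B2 continuous_chi(2) in \<open>auto intro!: continuous_intros\<close>)
    ultimately show ?thesis unfolding Y[OF t] by simp
  qed
  then show ?thesis by blast
qed

lemma norm_J_chi'_le:
  fixes f :: "'a \<times> 'b \<Rightarrow> 'c::euclidean_space"
  assumes f: "continuous_on Dc f" and t: "t \<in> C" and c: "\<And>x. x \<in> fiber D t \<Longrightarrow> norm (f (t, x)) \<le> c"
  shows "norm (J (chi' n) f t) \<le> c * (- J (chi' n) (\<lambda>_. 1::real) t)"
proof -
  have i1: "integrable lborel (\<lambda>x. cut (chi' n) f (t, x))" by (rule integrable_cut[OF f continuous_chi(2) t])
  have i2: "integrable lborel (\<lambda>x. cut (chi' n) (\<lambda>_. 1::real) (t, x))"
    by (rule integrable_cut[OF continuous_on_const continuous_chi(2) t])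
  have "norm (J (chi' n) f t) \<le> (\<integral>x. norm (cut (chi' n) f (t, x)) \<partial>lborel)"
    unfolding J_def by (rule integral_norm_bound)
  also have "\<dots> \<le> (\<integral>x. - c * cut (chi' n) (\<lambda>_. 1) (t, x) \<partial>lborel)"
  proof (rule integral_mono)
    fix x
    show "norm (cut (chi' n) f (t, x)) \<le> - c * cut (chi' n) (\<lambda>_. 1) (t, x)"
    proof (cases "x \<in> fiber D t")
      case True
      have "\<bar>chi' n (\<rho> (t, x))\<bar> * norm (f (t, x)) \<le> \<bar>chi' n (\<rho> (t, x))\<bar> * c"
        by (rule mult_left_mono[OF c[OF True]]) simp
      then show ?thesis using True chi_bounds(3)[of n "\<rho> (t, x)"] by (simp add: cut_def fiber_def mult.commute)
    qed (simp add: cut_def fiber_def)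
  qed (intro integrable_norm i1, intro integrable_mult_right i2)
  also have "\<dots> = c * (- J (chi' n) (\<lambda>_. 1::real) t)"
    unfolding J_def by simp
  finally show ?thesis .
qed

lemma C1_real_polynomial:
  assumes "real_polynomial_function p"
  shows "\<exists>p1. C1 p p1"
  using assms
proof induction
  case (linear f)
  have eq: "f h = (\<Sum>j\<in>Basis. (h \<bullet> j) *\<^sub>R f j)" for h
    by (subst euclidean_representation[of h, symmetric])
      (simp only: linear_sum[OF bounded_linear.linear[OF linear]] linear_scale[OF bounded_linear.linear[OF linear]])
  have "C1 f (\<lambda>j _. f j)"
    unfolding C1_def
    by (intro conjI ballI has_derivative_eq_rhs[OF bounded_linear_imp_has_derivative[OF linear]] continuous_on_const)
      (rule ext, rule eq)
  then show ?case by blast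
next
  case (const c)
  then show ?case using C1_const by blast
next
  case (add f g)
  then show ?case using C1_add by blast
next
  case (mult f g)
  then obtain f1 g1 where "C1 f f1" "C1 g g1" by blast
  from C1_scaleR[OF this] show ?case by auto
qed

lemma C1_polynomial:
  fixes p :: "'a \<times> 'b \<Rightarrow> 'c::euclidean_space"
  assumes "polynomial_function p"
  shows "\<exists>p1. C1 p p1"
proof -
  have "\<exists>p1. C1 (\<lambda>z. p z \<bullet> b) p1" for b
    using assms bounded_linear_inner_left[of b] C1_real_polynomial
    unfolding polynomial_function_def o_def by blast
  then obtain q where q: "\<And>b. C1 (\<lambda>z. p z \<bullet> b) (q b)" by metis
  have "\<exists>p1. C1 (\<lambda>z. \<Sum>b\<in>Basis. (p z \<bullet> b) *\<^sub>R b) p1"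
    by (intro exI, rule C1_sum, rule C1_scaleR[OF q C1_const])
  then show ?thesis by (simp add: euclidean_representation)
qed

text \<open>Continuity of F must suffice, since F will involve second derivatives of \<rho>.
  Polynomials are C1 and uniformly dense on the compact set \<open>K\<close>, and the bounded mass
  makes the replacement error small for all n at once.\<close>

lemma J_chi'_convergent:
  fixes F :: "'a \<times> 'b \<Rightarrow> 'c::euclidean_space"
  assumes F: "continuous_on Dc F"
  shows "uniformly_convergent_on C (\<lambda>n. J (chi' n) F)"
proof (rule Cauchy_uniformly_convergent, rule uniformly_Cauchy_onI)
  fix \<epsilon> :: real assume \<epsilon>: "\<epsilon> > 0"
  obtain M0 where M0: "\<And>n t. t \<in> C \<Longrightarrow> - J (chi' n) (\<lambda>_. 1::real) t \<le> M0" using J_chi'_bounded by blast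
  define M where "M = \<bar>M0\<bar> + 1"
  have M: "M > 0" "\<And>n t. t \<in> C \<Longrightarrow> - J (chi' n) (\<lambda>_. 1::real) t \<le> M"
  proof -
    show "- J (chi' n) (\<lambda>_. 1::real) t \<le> M" if "t \<in> C" for n t
      using M0[OF that, of n] by (simp add: M_def)
  qed (simp add: M_def)
  have "continuous_on K F" by (rule continuous_on_subset[OF F]) auto
  \<comment> \<open>The two replacement errors are at most \<epsilon> / 4 each, which leaves
    \<epsilon> / 2 for the Cauchy estimate of g.\<close>
  then obtain g where g: "polynomial_function g" "\<And>z. z \<in> K \<Longrightarrow> norm (F z - g z) < \<epsilon> / (4 * M)"
    using Stone_Weierstrass_polynomial_function[OF compact_K _, of F "\<epsilon> / (4 * M)"] \<epsilon> M by auto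
  obtain g1 where g1: "C1 g g1" using C1_polynomial[OF g(1)] by blast
  have "uniformly_Cauchy_on C (\<lambda>n. J (chi' n) g)"
    by (rule uniformly_convergent_Cauchy[OF J_chi'_C1[OF g1]])
  then obtain n0 where n0: "\<And>t m n. t \<in> C \<Longrightarrow> m \<ge> n0 \<Longrightarrow> n \<ge> n0 \<Longrightarrow> dist (J (chi' m) g t) (J (chi' n) g t) < \<epsilon> / 2"
    using \<epsilon> unfolding uniformly_Cauchy_on_def by (metis half_gt_zero)
  have close: "dist (J (chi' n) F t) (J (chi' n) g t) \<le> \<epsilon> / 4" if t: "t \<in> C" for n t
  proof -
    have "J (chi' n) F t - J (chi' n) g t = J (chi' n) (\<lambda>z. F z - g z) t"
      by (rule J_diff[OF F C1D(3)[OF g1] continuous_chi(2) t, symmetric])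
    moreover have "norm (J (chi' n) (\<lambda>z. F z - g z) t) \<le> \<epsilon> / (4 * M) * (- J (chi' n) (\<lambda>_. 1::real) t)"
      using g(2) in_K[OF t] by (intro norm_J_chi'_le continuous_intros F C1D(3)[OF g1] t) (auto intro: less_imp_le)
    moreover have "\<epsilon> / (4 * M) * (- J (chi' n) (\<lambda>_. 1::real) t) \<le> \<epsilon> / (4 * M) * M"
      using \<epsilon> M t by (intro mult_left_mono M) auto
    moreover have "\<epsilon> / (4 * M) * M = \<epsilon> / 4" using M by simp
    ultimately show ?thesis by (simp add: dist_norm)
  qed
  show "\<exists>n0. \<forall>t\<in>C. \<forall>m\<ge>n0. \<forall>n\<ge>n0. dist (J (chi' m) F t) (J (chi' n) F t) < \<epsilon>"
  proof (intro exI[of _ n0] ballI allI impI)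
    fix t m n assume t: "t \<in> C" and mn: "m \<ge> n0" "n \<ge> n0"
    have "dist (J (chi' m) F t) (J (chi' n) F t) \<le> dist (J (chi' m) F t) (J (chi' m) g t)
        + dist (J (chi' m) g t) (J (chi' n) g t) + dist (J (chi' n) F t) (J (chi' n) g t)"
      using dist_triangle[of "J (chi' m) F t" "J (chi' n) F t" "J (chi' m) g t"]
        dist_triangle[of "J (chi' m) g t" "J (chi' n) F t" "J (chi' n) g t"]
      by (simp add: dist_commute[of "J (chi' n) g t"])
    also have "\<dots> < \<epsilon>" using close[OF t, of m] close[OF t, of n] n0[OF t mn] \<epsilon> by linarith
    finally show "dist (J (chi' m) F t) (J (chi' n) F t) < \<epsilon>" .
  qed
qed

text \<open>The derivative formula with \<psi> = \<chi>' lowers \<chi>'' to \<chi>' at the price of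
  one derivative of F; the resulting \<open>Y\<close> is only continuous, which is why
  \<open>J_chi'_convergent\<close> is needed in that generality.\<close>

lemma J_chi''_convergent:
  fixes F :: "'a \<times> 'b \<Rightarrow> 'c::euclidean_space"
  assumes F: "C1 F F1"
  shows "uniformly_convergent_on C (\<lambda>n. J (chi'' n) F)"
proof -
  obtain n1 where n1: "C1 N n1" using C1_N by blast
  have cF: "continuous_on Dc (\<lambda>z. inverse (N z) *\<^sub>R F z)"
    using N_pos by (intro continuous_intros C1D(3)[OF n1] C1D(3)[OF F]) (metis less_irrefl)
  obtain Y where cY: "continuous_on Dc Y" and Y0: "\<forall>\<psi> \<psi>' t. (\<forall>r. (\<psi> has_real_derivative \<psi>' r) (at r)) \<longrightarrow>
     (\<forall>r\<ge>0. \<psi> r = 0 \<and> \<psi>' r = 0) \<longrightarrow> continuous_on UNIV \<psi>' \<longrightarrow> t \<in> C \<longrightarrow>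
     J \<psi>' F t = - J \<psi> Y t + J (\<lambda>r. r ^ 4 * \<psi>' r) (\<lambda>z. inverse (N z) *\<^sub>R F z) t"
    using J_derivative_formula[OF F] by (elim exE conjE) (rule that)
  have Y: "J (chi'' n) F t = - J (chi' n) Y t + J (\<lambda>r. r ^ 4 * chi'' n r) (\<lambda>z. inverse (N z) *\<^sub>R F z) t" if "t \<in> C" for n t
    by (rule Y0[rule_format, of "chi' n" "chi'' n" t, OF DERIV_chi' _ continuous_chi(3) that]) (simp add: chi_nonneg_arg)
  obtain l where l: "uniform_limit C (\<lambda>n. J (chi' n) Y) l sequentially"
    using J_chi'_convergent[OF cY] unfolding uniformly_convergent_on_def by blast
  have "uniform_limit C (\<lambda>n t. - J (chi' n) Y t + J (\<lambda>r. r ^ 4 * chi'' n r) (\<lambda>z. inverse (N z) *\<^sub>R F z) t)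
     (\<lambda>t. - l t + 0) sequentially"
    by (intro uniform_limit_intros l J_small_uniform_limit[OF cF, where c = 2304]
        pow4_chi continuous_intros continuous_chi)
  then have "uniformly_convergent_on C (\<lambda>n t. - J (chi' n) Y t + J (\<lambda>r. r ^ 4 * chi'' n r) (\<lambda>z. inverse (N z) *\<^sub>R F z) t)"
    by (rule uniformly_convergentI)
  then show ?thesis
    by (rule uniformly_convergent_cong[THEN iffD1, rotated 2]) (use Y in auto)
qed

text \<open>Integrating by parts against the coordinate x \<bullet> e, whose derivative is 1, turns
  the integral of \<chi>(\<rho>) into one of - \<chi>'(\<rho>) times a bounded function. Thus the
  mass of - \<chi>'(\<rho>) dx cannot collapse; this is the source of strictness.\<close>

lemma J_chi'_lower_bound:
  assumes t: "t \<in> C"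
  shows "\<exists>M>0. \<forall>n. J (chi n) (\<lambda>_. 1::real) t \<le> M * (- J (chi' n) (\<lambda>_. 1::real) t)"
proof -
  obtain e :: 'b where e: "e \<in> Basis" using nonempty_Basis by blast
  let ?f = "\<lambda>z :: 'a \<times> 'b. snd z \<bullet> e"
  have fC1: "C1 ?f (\<lambda>j _. snd j \<bullet> e)"
  proof -
    have bl: "bounded_linear ?f" by (intro bounded_linear_intros)
    have eq: "snd h \<bullet> e = (\<Sum>j\<in>Basis. (h \<bullet> j) *\<^sub>R (snd j \<bullet> e))" for h :: "'a \<times> 'b"
      by (subst euclidean_representation[of h, symmetric])
        (simp only: linear_sum[OF bounded_linear.linear[OF bl]] linear_scale[OF bounded_linear.linear[OF bl]])
    show ?thesis
      unfolding C1_def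
      by (intro conjI ballI has_derivative_eq_rhs[OF bounded_linear_imp_has_derivative[OF bl]] continuous_on_const)
        (rule ext, rule eq)
  qed
  have e': "(0, e) \<in> (Basis :: ('a \<times> 'b) set)" using e by (simp add: Basis_prod_def)
  have c: "continuous_on Dc (\<lambda>z. \<rho>1 (0, e) z *\<^sub>R ?f z)"
    by (intro continuous_intros C1D(2)[OF C1_rho e'])
  obtain B where B: "B > 0" "\<And>z. z \<in> K \<Longrightarrow> norm (\<rho>1 (0, e) z *\<^sub>R ?f z) \<le> B" using bounded_on_K[OF c] by blast
  have "J (chi n) (\<lambda>_. 1::real) t \<le> B * (- J (chi' n) (\<lambda>_. 1::real) t)" for n
  proof -
    have "J (chi' n) (\<lambda>z. \<rho>1 (0, e) z *\<^sub>R ?f z) t = - J (chi n) (\<lambda>_. snd (0::'a, e) \<bullet> e) t"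
      by (rule J_partial[OF DERIV_chi chi_nonneg_arg(1,2) continuous_chi(2) fC1 t e])
    then have "J (chi n) (\<lambda>_. 1::real) t \<le> norm (J (chi' n) (\<lambda>z. \<rho>1 (0, e) z *\<^sub>R ?f z) t)"
      using e by simp
    also have "\<dots> \<le> B * (- J (chi' n) (\<lambda>_. 1::real) t)"
      by (intro norm_J_chi'_le c t B in_K)
    finally show ?thesis .
  qed
  with B(1) show ?thesis by blast
qed

end

section \<open>Nakano positivity of the cut-off metric\<close>

text \<open>A Schur product statement for m and the Gram matrix of the u i. Gaussian elimination on
  m: a positive pivot splits off m a a times one square, leaving the Schur complement on I; a zero
  pivot forces its row and column to vanish.\<close>

lemma psd_sum_nonneg:
  fixes m :: "'i \<Rightarrow> 'i \<Rightarrow> real" and g :: "real^'r^'r"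
  assumes "finite I" and g: "pos_def g" and "\<And>i j. i \<in> I \<Longrightarrow> j \<in> I \<Longrightarrow> m i j = m j i"
    and "\<And>c. (\<Sum>i\<in>I. \<Sum>j\<in>I. c i * c j * m i j) \<ge> 0"
  shows "(\<Sum>i\<in>I. \<Sum>j\<in>I. m i j * ((g *v u i) \<bullet> u j)) \<ge> 0"
  using assms(1,3,4)
proof (induction I arbitrary: m rule: finite_induct)
  case empty
  then show ?case by simp
next
  case (insert a I)
  note sym = insert.prems(1) and psd = insert.prems(2)
  have split: "(\<Sum>i\<in>insert a I. \<Sum>j\<in>insert a I. f i j) =
      f a a + (\<Sum>j\<in>I. f a j) + (\<Sum>i\<in>I. f i a) + (\<Sum>i\<in>I. \<Sum>j\<in>I. f i j)" for f :: "'i \<Rightarrow> 'i \<Rightarrow> real"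
    using insert.hyps by (simp add: sum.distrib add_ac)
  have psdI: "(\<Sum>i\<in>I. \<Sum>j\<in>I. c i * c j * m i j) \<ge> 0" for c
  proof -
    have "(\<Sum>i\<in>I. \<Sum>j\<in>I. (c(a := 0)) i * (c(a := 0)) j * m i j) = (\<Sum>i\<in>I. \<Sum>j\<in>I. c i * c j * m i j)"
      using insert.hyps by (intro sum.cong refl) auto
    then show ?thesis using psd[of "c(a := 0)"] unfolding split by simp
  qed
  have quad: "s\<^sup>2 * m a a + 2 * s * (\<Sum>j\<in>I. c j * m a j) + (\<Sum>i\<in>I. \<Sum>j\<in>I. c i * c j * m i j) \<ge> 0" for s c
  proof -
    let ?c = "c(a := s)"
    have 1: "(\<Sum>j\<in>I. ?c a * ?c j * m a j) = s * (\<Sum>j\<in>I. c j * m a j)"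
      unfolding sum_distrib_left using insert.hyps by (intro sum.cong) auto
    have 2: "(\<Sum>i\<in>I. ?c i * ?c a * m i a) = s * (\<Sum>j\<in>I. c j * m a j)"
      unfolding sum_distrib_left using insert.hyps sym by (intro sum.cong) auto
    have 3: "(\<Sum>i\<in>I. \<Sum>j\<in>I. ?c i * ?c j * m i j) = (\<Sum>i\<in>I. \<Sum>j\<in>I. c i * c j * m i j)"
      using insert.hyps by (intro sum.cong refl) auto
    from psd[of ?c] show ?thesis unfolding split 1 2 3 by (simp add: power2_eq_square)
  qed
  have maa: "m a a \<ge> 0" using quad[of 1 "\<lambda>_. 0"] by simp
  show ?case
  proof (cases "m a a = 0")
    case True
    have "m a i = 0" if i: "i \<in> I" for i
    proof (rule ccontr)
      assume ne: "m a i \<noteq> 0"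
      let ?c = "\<lambda>j. if j = i then 1 else 0 :: real"
      have s1: "(\<Sum>j\<in>I. ?c j * m a j) = m a i"
      proof -
        have "(\<Sum>j\<in>I. ?c j * m a j) = (\<Sum>j\<in>I. if j = i then m a j else 0)"
          by (intro sum.cong) auto
        then show ?thesis using i insert.hyps by (simp add: sum.delta)
      qed
      define T where "T = (\<Sum>i\<in>I. \<Sum>j\<in>I. ?c i * ?c j * m i j)"
      have "2 * s * m a i + T \<ge> 0" for s
        using quad[of s ?c] True unfolding s1 T_def by simp
      \<comment> \<open>For this s the nonnegative expression would equal - 1.\<close>
      from this[of "- (T + 1) / (2 * m a i)"] show False using ne by (simp add: field_simps)
    qed
    moreover from this have "m i a = 0" if "i \<in> I" for i using sym[of i a] that by simp
    ultimately show ?thesis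
      unfolding split using True insert.IH[of m] sym psdI by simp
  next
    case False
    then have pos: "m a a > 0" using maa by simp
    \<comment> \<open>The Schur complement; it stays positive semidefinite because
      \<open>quad\<close> can be used at the minimizing s = - X / m a a.\<close>
    define m' where "m' i j = m i j - m a i * m a j / m a a" for i j
    have "(\<Sum>i\<in>I. \<Sum>j\<in>I. m' i j * ((g *v u i) \<bullet> u j)) \<ge> 0"
    proof (rule insert.IH)
      show "m' i j = m' j i" if "i \<in> I" "j \<in> I" for i j
        using sym[of i j] that by (simp add: m'_def mult.commute)
      show "(\<Sum>i\<in>I. \<Sum>j\<in>I. c i * c j * m' i j) \<ge> 0" for c
      proof -
        define X where "X = (\<Sum>j\<in>I. c j * m a j)"
        have "X * X = (\<Sum>i\<in>I. \<Sum>j\<in>I. c i * c j * (m a i * m a j))"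
          unfolding X_def sum_product by (intro sum.cong refl) (simp add: mult_ac)
        then have "(\<Sum>i\<in>I. \<Sum>j\<in>I. c i * c j * m' i j) =
            (\<Sum>i\<in>I. \<Sum>j\<in>I. c i * c j * m i j) - X * X / m a a"
          by (simp add: m'_def right_diff_distrib sum_subtractf sum_divide_distrib)
        moreover have "(- X / m a a)\<^sup>2 * m a a + 2 * (- X / m a a) * X = - (X * X / m a a)"
          using pos by (simp add: power2_eq_square field_simps)
        ultimately show ?thesis using quad[of "- X / m a a" c] unfolding X_def[symmetric] by linarith
      qed
    qed
    moreover have "(\<Sum>i\<in>insert a I. \<Sum>j\<in>insert a I. m i j * ((g *v u i) \<bullet> u j)) =
      m a a * ((g *v (u a + (\<Sum>i\<in>I. (m a i / m a a) *\<^sub>R u i))) \<bullet> (u a + (\<Sum>i\<in>I. (m a i / m a a) *\<^sub>R u i)))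
        + (\<Sum>i\<in>I. \<Sum>j\<in>I. m' i j * ((g *v u i) \<bullet> u j))"
    proof -
      define X where "X = (\<Sum>i\<in>I. (m a i / m a a) *\<^sub>R u i)"
      have gX: "g *v X = (\<Sum>i\<in>I. (m a i / m a a) *\<^sub>R (g *v u i))"
        unfolding X_def by (simp add: mv.sum_right mv.scaleR_right)
      have 1: "m a a * ((g *v u a) \<bullet> X) = (\<Sum>j\<in>I. m a j * ((g *v u a) \<bullet> u j))"
        unfolding X_def inner_sum_right sum_distrib_left using pos by (intro sum.cong) auto
      have 2: "m a a * ((g *v X) \<bullet> u a) = (\<Sum>i\<in>I. m i a * ((g *v u i) \<bullet> u a))"
        unfolding gX inner_sum_left sum_distrib_left using pos sym by (intro sum.cong) auto
      have 3: "m a a * ((g *v X) \<bullet> X) = (\<Sum>i\<in>I. \<Sum>j\<in>I. (m a i * m a j / m a a) * ((g *v u i) \<bullet> u j))"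
        unfolding gX unfolding X_def inner_sum_left inner_sum_right sum_distrib_left
        using pos by (intro sum.cong refl) (auto simp: field_simps intro!: disjI2 pos_def_symD[OF g])
      have 4: "(\<Sum>i\<in>I. \<Sum>j\<in>I. m' i j * ((g *v u i) \<bullet> u j)) = (\<Sum>i\<in>I. \<Sum>j\<in>I. m i j * ((g *v u i) \<bullet> u j))
         - (\<Sum>i\<in>I. \<Sum>j\<in>I. (m a i * m a j / m a a) * ((g *v u i) \<bullet> u j))"
        by (simp add: m'_def left_diff_distrib sum_subtractf)
      have "m a a * ((g *v (u a + X)) \<bullet> (u a + X)) = m a a * ((g *v u a) \<bullet> u a) + m a a * ((g *v u a) \<bullet> X)
        + m a a * ((g *v X) \<bullet> u a) + m a a * ((g *v X) \<bullet> X)"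
        by (simp add: mv.add_right inner_add_left inner_add_right algebra_simps)
      then show ?thesis unfolding split X_def[symmetric] 1 2 3 4 by simp
    qed
    moreover have "(g *v v) \<bullet> v \<ge> 0" for v by (rule pos_def_nonneg[OF g])
    ultimately show ?thesis using pos by simp
  qed
qed

lemma compact_quadratic_lower_bound:
  fixes q :: "'z::metric_space \<times> 'v::euclidean_space \<Rightarrow> real"
  assumes K: "compact K" and q: "continuous_on (K \<times> sphere 0 1) q"
    and pos: "\<And>z v. z \<in> K \<Longrightarrow> v \<noteq> 0 \<Longrightarrow> q (z, v) > 0"
    and hom: "\<And>z c v. q (z, c *\<^sub>R v) = c\<^sup>2 * q (z, v)"
  shows "\<exists>l>0. \<forall>z\<in>K. \<forall>v. l * (norm v)\<^sup>2 \<le> q (z, v)"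
proof (cases "K = {}")
  case True
  then show ?thesis by (auto intro: exI[of _ 1])
next
  case False
  have "compact (K \<times> sphere (0::'v) 1)" using K by (intro compact_Times) auto
  moreover have "sphere (0::'v) 1 \<noteq> {}" by simp
  then have "K \<times> sphere (0::'v) 1 \<noteq> {}" using False by blast
  ultimately obtain y where y: "y \<in> K \<times> sphere 0 1" "\<And>x. x \<in> K \<times> sphere 0 1 \<Longrightarrow> q y \<le> q x"
    using continuous_attains_inf[OF _ _ q] by metis
  obtain z0 v0 where "y = (z0, v0)" "z0 \<in> K" "norm v0 = 1" using y(1) by auto
  moreover from this have "v0 \<noteq> 0" by auto
  ultimately have "q y > 0" using pos[of z0 v0] by simp
  moreover have "q y * (norm v)\<^sup>2 \<le> q (z, v)" if "z \<in> K" for z v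
  proof (cases "v = 0")
    case True
    then show ?thesis using hom[of z 0 v] by simp
  next
    case False
    then have "q y \<le> q (z, v /\<^sub>R norm v)" using that by (intro y(2)) simp
    then have "q y * (norm v)\<^sup>2 \<le> (norm v)\<^sup>2 * q (z, v /\<^sub>R norm v)"
      by (subst mult.commute) (rule mult_left_mono, auto)
    also have "\<dots> = q (z, norm v *\<^sub>R (v /\<^sub>R norm v))" by (simp only: hom)
    also have "\<dots> = q (z, v)" using False by simp
    finally show ?thesis .
  qed
  ultimately show ?thesis by blast
qed

locale nakano_family_over = convex_family_over U D \<rho> \<rho>1 \<rho>2 C R
  for U :: "'a::euclidean_space set" and D :: "('a \<times> 'b::euclidean_space) set" and \<rho> \<rho>1 \<rho>2 C R +
  fixes W :: "('a \<times> 'b) set" and g :: "'a \<times> 'b \<Rightarrow> real^'r^'r" and g1 g2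
  assumes g: "C2_partials W g g1 g2" and W: "open W" "Dc \<subseteq> W"
    and g_pos: "\<And>z. z \<in> W \<Longrightarrow> pos_def (g z)"
    and g_nakano: "\<And>z. z \<in> D \<Longrightarrow> nakano_ge Basis (g z) (\<lambda>j. g1 j z) (\<lambda>j k. g2 j k z) 0"
begin

text \<open>On the compact set \<open>K\<close> the Hessian of \<rho> dominates l times the identity
  and g dominates m times the identity. Pairing the semidefinite difference of the former with g by
  \<open>psd_sum_nonneg\<close> gives the constant l m.\<close>

lemma hessian_lower_bound:
  "\<exists>c>0. \<forall>z\<in>K. \<forall>u. c * (\<Sum>j\<in>Basis. (norm (u j))\<^sup>2) \<le> (\<Sum>j\<in>Basis. \<Sum>k\<in>Basis. \<rho>2 j k z * ((g z *v u j) \<bullet> u k))"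
proof -
  let ?q = "\<lambda>(z, v). \<Sum>j\<in>Basis. \<Sum>k\<in>Basis. (v \<bullet> j) * (v \<bullet> k) * \<rho>2 j k z"
  have c2: "continuous_on (K \<times> T) (\<lambda>x. \<rho>2 j k (fst x))" if "j \<in> Basis" "k \<in> Basis" for j k and T :: "('a \<times> 'b) set"
    by (rule continuous_on_compose2[OF C2_partialsD(3)[OF rho that]]) (auto intro!: continuous_intros)
  have "\<exists>l>0. \<forall>z\<in>K. \<forall>v. l * (norm v)\<^sup>2 \<le> ?q (z, v)"
  proof (rule compact_quadratic_lower_bound[OF compact_K])
    show "continuous_on (K \<times> sphere 0 1) ?q"
      unfolding case_prod_beta by (intro continuous_intros c2)
    show "?q (z, v) > 0" if "z \<in> K" "v \<noteq> 0" for z v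
      using hess[of z v] that by auto
    show "?q (z, c *\<^sub>R v) = c\<^sup>2 * ?q (z, v)" for z c v
      by (simp add: sum_distrib_left power2_eq_square mult_ac)
  qed
  then obtain l where l: "l > 0" "\<And>z v. z \<in> K \<Longrightarrow> l * (norm v)\<^sup>2 \<le> ?q (z, v)" by blast
  have "\<exists>m>0. \<forall>z\<in>K. \<forall>v. m * (norm v)\<^sup>2 \<le> (\<lambda>(z, v). (g z *v v) \<bullet> v) (z, v)"
  proof (rule compact_quadratic_lower_bound[OF compact_K])
    have "continuous_on (K \<times> sphere 0 1) (\<lambda>x. g (fst x))"
      by (rule continuous_on_compose2[OF C2_partials_continuous(1)[OF g]]) (use W in \<open>auto intro!: continuous_intros\<close>)
    then show "continuous_on (K \<times> sphere 0 1) (\<lambda>(z, v). (g z *v v) \<bullet> v)"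
      unfolding case_prod_beta by (intro continuous_intros mv.continuous_on)
    show "(\<lambda>(z, v). (g z *v v) \<bullet> v) (z, v) > 0" if "z \<in> K" "v \<noteq> 0" for z v
      using g_pos[of z] that W by (auto simp: pos_def_def)
    show "(\<lambda>(z, v). (g z *v v) \<bullet> v) (z, c *\<^sub>R v) = c\<^sup>2 * (\<lambda>(z, v). (g z *v v) \<bullet> v) (z, v)" for z c v
      by (simp add: mv.scaleR_right power2_eq_square)
  qed
  then obtain m where m: "m > 0" "\<And>z v. z \<in> K \<Longrightarrow> m * (norm v)\<^sup>2 \<le> (g z *v v) \<bullet> v" by auto
  have "l * m * (\<Sum>j\<in>Basis. (norm (u j))\<^sup>2) \<le> (\<Sum>j\<in>Basis. \<Sum>k\<in>Basis. \<rho>2 j k z * ((g z *v u j) \<bullet> u k))"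
    if z: "z \<in> K" for z u
  proof -
    define d where "d j k = (if j = k then l else 0)" for j k :: "'a \<times> 'b"
    have dsum: "(\<Sum>j\<in>Basis. \<Sum>k\<in>Basis. d j k * f j k) = (\<Sum>j\<in>Basis. l * f j j)" for f
    proof (rule sum.cong[OF refl])
      fix j :: "'a \<times> 'b" assume "j \<in> Basis"
      have "(\<Sum>k\<in>Basis. d j k * f j k) = (\<Sum>k\<in>Basis. if j = k then l * f j k else 0)"
        by (intro sum.cong) (auto simp: d_def)
      then show "(\<Sum>k\<in>Basis. d j k * f j k) = l * f j j"
        using \<open>j \<in> Basis\<close> by simp
    qed
    have zW: "z \<in> W" and zS: "z \<in> S" using z W by auto
    have "0 \<le> (\<Sum>j\<in>Basis. \<Sum>k\<in>Basis. (\<rho>2 j k z - d j k) * ((g z *v u j) \<bullet> u k))"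
    proof (rule psd_sum_nonneg[OF finite_Basis g_pos[OF zW]])
      show "\<rho>2 i j z - d i j = \<rho>2 j i z - d j i" if "i \<in> Basis" "j \<in> Basis" for i j
        using C2_partials_symmetric[OF rho open_S zS that] by (simp add: d_def)
      fix c :: "'a \<times> 'b \<Rightarrow> real"
      define v where "v = (\<Sum>j\<in>Basis. c j *\<^sub>R j)"
      have vj: "v \<bullet> j = c j" if "j \<in> Basis" for j
        unfolding v_def using that by (simp add: inner_Basis_sum)
      have "(norm v)\<^sup>2 = (\<Sum>j\<in>Basis. c j * c j)"
        unfolding power2_norm_eq_inner euclidean_inner[of v v] by (intro sum.cong) (auto simp: vj)
      moreover have "?q (z, v) = (\<Sum>j\<in>Basis. \<Sum>k\<in>Basis. c j * c k * \<rho>2 j k z)"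
        by (simp add: vj)
      moreover have "(\<Sum>i\<in>Basis. \<Sum>j\<in>Basis. c i * c j * (\<rho>2 i j z - d i j)) =
          (\<Sum>j\<in>Basis. \<Sum>k\<in>Basis. c j * c k * \<rho>2 j k z) - (\<Sum>j\<in>Basis. \<Sum>k\<in>Basis. d j k * (c j * c k))"
        by (simp add: right_diff_distrib sum_subtractf mult_ac)
      ultimately show "0 \<le> (\<Sum>i\<in>Basis. \<Sum>j\<in>Basis. c i * c j * (\<rho>2 i j z - d i j))"
        using l(2)[OF z, of v] unfolding dsum by (simp add: sum_distrib_left)
    qed
    also have "\<dots> = (\<Sum>j\<in>Basis. \<Sum>k\<in>Basis. \<rho>2 j k z * ((g z *v u j) \<bullet> u k)) - (\<Sum>j\<in>Basis. l * ((g z *v u j) \<bullet> u j))"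
      by (simp only: left_diff_distrib sum_subtractf dsum)
    finally have "(\<Sum>j\<in>Basis. l * ((g z *v u j) \<bullet> u j)) \<le> (\<Sum>j\<in>Basis. \<Sum>k\<in>Basis. \<rho>2 j k z * ((g z *v u j) \<bullet> u k))"
      by simp
    moreover have "l * m * (\<Sum>j\<in>Basis. (norm (u j))\<^sup>2) \<le> (\<Sum>j\<in>Basis. l * ((g z *v u j) \<bullet> u j))"
      unfolding sum_distrib_left mult.assoc using l(1) m(2)[OF z] by (intro sum_mono mult_left_mono) auto
    ultimately show ?thesis by linarith
  qed
  then show ?thesis using l(1) m(1) by (intro exI[of _ "l * m"]) auto
qed

definition hn :: "nat \<Rightarrow> 'a \<times> 'b \<Rightarrow> real^'r^'r" where
  "hn n = cut (chi n) g"

definition pn :: "nat \<Rightarrow> 'a \<times> 'b \<Rightarrow> 'a \<times> 'b \<Rightarrow> real^'r^'r" where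
  "pn n j z = cut (chi n) (g1 j) z + cut (chi' n) (\<lambda>z. \<rho>1 j z *\<^sub>R g z) z"

text \<open>Grouped as \<open>has_derivative_cut\<close> produces it: one bracket for each summand
  of \<open>pn\<close>.\<close>

definition qn :: "nat \<Rightarrow> 'a \<times> 'b \<Rightarrow> 'a \<times> 'b \<Rightarrow> 'a \<times> 'b \<Rightarrow> real^'r^'r" where
  "qn n j k z = (cut (chi n) (g2 j k) z + cut (chi' n) (\<lambda>z. \<rho>1 k z *\<^sub>R g1 j z) z) +
     (cut (chi' n) (\<lambda>z. \<rho>1 j z *\<^sub>R g1 k z + \<rho>2 j k z *\<^sub>R g z) z + cut (chi'' n) (\<lambda>z. \<rho>1 k z *\<^sub>R \<rho>1 j z *\<^sub>R g z) z)"

lemma C1_g: "C1 g g1"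
  unfolding C1_def using C2_partialsD(1)[OF g] continuous_on_subset[OF C2_partials_continuous(2)[OF g] W(2)] W by auto

lemma C1_g1: "j \<in> Basis \<Longrightarrow> C1 (g1 j) (g2 j)"
  unfolding C1_def
  by (intro conjI ballI C2_partialsD(2)[OF g] continuous_on_subset[OF C2_partialsD(3)[OF g] W(2)])
    (use W in blast)+

lemma has_derivative_cut_C1:
  fixes f :: "'a \<times> 'b \<Rightarrow> 'c::real_normed_vector"
  assumes \<psi>: "\<And>r. (\<psi> has_real_derivative \<psi>' r) (at r)" "\<And>r. r \<ge> 0 \<Longrightarrow> \<psi> r = 0" "\<And>r. r \<ge> 0 \<Longrightarrow> \<psi>' r = 0"
    and f: "C1 f f1" and z: "z \<in> S"
  shows "(cut \<psi> f has_derivative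
    (\<lambda>h. \<Sum>j\<in>Basis. (h \<bullet> j) *\<^sub>R (cut \<psi> (f1 j) z + cut \<psi>' (\<lambda>z. \<rho>1 j z *\<^sub>R f z) z))) (at z)"
  by (rule has_derivative_cut[where f = f and z = z and \<psi> = \<psi> and \<psi>' = \<psi>']) (use assms C1D(1)[OF f] in auto)

lemma C2_partials_hn: "C2_partials S (hn n) (pn n) (qn n)"
  unfolding C2_partials_def
proof (intro conjI ballI)
  fix z assume z: "z \<in> S"
  show "(hn n has_derivative (\<lambda>h. \<Sum>j\<in>Basis. (h \<bullet> j) *\<^sub>R pn n j z)) (at z)"
    unfolding hn_def pn_def
    by (rule has_derivative_cut_C1[OF DERIV_chi chi_nonneg_arg(1,2) C1_g z])
  fix j :: "'a \<times> 'b" assume j: "j \<in> Basis"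
  have a: "(cut (chi n) (g1 j) has_derivative (\<lambda>h. \<Sum>k\<in>Basis. (h \<bullet> k) *\<^sub>R
      (cut (chi n) (g2 j k) z + cut (chi' n) (\<lambda>z. \<rho>1 k z *\<^sub>R g1 j z) z))) (at z)"
    by (rule has_derivative_cut_C1[OF DERIV_chi chi_nonneg_arg(1,2) C1_g1[OF j] z])
  have b: "(cut (chi' n) (\<lambda>z. \<rho>1 j z *\<^sub>R g z) has_derivative (\<lambda>h. \<Sum>k\<in>Basis. (h \<bullet> k) *\<^sub>R
      (cut (chi' n) (\<lambda>z. \<rho>1 j z *\<^sub>R g1 k z + \<rho>2 j k z *\<^sub>R g z) z
      + cut (chi'' n) (\<lambda>z. \<rho>1 k z *\<^sub>R \<rho>1 j z *\<^sub>R g z) z))) (at z)"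
    by (rule has_derivative_cut_C1[OF DERIV_chi' chi_nonneg_arg(2,3) C1_scaleR[OF C1_rho1[OF j] C1_g] z])
  show "(pn n j has_derivative (\<lambda>h. \<Sum>k\<in>Basis. (h \<bullet> k) *\<^sub>R qn n j k z)) (at z)"
    using has_derivative_add[OF a b]
    unfolding pn_def[abs_def] qn_def scaleR_add_right sum.distrib[symmetric] .
next
  fix j k :: "'a \<times> 'b" assume j: "j \<in> Basis" and k: "k \<in> Basis"
  show "continuous_on S (qn n j k)"
    unfolding qn_def[abs_def]
    by (intro continuous_intros continuous_on_cut continuous_chi chi_nonneg_arg
        C1D(2)[OF C1_g1[OF j] k] C1D(2)[OF C1_rho1[OF j] k] C1D(2)[OF C1_g k] C1D(2)[OF C1_rho j] C1D(2)[OF C1_rho k]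
        C1D(3)[OF C1_g1[OF j]] C1D(3)[OF C1_g])
qed

text \<open>Write \<phi> = \<chi>(\<rho>), l = \<phi>' / \<phi>, a for the sum of the \<rho>1 j u j,
  and H, Q for the Hessian sum and the second derivative sum of g. The right side minus the double
  sum is \<phi> (g(w0, w0) - Q) + (\<phi> l^2 - \<phi>'') g(a, a) - \<phi>' H. The first term is
  nonnegative by positivity of g, the second by log-concavity of \<chi>, and the third supplies the
  slack.\<close>

lemma nakano_ge_hn:
  assumes z: "z \<in> D" and c: "c \<ge> 0" "\<And>u. c * (\<Sum>j\<in>Basis. (norm (u j))\<^sup>2) \<le>
    (\<Sum>j\<in>Basis. \<Sum>k\<in>Basis. \<rho>2 j k z * ((g z *v u j) \<bullet> u k))"
  shows "nakano_ge Basis (hn n z) (\<lambda>j. pn n j z) (\<lambda>j k. qn n j k z) (- chi' n (\<rho> z) * c)"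
  unfolding nakano_ge_def
proof (intro allI impI)
  fix u :: "'a \<times> 'b \<Rightarrow> real^'r" and w :: "real^'r"
  define \<phi> where "\<phi> = chi n (\<rho> z)"
  define \<phi>' where "\<phi>' = chi' n (\<rho> z)"
  define \<phi>'' where "\<phi>'' = chi'' n (\<rho> z)"
  have rz: "\<rho> z < 0" using z D_iff D_sub by blast
  have \<phi>: "\<phi> > 0" "\<phi>' \<le> 0" "\<phi> * \<phi>'' \<le> \<phi>'\<^sup>2"
    using chi_pos[OF rz] chi_bounds chi_log_concave[OF rz] by (auto simp: \<phi>_def \<phi>'_def \<phi>''_def)
  have zW: "z \<in> W" using z D_sub_Dc W by blast
  note gs = pos_def_symD[OF g_pos[OF zW]]
  have h: "hn n z = \<phi> *\<^sub>R g z" using z by (simp add: hn_def cut_def \<phi>_def)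
  have p: "pn n j z = \<phi> *\<^sub>R g1 j z + (\<phi>' * \<rho>1 j z) *\<^sub>R g z" for j
    using z by (simp add: pn_def cut_def \<phi>_def \<phi>'_def)
  have q: "qn n j k z = \<phi> *\<^sub>R g2 j k z + (\<phi>' * \<rho>1 k z) *\<^sub>R g1 j z + (\<phi>' * \<rho>1 j z) *\<^sub>R g1 k z
      + (\<phi>' * \<rho>2 j k z) *\<^sub>R g z + (\<phi>'' * (\<rho>1 k z * \<rho>1 j z)) *\<^sub>R g z" for j k
    using z by (simp add: qn_def cut_def \<phi>_def \<phi>'_def \<phi>''_def scaleR_add_right)
  define a where "a = (\<Sum>j\<in>Basis. \<rho>1 j z *\<^sub>R u j)"
  define b where "b = (\<Sum>j\<in>Basis. g1 j z *v u j)"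
  define l where "l = \<phi>' / \<phi>"
  have l: "\<phi>' = l * \<phi>" using \<phi> by (simp add: l_def)
  assume "hn n z *v w = (\<Sum>j\<in>Basis. pn n j z *v u j)"
  also have "\<dots> = \<phi> *\<^sub>R b + \<phi>' *\<^sub>R (g z *v a)"
    by (simp add: p a_def b_def mv.add_left mv.scaleR_left mv.scaleR_right mv.sum_right sum.distrib scaleR_sum_right)
  finally have hw: "\<phi> *\<^sub>R (g z *v w) = \<phi> *\<^sub>R (b + l *\<^sub>R (g z *v a))"
    by (simp add: h mv.scaleR_left l scaleR_add_right mult.commute)
  then have gw: "g z *v w = b + l *\<^sub>R (g z *v a)" using \<phi> by simp
  \<comment> \<open>Removing l a from w leaves the auxiliary vector belonging to g itself.\<close>
  define w0 where "w0 = w - l *\<^sub>R a"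
  have gw0: "g z *v w0 = b" by (simp add: w0_def mv.diff_right mv.scaleR_right gw)
  have N: "(\<Sum>j\<in>Basis. \<Sum>k\<in>Basis. (g2 j k z *v u j) \<bullet> u k) \<le> (g z *v w0) \<bullet> w0"
    using g_nakano[OF z] gw0 unfolding nakano_ge_def b_def by auto
  have s1: "(\<Sum>j\<in>Basis. \<Sum>k\<in>Basis. (\<rho>1 k z) * ((g1 j z *v u j) \<bullet> u k)) = b \<bullet> a"
    unfolding b_def inner_sum_left unfolding a_def inner_sum_right by simp
  have g1s: "transpose (g1 j z) = g1 j z" if "j \<in> Basis" for j
    using C2_partials_transpose(1)[OF g W(1) zW _ that that] g_pos by (auto simp: pos_def_def)
  have s2: "(\<Sum>j\<in>Basis. \<Sum>k\<in>Basis. (\<rho>1 j z) * ((g1 k z *v u j) \<bullet> u k)) = b \<bullet> a"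
  proof -
    have "(\<Sum>j\<in>Basis. \<Sum>k\<in>Basis. (\<rho>1 j z) * ((g1 k z *v u j) \<bullet> u k)) =
        (\<Sum>j\<in>Basis. \<Sum>k\<in>Basis. (\<rho>1 j z) * ((g1 k z *v u k) \<bullet> u j))"
      by (intro sum.cong refl) (simp add: inner_symmetric_matrix[OF g1s])
    also have "\<dots> = (\<Sum>k\<in>Basis. \<Sum>j\<in>Basis. (\<rho>1 j z) * ((g1 k z *v u k) \<bullet> u j))"
      by (rule sum.swap)
    finally show ?thesis using s1 by simp
  qed
  have s3: "(\<Sum>j\<in>Basis. \<Sum>k\<in>Basis. (\<rho>1 k z * \<rho>1 j z) * ((g z *v u j) \<bullet> u k)) = (g z *v a) \<bullet> a"
  proof -
    have ga: "g z *v a = (\<Sum>j\<in>Basis. \<rho>1 j z *\<^sub>R (g z *v u j))"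
      by (simp add: a_def mv.sum_right mv.scaleR_right)
    show ?thesis
      unfolding ga inner_sum_left unfolding a_def inner_sum_right by (simp add: mult_ac)
  qed
  define H where "H = (\<Sum>j\<in>Basis. \<Sum>k\<in>Basis. \<rho>2 j k z * ((g z *v u j) \<bullet> u k))"
  define Q where "Q = (\<Sum>j\<in>Basis. \<Sum>k\<in>Basis. (g2 j k z *v u j) \<bullet> u k)"
  have "(\<Sum>j\<in>Basis. \<Sum>k\<in>Basis. (qn n j k z *v u j) \<bullet> u k) =
      \<phi> * Q + \<phi>' * (\<Sum>j\<in>Basis. \<Sum>k\<in>Basis. (\<rho>1 k z) * ((g1 j z *v u j) \<bullet> u k))
      + \<phi>' * (\<Sum>j\<in>Basis. \<Sum>k\<in>Basis. (\<rho>1 j z) * ((g1 k z *v u j) \<bullet> u k)) + \<phi>' * H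
      + \<phi>'' * (\<Sum>j\<in>Basis. \<Sum>k\<in>Basis. (\<rho>1 k z * \<rho>1 j z) * ((g z *v u j) \<bullet> u k))"
    unfolding q Q_def H_def sum_distrib_left sum.distrib[symmetric]
    by (intro sum.cong refl) (simp add: mv.add_left mv.scaleR_left inner_add_left)
  then have lhs: "(\<Sum>j\<in>Basis. \<Sum>k\<in>Basis. (qn n j k z *v u j) \<bullet> u k) =
      \<phi> * Q + 2 * (\<phi>' * (b \<bullet> a)) + \<phi>' * H + \<phi>'' * ((g z *v a) \<bullet> a)"
    unfolding s1 s2 s3 by simp
  have w: "w = w0 + l *\<^sub>R a" by (simp add: w0_def)
  have "(g z *v w) \<bullet> w = (g z *v w0) \<bullet> w0 + 2 * (l * (b \<bullet> a)) + l * l * ((g z *v a) \<bullet> a)"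
    using gs[of a w0] unfolding w
    by (simp add: mv.add_right mv.scaleR_right inner_add_left inner_add_right gw0 distrib_left)
  then have "(hn n z *v w) \<bullet> w = \<phi> * ((g z *v w0) \<bullet> w0) + 2 * (\<phi>' * (b \<bullet> a)) + \<phi> * (l * l) * ((g z *v a) \<bullet> a)"
    unfolding h mv.scaleR_left inner_scaleR_left l by (simp add: algebra_simps)
  moreover have "\<phi>'' * ((g z *v a) \<bullet> a) \<le> \<phi> * (l * l) * ((g z *v a) \<bullet> a)"
  proof (rule mult_right_mono)
    have "\<phi> * \<phi>'' \<le> \<phi> * (\<phi> * (l * l))" using \<phi>(3) unfolding l by (simp add: power2_eq_square mult_ac)
    then show "\<phi>'' \<le> \<phi> * (l * l)" using \<phi>(1) by (simp add: mult_le_cancel_left)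
  qed (rule pos_def_nonneg[OF g_pos[OF zW]])
  moreover have "\<phi> * Q \<le> \<phi> * ((g z *v w0) \<bullet> w0)"
    using N \<phi>(1) unfolding Q_def by (intro mult_left_mono) auto
  moreover have "- \<phi>' * (c * (\<Sum>j\<in>Basis. (norm (u j))\<^sup>2)) \<le> - \<phi>' * H"
    using c(2)[of u] \<phi>(2) unfolding H_def by (intro mult_left_mono) auto
  ultimately show "(\<Sum>j\<in>Basis. \<Sum>k\<in>Basis. (qn n j k z *v u j) \<bullet> u k) + - chi' n (\<rho> z) * c * (\<Sum>j\<in>Basis. (norm (u j))\<^sup>2)
      \<le> (hn n z *v w) \<bullet> w"
    unfolding lhs \<phi>'_def[symmetric] by (simp add: mult.assoc)
qed

end

section \<open>The direct image metric\<close>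

lemma sum_Basis_Pair:
  fixes f :: "'a::euclidean_space \<times> 'b::euclidean_space \<Rightarrow> 'c::comm_monoid_add"
  shows "(\<Sum>j\<in>Basis. f j) = (\<Sum>j\<in>Basis. f (j, 0)) + (\<Sum>e\<in>Basis. f (0, e))"
proof -
  have "(\<Sum>j\<in>Basis. f j) = (\<Sum>j\<in>(\<lambda>j. (j, 0)) ` Basis. f j) + (\<Sum>j\<in>(\<lambda>e. (0, e)) ` Basis. f j)"
    unfolding Basis_prod_def by (rule sum.union_disjoint) (auto simp: nonzero_Basis)
  then show ?thesis
    by (simp add: sum.reindex inj_on_def)
qed

lemma C2_partials_cong:
  assumes S: "open S" and f: "C2_partials S f p q" and eq: "\<And>x. x \<in> S \<Longrightarrow> f x = g x"
  shows "C2_partials S g p q"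
  using f has_derivative_transform_within_open[OF C2_partialsD(1)[OF f] S _ eq]
  unfolding C2_partials_def by blast

lemma pos_def_scaleR:
  assumes "pos_def A" "a > 0"
  shows "pos_def (a *\<^sub>R A)"
proof -
  have "transpose (a *\<^sub>R A) = a *\<^sub>R transpose A" by (simp add: transpose_def vec_eq_iff)
  then show ?thesis using assms by (simp add: pos_def_def mv.scaleR_left)
qed

text \<open>An iterated integral over all fibre directions is still a function on the product,
  though constant in x; the slice x = 0 turns it into a function of t.\<close>

lemma C2_partials_Pair:
  fixes H :: "'a::euclidean_space \<times> 'b::euclidean_space \<Rightarrow> 'c::real_normed_vector"
  assumes H: "C2_partials (B \<times> UNIV) H p q"
  shows "C2_partials B (\<lambda>t. H (t, 0)) (\<lambda>j t. p (j, 0) (t, 0)) (\<lambda>j k t. q (j, 0) (k, 0) (t, 0))"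
proof -
  have j0: "(j, 0) \<in> (Basis :: ('a \<times> 'b) set)" if "j \<in> Basis" for j
    using that by (simp add: Basis_prod_def)
  have D: "((\<lambda>t. f (t, 0)) has_derivative (\<lambda>h. \<Sum>j\<in>Basis. (h \<bullet> j) *\<^sub>R f1 (j, 0))) (at t)"
    if "(f has_derivative (\<lambda>h. \<Sum>j\<in>Basis. (h \<bullet> j) *\<^sub>R f1 j)) (at (t, 0))"
    for f :: "'a \<times> 'b \<Rightarrow> 'c" and f1 t
  proof -
    have "((\<lambda>t. (t, 0::'b)) has_derivative (\<lambda>h. (h, 0))) (at t)"
      by (intro derivative_intros)
    from has_derivative_compose[OF this that] show ?thesis
      by (simp add: sum_Basis_Pair)
  qed
  show ?thesis
    unfolding C2_partials_def
  proof (intro conjI ballI)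
    fix t assume t: "t \<in> B"
    then have tB: "(t, 0) \<in> B \<times> (UNIV :: 'b set)" by simp
    show "((\<lambda>t. H (t, 0)) has_derivative (\<lambda>h. \<Sum>j\<in>Basis. (h \<bullet> j) *\<^sub>R p (j, 0) (t, 0))) (at t)"
      by (rule D[OF C2_partialsD(1)[OF H tB]])
    fix j :: 'a assume "j \<in> Basis"
    then show "((\<lambda>t. p (j, 0) (t, 0)) has_derivative (\<lambda>h. \<Sum>k\<in>Basis. (h \<bullet> k) *\<^sub>R q (j, 0) (k, 0) (t, 0))) (at t)"
      by (intro D[OF C2_partialsD(2)[OF H tB j0]])
  next
    fix j k :: 'a assume "j \<in> Basis" "k \<in> Basis"
    then show "continuous_on B (\<lambda>t. q (j, 0) (k, 0) (t, 0))"
      by (intro continuous_on_compose2[OF C2_partialsD(3)[OF H j0 j0]] continuous_intros) auto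
  qed
qed

lemma has_derivative_uniform_limit:
  fixes f :: "nat \<Rightarrow> 'a::euclidean_space \<Rightarrow> 'b::banach"
  assumes B: "open B" "convex B"
    and f: "\<And>n x. x \<in> B \<Longrightarrow> (f n has_derivative (\<lambda>h. \<Sum>j\<in>Basis. (h \<bullet> j) *\<^sub>R p n j x)) (at x)"
    and l: "uniform_limit B f l sequentially"
    and pl: "\<And>j. j \<in> Basis \<Longrightarrow> uniform_limit B (\<lambda>n. p n j) (pl j) sequentially"
    and x: "x \<in> B"
  shows "(l has_derivative (\<lambda>h. \<Sum>j\<in>Basis. (h \<bullet> j) *\<^sub>R pl j x)) (at x)"
proof -
  have "\<exists>g. \<forall>x\<in>B. (\<lambda>n. f n x) \<longlonglongrightarrow> g x \<and> (g has_derivative (\<lambda>h. \<Sum>j\<in>Basis. (h \<bullet> j) *\<^sub>R pl j x)) (at x within B)"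
  proof (rule has_derivative_sequence[OF B(2)])
    show "(f n has_derivative (\<lambda>h. \<Sum>j\<in>Basis. (h \<bullet> j) *\<^sub>R p n j x)) (at x within B)" if "x \<in> B" for n x
      by (rule has_derivative_at_withinI[OF f[OF that]])
    show "(\<lambda>n. f n x) \<longlonglongrightarrow> l x" by (rule tendsto_uniform_limitI[OF l x])
    fix e :: real assume e: "e > 0"
    \<comment> \<open>Each of the DIM coefficients may contribute d |h| to the operator
      error.\<close>
    define d where "d = e / real DIM('a)"
    have d: "d > 0" using e by (simp add: d_def)
    have "\<forall>\<^sub>F n in sequentially. \<forall>j\<in>Basis. \<forall>x\<in>B. dist (p n j x) (pl j x) < d"
      by (intro eventually_ball_finite ballI finite_Basis uniform_limitD[OF pl d])
    then show "\<forall>\<^sub>F n in sequentially. \<forall>x\<in>B. \<forall>h. norm ((\<Sum>j\<in>Basis. (h \<bullet> j) *\<^sub>R p n j x)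
        - (\<Sum>j\<in>Basis. (h \<bullet> j) *\<^sub>R pl j x)) \<le> e * norm h"
    proof (rule eventually_mono, intro ballI allI)
      fix n x h assume n: "\<forall>j\<in>Basis. \<forall>x\<in>B. dist (p n j x) (pl j x) < d" and x: "x \<in> B"
      have "norm (\<Sum>j\<in>Basis. (h \<bullet> j) *\<^sub>R (p n j x - pl j x)) \<le> (\<Sum>j\<in>(Basis::'a set). norm h * d)"
      proof (rule sum_norm_le)
        fix j :: 'a assume j: "j \<in> Basis"
        then have "norm (p n j x - pl j x) \<le> d" using n x by (simp add: dist_norm less_imp_le)
        then show "norm ((h \<bullet> j) *\<^sub>R (p n j x - pl j x)) \<le> norm h * d"
          using Basis_le_norm[OF j, of h] by (simp add: mult_mono)
      qed
      also have "\<dots> = e * norm h" by (simp add: d_def)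
      finally show "norm ((\<Sum>j\<in>Basis. (h \<bullet> j) *\<^sub>R p n j x) - (\<Sum>j\<in>Basis. (h \<bullet> j) *\<^sub>R pl j x)) \<le> e * norm h"
        by (simp add: scaleR_diff_right sum_subtractf)
    qed
  qed (rule x)
  then obtain g where g: "\<And>x. x \<in> B \<Longrightarrow> (\<lambda>n. f n x) \<longlonglongrightarrow> g x"
    "\<And>x. x \<in> B \<Longrightarrow> (g has_derivative (\<lambda>h. \<Sum>j\<in>Basis. (h \<bullet> j) *\<^sub>R pl j x)) (at x within B)"
    by blast
  have "g y = l y" if "y \<in> B" for y
    using LIMSEQ_unique[OF g(1)[OF that] tendsto_uniform_limitI[OF l that]] .
  then show ?thesis
    using has_derivative_transform_within_open[OF g(2)[OF x, unfolded at_within_open[OF x B(1)]] B(1) x] by blast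
qed

lemma C2_partials_uniform_limit:
  fixes f :: "nat \<Rightarrow> 'a::euclidean_space \<Rightarrow> 'b::banach"
  assumes B: "open B" "convex B" and f: "\<And>n. C2_partials B (f n) (p n) (q n)"
    and l: "uniform_limit B f l sequentially"
    and pl: "\<And>j. j \<in> Basis \<Longrightarrow> uniform_limit B (\<lambda>n. p n j) (pl j) sequentially"
    and ql: "\<And>j k. j \<in> Basis \<Longrightarrow> k \<in> Basis \<Longrightarrow> uniform_limit B (\<lambda>n. q n j k) (ql j k) sequentially"
  shows "C2_partials B l pl ql"
  unfolding C2_partials_def
proof (intro conjI ballI)
  fix x assume x: "x \<in> B"
  show "(l has_derivative (\<lambda>h. \<Sum>j\<in>Basis. (h \<bullet> j) *\<^sub>R pl j x)) (at x)"
    by (rule has_derivative_uniform_limit[OF B C2_partialsD(1)[OF f] l pl x])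
  fix j :: 'a assume j: "j \<in> Basis"
  show "(pl j has_derivative (\<lambda>h. \<Sum>k\<in>Basis. (h \<bullet> k) *\<^sub>R ql j k x)) (at x)"
    by (rule has_derivative_uniform_limit[OF B C2_partialsD(2)[OF f _ j] pl[OF j] ql[OF j] x])
next
  fix j k :: 'a assume "j \<in> Basis" "k \<in> Basis"
  then show "continuous_on B (ql j k)"
    by (intro uniform_limit_theorem[OF always_eventually ql]) (auto intro: C2_partialsD(3)[OF f])
qed

text \<open>For fixed u the auxiliary vector has to be adjusted to each n; the solutions
  \<open>wn\<close> converge to w because the limit matrix is invertible. The slack passes to its
  limit, so strictness depends on \<kappa>l alone.\<close>

lemma nakano_ge_limit:
  fixes G :: "nat \<Rightarrow> real^'r^'r"
  assumes N: "\<And>n. nakano_ge M (G n) (P n) (Q n) (\<kappa> n)" and pos: "\<And>n. pos_def (G n)"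
    and l: "G \<longlonglongrightarrow> Gl" "pos_def Gl" "\<And>j. j \<in> M \<Longrightarrow> (\<lambda>n. P n j) \<longlonglongrightarrow> Pl j"
      "\<And>j k. j \<in> M \<Longrightarrow> k \<in> M \<Longrightarrow> (\<lambda>n. Q n j k) \<longlonglongrightarrow> Ql j k" "\<kappa> \<longlonglongrightarrow> \<kappa>l"
  shows "nakano_ge M Gl Pl Ql \<kappa>l"
  unfolding nakano_ge_def
proof (intro allI impI)
  fix u w assume w: "Gl *v w = (\<Sum>j\<in>M. Pl j *v u j)"
  define wn where "wn n = matrix_inv (G n) *v (\<Sum>j\<in>M. P n j *v u j)" for n
  have wn: "G n *v wn n = (\<Sum>j\<in>M. P n j *v u j)" for n
    unfolding wn_def by (rule matrix_inv_mult_vector(1)[OF pos_def_invertible[OF pos]])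
  have "wn \<longlonglongrightarrow> matrix_inv Gl *v (\<Sum>j\<in>M. Pl j *v u j)"
    unfolding wn_def[abs_def]
    by (intro mv.tendsto tendsto_sum tendsto_matrix_inv l tendsto_const always_eventually allI pos_def_invertible pos)
  then have "wn \<longlonglongrightarrow> w"
    unfolding w[symmetric] matrix_inv_mult_vector(2)[OF pos_def_invertible[OF l(2)]] .
  then have r: "(\<lambda>n. (G n *v wn n) \<bullet> wn n) \<longlonglongrightarrow> (Gl *v w) \<bullet> w"
    by (intro tendsto_inner mv.tendsto l)
  have s: "(\<lambda>n. (\<Sum>j\<in>M. \<Sum>k\<in>M. (Q n j k *v u j) \<bullet> u k) + \<kappa> n * (\<Sum>j\<in>M. (norm (u j))\<^sup>2))
     \<longlonglongrightarrow> (\<Sum>j\<in>M. \<Sum>k\<in>M. (Ql j k *v u j) \<bullet> u k) + \<kappa>l * (\<Sum>j\<in>M. (norm (u j))\<^sup>2)"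
    by (intro tendsto_add tendsto_sum tendsto_inner mv.tendsto tendsto_mult tendsto_const l)
  show "(\<Sum>j\<in>M. \<Sum>k\<in>M. (Ql j k *v u j) \<bullet> u k) + \<kappa>l * (\<Sum>j\<in>M. (norm (u j))\<^sup>2) \<le> (Gl *v w) \<bullet> w"
    using N wn by (intro tendsto_le[OF sequentially_bot r s] always_eventually allI) (auto simp: nakano_ge_def)
qed

lemma translation_closed_fiber:
  fixes P :: "('a::euclidean_space \<times> 'b::euclidean_space) set"
  assumes P: "\<And>e. e \<in> Basis \<Longrightarrow> translation_closed P (0, e)" and x: "(t, x) \<in> P"
  shows "(t, y) \<in> P"
proof -
  have "(t, x + (\<Sum>e\<in>A. c e *\<^sub>R e)) \<in> P" if "A \<subseteq> Basis" for A and c :: "'b \<Rightarrow> real"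
    using finite_subset[OF that finite_Basis] that
  proof (induction A rule: finite_induct)
    case (insert e A)
    then have "(t, x + (\<Sum>e\<in>A. c e *\<^sub>R e)) + c e *\<^sub>R (0, e) \<in> P"
      using P[of e] by (auto simp: translation_closed_def)
    then show ?case using insert.hyps by (simp add: add_ac)
  qed (use x in simp)
  from this[of Basis "\<lambda>e. (y - x) \<bullet> e"] show ?thesis
    by (simp add: euclidean_representation)
qed

lemma nakano_ge_Pair:
  fixes M :: "('a::euclidean_space \<times> 'b::euclidean_space) set"
  assumes "nakano_ge ((\<lambda>j. (j, 0)) ` (Basis :: 'a set)) H p q \<kappa>"
  shows "nakano_ge (Basis :: 'a set) H (\<lambda>j. p (j, 0::'b)) (\<lambda>j k. q (j, 0) (k, 0)) \<kappa>"
  unfolding nakano_ge_def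
proof (intro allI impI)
  fix u w
  assume "H *v w = (\<Sum>j\<in>Basis. p (j, 0) *v u j)"
  moreover have "inj_on (\<lambda>j. (j, 0::'b)) (Basis :: 'a set)" by (simp add: inj_on_def)
  ultimately show "(\<Sum>j\<in>Basis. \<Sum>k\<in>Basis. (q (j, 0) (k, 0) *v u j) \<bullet> u k) + \<kappa> * (\<Sum>j\<in>Basis. (norm (u j))\<^sup>2) \<le> (H *v w) \<bullet> w"
    using assms[unfolded nakano_ge_def, rule_format, of w "\<lambda>z. u (fst z)"] by (simp add: sum.reindex)
qed

context nakano_family_over
begin

definition Gn :: "nat \<Rightarrow> 'a \<Rightarrow> real^'r^'r" where
  "Gn n = J (chi n) g"

definition Pn :: "nat \<Rightarrow> 'a \<Rightarrow> 'a \<Rightarrow> real^'r^'r" where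
  "Pn n j t = J (chi n) (g1 (j, 0)) t + J (chi' n) (\<lambda>z. \<rho>1 (j, 0) z *\<^sub>R g z) t"

text \<open>The fibre integral of \<open>qn\<close> at base indices, split so that each term meets
  its convergence result: \<chi>' stands against continuous coefficients, \<chi>'' against a C1
  one.\<close>

definition Qn :: "nat \<Rightarrow> 'a \<Rightarrow> 'a \<Rightarrow> 'a \<Rightarrow> real^'r^'r" where
  "Qn n j k t = (J (chi n) (g2 (j, 0) (k, 0)) t + J (chi' n) (\<lambda>z. \<rho>1 (k, 0) z *\<^sub>R g1 (j, 0) z) t) +
     (J (chi' n) (\<lambda>z. \<rho>1 (j, 0) z *\<^sub>R g1 (k, 0) z + \<rho>2 (j, 0) (k, 0) z *\<^sub>R g z) t
     + J (chi'' n) (\<lambda>z. \<rho>1 (k, 0) z *\<^sub>R \<rho>1 (j, 0) z *\<^sub>R g z) t)"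

lemma basis_Pair: "j \<in> Basis \<Longrightarrow> (j, 0) \<in> (Basis :: ('a \<times> 'b) set)"
  by (simp add: Basis_prod_def)

lemma continuous_coeffs:
  assumes "j \<in> Basis" "k \<in> Basis"
  shows "continuous_on Dc g" "continuous_on Dc (g1 (j, 0))" "continuous_on Dc (g2 (j, 0) (k, 0))"
    "continuous_on Dc (\<lambda>z. \<rho>1 (j, 0) z *\<^sub>R g z)" "continuous_on Dc (\<lambda>z. \<rho>1 (k, 0) z *\<^sub>R g1 (j, 0) z)"
    "continuous_on Dc (\<lambda>z. \<rho>1 (j, 0) z *\<^sub>R g1 (k, 0) z + \<rho>2 (j, 0) (k, 0) z *\<^sub>R g z)"
    "continuous_on Dc (\<lambda>z. \<rho>1 (k, 0) z *\<^sub>R \<rho>1 (j, 0) z *\<^sub>R g z)"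
  using basis_Pair[OF assms(1)] basis_Pair[OF assms(2)]
  by (auto intro!: continuous_on_add continuous_on_scaleR continuous_on_mult C1D(2)[OF C1_g1] C1D(2)[OF C1_rho1] C1D(2)[OF C1_g] C1D(2)[OF C1_rho]
      C1D(3)[OF C1_g1] C1D(3)[OF C1_g])

lemma fints_fiber:
  fixes F :: "'a \<times> 'b \<Rightarrow> 'c::euclidean_space"
  assumes bs: "distinct bs" "set bs = Basis" and t: "t \<in> C" and F: "continuous_on S F"
    and supp: "\<And>x. F (t, x) \<noteq> 0 \<Longrightarrow> (t, x) \<in> D"
  shows "fints R (map (Pair 0) bs) F (t, 0) = (\<integral>x. F (t, x) \<partial>lborel)"
  unfolding fints_Pair
proof (rule fints_eq_lborel_integral[OF bs])
  show "continuous_on UNIV (\<lambda>x. F (t, x))"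
    by (rule continuous_on_compose2[OF F]) (use t C_sub in \<open>auto intro!: continuous_intros\<close>)
  fix x e :: 'b assume e: "e \<in> Basis" and "F (t, x) \<noteq> 0"
  then have "norm x < R" using supp norm_less[OF t, of x] by (simp add: fiber_def)
  then show "\<bar>x \<bullet> e\<bar> \<le> R" using Basis_le_norm[OF e, of x] by linarith
qed

lemma cut_eq_0: "z \<notin> D \<Longrightarrow> cut \<psi> f z = 0"
  by (simp add: cut_def)

lemma nakano_admissible_hn:
  assumes B: "open B" "convex B" "B \<subseteq> C"
    and c: "c > 0" "\<And>z u. z \<in> K \<Longrightarrow> c * (\<Sum>j\<in>Basis. (norm (u j))\<^sup>2) \<le>
      (\<Sum>j\<in>Basis. \<Sum>k\<in>Basis. \<rho>2 j k z * ((g z *v u j) \<bullet> u k))"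
  shows "nakano_admissible (B \<times> UNIV) R Basis (Pair 0 ` Basis) (D \<inter> (B \<times> UNIV)) (hn n) (pn n) (qn n)
    (cut (chi' n) (\<lambda>_. - c))"
  unfolding nakano_admissible_def
proof (intro conjI ballI)
  have BS: "B \<times> UNIV \<subseteq> S" using B(3) C_sub by auto
  show "C2_partials (B \<times> UNIV) (hn n) (pn n) (qn n)"
    by (rule C2_partials_subset[OF C2_partials_hn BS])
  show "open (D \<inter> (B \<times> UNIV))" using B open_D by (intro open_Int open_Times) auto
  show "convex (D \<inter> (B \<times> UNIV))" by (rule convex_restrict) (use B C_sub in auto)
  show "continuous_on (B \<times> UNIV) (cut (chi' n) (\<lambda>_. - c))"
    by (rule continuous_on_subset[OF continuous_on_cut[OF continuous_chi(2) chi_nonneg_arg(2) continuous_on_const] BS])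
next
  fix z assume z: "z \<in> D \<inter> (B \<times> UNIV)"
  have zW: "z \<in> W" and zK: "z \<in> K" using z D_sub_Dc W B by auto
  have rz: "\<rho> z < 0" using z D_iff D_sub by blast
  show "pos_def (hn n z)"
    using pos_def_scaleR[OF g_pos[OF zW] chi_pos[OF rz, of n]] z by (simp add: hn_def cut_def)
  have "cut (chi' n) (\<lambda>_. - c) z = - chi' n (\<rho> z) * c" using z by (simp add: cut_def)
  then show "nakano_ge Basis (hn n z) (\<lambda>j. pn n j z) (\<lambda>j k. qn n j k z) (cut (chi' n) (\<lambda>_. - c) z)"
    using nakano_ge_hn[of z c n] c(1) c(2)[OF zK] z by auto
  fix e :: "'a \<times> 'b" assume "e \<in> Pair 0 ` Basis"
  then obtain b where b: "b \<in> Basis" "e = (0, b)" by auto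
  obtain t x where tx: "z = (t, x)" by (cases z)
  have "norm x < R" using z B(3) by (intro norm_less[of t]) (auto simp: tx fiber_def)
  then show "\<bar>z \<bullet> e\<bar> < R" using Basis_le_norm[OF b(1), of x] by (simp add: tx b)
next
  fix z assume "z \<in> B \<times> (UNIV :: 'b set)"
  show "cut (chi' n) (\<lambda>_. - c) z \<ge> 0"
    using c(1) chi_bounds(3)[of n "\<rho> z"] by (auto simp: cut_def mult_nonpos_nonneg)
qed (auto simp: hn_def pn_def qn_def cut_eq_0)

text \<open>All fibre directions are integrated at once and the result is read off at (t, 0). That
  point need not lie in D, but the final positivity set contains the part of D over B and is
  invariant in the fibre directions, and the fibre over t is nonempty. The slack becomes c times the
  mass of - \<chi>'(\<rho>) dx.\<close>

lemma cut_off_direct_image: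
  assumes B: "open B" "convex B" "B \<subseteq> C"
    and c: "c > 0" "\<And>z u. z \<in> K \<Longrightarrow> c * (\<Sum>j\<in>Basis. (norm (u j))\<^sup>2) \<le>
      (\<Sum>j\<in>Basis. \<Sum>k\<in>Basis. \<rho>2 j k z * ((g z *v u j) \<bullet> u k))"
  shows "\<exists>p q. C2_partials B (Gn n) p q \<and> (\<forall>t\<in>B. (\<forall>j\<in>Basis. p j t = Pn n j t) \<and>
    (\<forall>j\<in>Basis. \<forall>k\<in>Basis. q j k t = Qn n j k t) \<and> pos_def (Gn n t) \<and>
    nakano_ge Basis (Gn n t) (\<lambda>j. p j t) (\<lambda>j k. q j k t) (c * - J (chi' n) (\<lambda>_. 1::real) t))"
proof -
  obtain bs :: "'b list" where bs: "set bs = Basis" "distinct bs"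
    using finite_distinct_list[OF finite_Basis] by blast
  let ?es = "map (Pair (0::'a)) bs"
  have BS: "B \<times> UNIV \<subseteq> S" using B(3) C_sub by auto
  have es: "set ?es = Pair 0 ` Basis" "distinct ?es" using bs by (auto simp: distinct_map inj_on_def)
  have Pair_Basis: "Pair 0 ` Basis \<subseteq> (Basis :: ('a \<times> 'b) set)" by (auto simp: Basis_prod_def)
  have "\<exists>P' p' q'. nakano_admissible (B \<times> UNIV) R (Basis - set ?es) (Pair 0 ` Basis - set ?es) P'
      (fints R ?es (hn n)) p' q' (fints R ?es (cut (chi' n) (\<lambda>_. - c))) \<and>
    (\<forall>j. j \<notin> set ?es \<longrightarrow> p' j = fints R ?es (pn n j)) \<and>
    (\<forall>j k. j \<notin> set ?es \<longrightarrow> k \<notin> set ?es \<longrightarrow> q' j k = fints R ?es (qn n j k)) \<and>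
    D \<inter> (B \<times> UNIV) \<subseteq> P' \<and> (\<forall>e. translation_closed (D \<inter> (B \<times> UNIV)) e \<or> e \<in> set ?es \<longrightarrow> translation_closed P' e)"
    by (rule nakano_admissible_fints[OF _ _ _ es(2) _ Pair_Basis subset_refl nakano_admissible_hn[OF B c]])
      (use B es in \<open>auto simp: open_Times convex_Times translation_closed_def\<close>)
  then obtain P' p' q' where all: "nakano_admissible (B \<times> UNIV) R (Basis - set ?es) (Pair 0 ` Basis - set ?es) P'
      (fints R ?es (hn n)) p' q' (fints R ?es (cut (chi' n) (\<lambda>_. - c))) \<and>
    (\<forall>j. j \<notin> set ?es \<longrightarrow> p' j = fints R ?es (pn n j)) \<and>
    (\<forall>j k. j \<notin> set ?es \<longrightarrow> k \<notin> set ?es \<longrightarrow> q' j k = fints R ?es (qn n j k)) \<and>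
    D \<inter> (B \<times> UNIV) \<subseteq> P' \<and> (\<forall>e. translation_closed (D \<inter> (B \<times> UNIV)) e \<or> e \<in> set ?es \<longrightarrow> translation_closed P' e)"
    by (elim exE)
  note adm = all[THEN conjunct1]
    and p' = all[THEN conjunct2, THEN conjunct1, rule_format]
    and q' = all[THEN conjunct2, THEN conjunct2, THEN conjunct1, rule_format]
    and P'_sup = all[THEN conjunct2, THEN conjunct2, THEN conjunct2, THEN conjunct1]
    and P'_tc = all[THEN conjunct2, THEN conjunct2, THEN conjunct2, THEN conjunct2, rule_format]
  have notin: "(j, 0) \<notin> set ?es" for j
    unfolding es by (auto simp: nonzero_Basis)
  have Mt: "Basis - set ?es = (\<lambda>j. (j, 0)) ` Basis"
    unfolding es Basis_prod_def by (auto simp: nonzero_Basis)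
  have tC: "t \<in> C" if "t \<in> B" for t using that B by blast
  have H: "fints R ?es (hn n) (t, 0) = Gn n t" if t: "t \<in> B" for t
  proof -
    have "fints R ?es (hn n) (t, 0) = (\<integral>x. hn n (t, x) \<partial>lborel)"
      by (rule fints_fiber[OF bs(2,1) tC[OF t] C2_partials_continuous(1)[OF C2_partials_hn]])
        (auto simp: hn_def cut_def split: if_splits)
    then show ?thesis by (simp add: Gn_def J_def hn_def)
  qed
  have p0: "p' (j, 0) (t, 0) = Pn n j t" if t: "t \<in> B" and j: "j \<in> Basis" for t j
  proof -
    have "p' (j, 0) (t, 0) = (\<integral>x. pn n (j, 0) (t, x) \<partial>lborel)"
      unfolding p'[OF notin]
      by (rule fints_fiber[OF bs(2,1) tC[OF t] C2_partials_continuous(2)[OF C2_partials_hn basis_Pair[OF j]]])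
        (auto simp: pn_def cut_def split: if_splits)
    also have "\<dots> = Pn n j t"
      unfolding Pn_def pn_def J_def
      by (intro Bochner_Integration.integral_add integrable_cut continuous_coeffs[OF j j] continuous_chi tC t)
    finally show ?thesis .
  qed
  have q0: "q' (j, 0) (k, 0) (t, 0) = Qn n j k t" if t: "t \<in> B" and j: "j \<in> Basis" and k: "k \<in> Basis" for t j k
  proof -
    have i1: "integrable lborel (\<lambda>x. cut (chi n) (g2 (j, 0) (k, 0)) (t, x))"
      "integrable lborel (\<lambda>x. cut (chi' n) (\<lambda>z. \<rho>1 (k, 0) z *\<^sub>R g1 (j, 0) z) (t, x))"
      "integrable lborel (\<lambda>x. cut (chi' n) (\<lambda>z. \<rho>1 (j, 0) z *\<^sub>R g1 (k, 0) z + \<rho>2 (j, 0) (k, 0) z *\<^sub>R g z) (t, x))"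
      "integrable lborel (\<lambda>x. cut (chi'' n) (\<lambda>z. \<rho>1 (k, 0) z *\<^sub>R \<rho>1 (j, 0) z *\<^sub>R g z) (t, x))"
      by (intro integrable_cut continuous_coeffs[OF j k] continuous_chi tC t)+
    have "q' (j, 0) (k, 0) (t, 0) = (\<integral>x. qn n (j, 0) (k, 0) (t, x) \<partial>lborel)"
      unfolding q'[OF notin notin]
      by (rule fints_fiber[OF bs(2,1) tC[OF t] C2_partialsD(3)[OF C2_partials_hn basis_Pair[OF j] basis_Pair[OF k]]])
        (auto simp: qn_def cut_def split: if_splits)
    also have "\<dots> = Qn n j k t"
      unfolding Qn_def qn_def J_def
      by (simp only: Bochner_Integration.integral_add i1 Bochner_Integration.integrable_add)
    finally show ?thesis .
  qed
  have k0: "fints R ?es (cut (chi' n) (\<lambda>_. - c)) (t, 0) = c * - J (chi' n) (\<lambda>_. 1::real) t" if t: "t \<in> B" for t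
  proof -
    have "fints R ?es (cut (chi' n) (\<lambda>_. - c)) (t, 0) = (\<integral>x. cut (chi' n) (\<lambda>_. - c) (t, x) \<partial>lborel)"
      by (rule fints_fiber[OF bs(2,1) tC[OF t] continuous_on_cut[OF continuous_chi(2) chi_nonneg_arg(2) continuous_on_const]])
        (auto simp: cut_def split: if_splits)
    also have "\<dots> = (\<integral>x. - c * cut (chi' n) (\<lambda>_. 1::real) (t, x) \<partial>lborel)"
      by (intro Bochner_Integration.integral_cong) (auto simp: cut_def)
    finally show ?thesis by (simp add: J_def)
  qed
  let ?p = "\<lambda>j t. p' (j, 0) (t, 0)" and ?q = "\<lambda>j k t. q' (j, 0) (k, 0) (t, 0)"
  have "C2_partials B (\<lambda>t. fints R ?es (hn n) (t, 0)) ?p ?q"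
    by (rule C2_partials_Pair) (use adm in \<open>simp add: nakano_admissible_def\<close>)
  then have C2: "C2_partials B (Gn n) ?p ?q"
    by (rule C2_partials_cong[OF B(1) _ H])
  have "pos_def (Gn n t) \<and> nakano_ge Basis (Gn n t) (\<lambda>j. ?p j t) (\<lambda>j k. ?q j k t) (c * - J (chi' n) (\<lambda>_. 1::real) t)"
    if t: "t \<in> B" for t
  proof -
    obtain x where "x \<in> fiber D t" using fiber_ne[of t] t B C_sub by blast
    then have "(t, x) \<in> P'" using P'_sup t by (auto simp: fiber_def)
    then have "(t, 0) \<in> P'"
      by (rule translation_closed_fiber[rotated]) (rule P'_tc, simp add: bs)
    then have "pos_def (fints R ?es (hn n) (t, 0)) \<and> nakano_ge (Basis - set ?es) (fints R ?es (hn n) (t, 0))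
        (\<lambda>j. p' j (t, 0)) (\<lambda>j k. q' j k (t, 0)) (fints R ?es (cut (chi' n) (\<lambda>_. - c)) (t, 0))"
      using adm unfolding nakano_admissible_def by blast
    then show ?thesis
      unfolding H[OF t] k0[OF t] Mt using nakano_ge_Pair[of "Gn n t" "\<lambda>j. p' j (t, 0)" "\<lambda>j k. q' j k (t, 0)"] by blast
  qed
  then show ?thesis
    using C2 p0 q0 by (intro exI[of _ ?p] exI[of _ ?q]) auto
qed

end

section \<open>Passage to the limit in the cut-off\<close>

context nakano_family_over
begin

lemma J_linear:
  fixes f :: "'a \<times> 'b \<Rightarrow> 'c::euclidean_space" and L :: "'c \<Rightarrow> 'd::euclidean_space"
  assumes L: "bounded_linear L" and f: "continuous_on Dc f" and \<psi>: "continuous_on UNIV \<psi>" and t: "t \<in> C"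
  shows "J \<psi> (\<lambda>z. L (f z)) t = L (J \<psi> f t)"
proof -
  interpret L: bounded_linear L by (rule L)
  have "cut \<psi> (\<lambda>z. L (f z)) (t, x) = L (cut \<psi> f (t, x))" for x
    by (simp add: cut_def L.scaleR L.zero)
  then show ?thesis
    unfolding J_def using integral_bounded_linear[OF L integrable_cut[OF f \<psi> t]] by simp
qed

lemma pos_def_direct_image:
  assumes t: "t \<in> C"
  shows "pos_def (J (\<lambda>_. 1) g t)"
  unfolding pos_def_def
proof (intro conjI allI impI)
  have gp: "pos_def (g (t, x))" if "x \<in> fiber D t" for x
    using g_pos in_K[OF t that] W(2) by blast
  note cg = C1D(3)[OF C1_g]
  have "J (\<lambda>_. 1) (\<lambda>z. transpose (g z)) t = J (\<lambda>_. 1) g t"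
    by (rule J_cong) (use gp in \<open>simp add: pos_def_def\<close>)
  then show "transpose (J (\<lambda>_. 1) g t) = J (\<lambda>_. 1) g t"
    using J_linear[OF bounded_linear_transpose cg continuous_on_const t, of 1] by simp
  fix u :: "real^'r" assume u: "u \<noteq> 0"
  have bl: "bounded_linear (\<lambda>A :: real^'r^'r. (A *v u) \<bullet> u)"
    by (rule bounded_linear_compose[OF bounded_linear_inner_left mv.bounded_linear_left])
  have "J (\<lambda>_. 1) (\<lambda>z. (g z *v u) \<bullet> u) t > 0"
    by (rule J_pos[OF _ t]) (use gp u in \<open>auto simp: pos_def_def intro!: continuous_intros mv.continuous_on cg\<close>)
  then show "(J (\<lambda>_. 1) g t *v u) \<bullet> u > 0"
    using J_linear[OF bl cg continuous_on_const t, of 1] by simp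
qed

lemma Pn_convergent:
  assumes j: "j \<in> Basis"
  shows "\<exists>l. uniform_limit C (\<lambda>n. Pn n j) l sequentially"
proof -
  obtain l where "uniform_limit C (\<lambda>n. J (chi' n) (\<lambda>z. \<rho>1 (j, 0) z *\<^sub>R g z)) l sequentially"
    using J_chi'_convergent[OF continuous_coeffs(4)[OF j j]] unfolding uniformly_convergent_on_def by blast
  from uniform_limit_add[OF J_chi_uniform_limit[OF continuous_coeffs(2)[OF j j]] this]
  show ?thesis unfolding Pn_def by blast
qed

lemma Qn_convergent:
  assumes j: "j \<in> Basis" and k: "k \<in> Basis"
  shows "\<exists>l. uniform_limit C (\<lambda>n. Qn n j k) l sequentially"
proof -
  obtain l1 where l1: "uniform_limit C (\<lambda>n. J (chi' n) (\<lambda>z. \<rho>1 (k, 0) z *\<^sub>R g1 (j, 0) z)) l1 sequentially"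
    using J_chi'_convergent[OF continuous_coeffs(5)[OF j k]] unfolding uniformly_convergent_on_def by blast
  obtain l2 where l2: "uniform_limit C (\<lambda>n. J (chi' n) (\<lambda>z. \<rho>1 (j, 0) z *\<^sub>R g1 (k, 0) z + \<rho>2 (j, 0) (k, 0) z *\<^sub>R g z)) l2 sequentially"
    using J_chi'_convergent[OF continuous_coeffs(6)[OF j k]] unfolding uniformly_convergent_on_def by blast
  obtain l3 where l3: "uniform_limit C (\<lambda>n. J (chi'' n) (\<lambda>z. \<rho>1 (k, 0) z *\<^sub>R \<rho>1 (j, 0) z *\<^sub>R g z)) l3 sequentially"
    using J_chi''_convergent[OF C1_scaleR[OF C1_rho1[OF basis_Pair[OF k]] C1_scaleR[OF C1_rho1[OF basis_Pair[OF j]] C1_g]]]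
    unfolding uniformly_convergent_on_def by blast
  from uniform_limit_add[OF uniform_limit_add[OF J_chi_uniform_limit[OF continuous_coeffs(3)[OF j k]] l1]
      uniform_limit_add[OF l2 l3]]
  show ?thesis unfolding Qn_def by blast
qed

text \<open>\<open>Gn\<close> and its first two derivatives converge uniformly, so the direct image
  is C2 with the limit coefficients, and Nakano positivity passes to the limit pointwise. B is an
  open convex part of the compact set C: differentiation takes place on B, uniform estimates on
  C.\<close>

lemma direct_image_local:
  assumes B: "open B" "convex B" "B \<subseteq> C"
  shows "\<exists>p q. C2_partials B (J (\<lambda>_. 1) g) p q \<and>
    (\<forall>t\<in>B. \<exists>\<kappa>>0. nakano_ge Basis (J (\<lambda>_. 1) g t) (\<lambda>j. p j t) (\<lambda>j k. q j k t) \<kappa>)"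
proof -
  obtain c where c: "c > 0" "\<And>z u. z \<in> K \<Longrightarrow> c * (\<Sum>j\<in>Basis. (norm (u j))\<^sup>2) \<le>
      (\<Sum>j\<in>Basis. \<Sum>k\<in>Basis. \<rho>2 j k z * ((g z *v u j) \<bullet> u k))"
    using hessian_lower_bound by blast
  define X where "X n p q \<longleftrightarrow> C2_partials B (Gn n) p q \<and> (\<forall>t\<in>B. (\<forall>j\<in>Basis. p j t = Pn n j t) \<and>
      (\<forall>j\<in>Basis. \<forall>k\<in>Basis. q j k t = Qn n j k t) \<and> pos_def (Gn n t) \<and>
      nakano_ge Basis (Gn n t) (\<lambda>j. p j t) (\<lambda>j k. q j k t) (c * - J (chi' n) (\<lambda>_. 1::real) t))" for n p q
  have "\<exists>p q. X n p q" for n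
    unfolding X_def by (rule cut_off_direct_image[OF B c])
  then obtain p q where "\<And>n. X n (p n) (q n)" by metis
  note all = this[unfolded X_def]
  have C2: "C2_partials B (Gn n) (p n) (q n)" for n using all by blast
  have eqp: "p n j t = Pn n j t" if "t \<in> B" "j \<in> Basis" for n j t using all that by blast
  have eqq: "q n j k t = Qn n j k t" if "t \<in> B" "j \<in> Basis" "k \<in> Basis" for n j k t using all that by blast
  have pos: "pos_def (Gn n t)" if "t \<in> B" for n t using all that by blast
  have N: "nakano_ge Basis (Gn n t) (\<lambda>j. p n j t) (\<lambda>j k. q n j k t) (c * - J (chi' n) (\<lambda>_. 1::real) t)"
    if "t \<in> B" for n t using all that by blast
  have "\<exists>l. uniform_limit B (\<lambda>n. p n j) l sequentially" if j: "j \<in> Basis" for j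
  proof -
    obtain l where "uniform_limit C (\<lambda>n. Pn n j) l sequentially" using Pn_convergent[OF j] by blast
    then have "uniform_limit B (\<lambda>n. Pn n j) l sequentially" using B(3) by (rule uniform_limit_on_subset)
    then have "uniform_limit B (\<lambda>n. p n j) l sequentially"
      by (rule uniform_limit_cong'[THEN iffD1, rotated 2]) (use eqp j in auto)
    then show ?thesis by blast
  qed
  then obtain pl where pl: "\<And>j. j \<in> Basis \<Longrightarrow> uniform_limit B (\<lambda>n. p n j) (pl j) sequentially" by metis
  have "\<exists>l. uniform_limit B (\<lambda>n. q n j k) l sequentially" if j: "j \<in> Basis" and k: "k \<in> Basis" for j k
  proof -
    obtain l where "uniform_limit C (\<lambda>n. Qn n j k) l sequentially" using Qn_convergent[OF j k] by blast
    then have "uniform_limit B (\<lambda>n. Qn n j k) l sequentially" using B(3) by (rule uniform_limit_on_subset)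
    then have "uniform_limit B (\<lambda>n. q n j k) l sequentially"
      by (rule uniform_limit_cong'[THEN iffD1, rotated 2]) (use eqq j k in auto)
    then show ?thesis by blast
  qed
  then obtain ql where ql: "\<And>j k. j \<in> Basis \<Longrightarrow> k \<in> Basis \<Longrightarrow> uniform_limit B (\<lambda>n. q n j k) (ql j k) sequentially"
    by metis
  have Gl: "uniform_limit B Gn (J (\<lambda>_. 1) g) sequentially"
    unfolding Gn_def[abs_def]
    by (rule uniform_limit_on_subset[OF J_chi_uniform_limit[OF C1D(3)[OF C1_g]] B(3)])
  have "C2_partials B (J (\<lambda>_. 1) g) pl ql"
    by (rule C2_partials_uniform_limit[OF B(1,2) C2 Gl pl ql])
  moreover have "\<exists>\<kappa>>0. nakano_ge Basis (J (\<lambda>_. 1) g t) (\<lambda>j. pl j t) (\<lambda>j k. ql j k t) \<kappa>" if t: "t \<in> B" for t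
  proof -
    have tC: "t \<in> C" using t B by blast
    have c1: "continuous_on Dc (\<lambda>_. 1::real)" by (rule continuous_on_const)
    obtain l where "uniform_limit C (\<lambda>n. J (chi' n) (\<lambda>_. 1::real)) l sequentially"
      using J_chi'_convergent[OF c1] unfolding uniformly_convergent_on_def by blast
    then have l: "(\<lambda>n. J (chi' n) (\<lambda>_. 1::real) t) \<longlonglongrightarrow> l t"
      using tC by (rule tendsto_uniform_limitI)
    obtain M where M: "M > 0" "\<And>n. J (chi n) (\<lambda>_. 1::real) t \<le> M * (- J (chi' n) (\<lambda>_. 1) t)"
      using J_chi'_lower_bound[OF tC] by blast
    \<comment> \<open>The left side is the volume of the fibre, so the limit mass - l t is
      positive.\<close>
    have "J (\<lambda>_. 1) (\<lambda>_. 1::real) t \<le> M * (- l t)"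
      by (rule LIMSEQ_le[OF tendsto_uniform_limitI[OF J_chi_uniform_limit[OF c1] tC]
            tendsto_mult[OF tendsto_const tendsto_minus[OF l]]]) (use M in blast)
    moreover have "J (\<lambda>_. 1) (\<lambda>_. 1::real) t > 0" by (rule J_pos[OF c1 tC]) simp
    ultimately have "M * (- l t) > 0" by linarith
    then have "- l t > 0" using M(1) zero_less_mult_pos by blast
    moreover have "nakano_ge Basis (J (\<lambda>_. 1) g t) (\<lambda>j. pl j t) (\<lambda>j k. ql j k t) (c * - l t)"
      by (rule nakano_ge_limit[OF N[OF t] pos[OF t] tendsto_uniform_limitI[OF Gl t] pos_def_direct_image[OF tC]
            tendsto_uniform_limitI[OF pl t] tendsto_uniform_limitI[OF ql t]])
        (auto intro!: tendsto_intros l)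
    ultimately show ?thesis using c(1) by (intro exI[of _ "c * - l t"]) (simp add: mult_pos_neg)
  qed
  ultimately show ?thesis by blast
qed

lemma direct_image_metric_eq:
  assumes t: "t \<in> C"
  shows "J (\<lambda>_. 1) g t = (\<chi> \<kappa> \<mu>. LINT x:fiber D t|lborel.
    (\<Sum>i\<in>UNIV. \<Sum>j\<in>UNIV. axis \<kappa> 1 $ i * axis \<mu> 1 $ j * g (t, x) $ i $ j))"
proof -
  have "J (\<lambda>_. 1) g t $ \<kappa> $ \<mu> = (LINT x:fiber D t|lborel.
      (\<Sum>i\<in>UNIV. \<Sum>j\<in>UNIV. axis \<kappa> 1 $ i * axis \<mu> 1 $ j * g (t, x) $ i $ j))" for \<kappa> \<mu>
  proof -
    have bl: "bounded_linear (\<lambda>A :: real^'r^'r. A $ \<kappa> $ \<mu>)"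
      by (intro bounded_linear_intros bounded_linear_compose[OF bounded_linear_vec_nth bounded_linear_vec_nth])
    have "J (\<lambda>_. 1) g t $ \<kappa> $ \<mu> = J (\<lambda>_. 1) (\<lambda>z. g z $ \<kappa> $ \<mu>) t"
      by (rule J_linear[OF bl C1D(3)[OF C1_g] continuous_on_const t, symmetric])
    also have "\<dots> = (LINT x:fiber D t|lborel. g (t, x) $ \<kappa> $ \<mu>)"
      unfolding J_def set_lebesgue_integral_def
      by (intro Bochner_Integration.integral_cong) (auto simp: cut_def fiber_def indicator_def)
    also have "\<dots> = (LINT x:fiber D t|lborel.
      (\<Sum>i\<in>UNIV. \<Sum>j\<in>UNIV. axis \<kappa> 1 $ i * axis \<mu> 1 $ j * g (t, x) $ i $ j))"
    proof -
      have "(\<Sum>i\<in>UNIV. \<Sum>j\<in>UNIV. axis \<kappa> 1 $ i * axis \<mu> 1 $ j * A $ i $ j) = A $ \<kappa> $ \<mu>" for A :: "real^'r^'r"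
      proof -
        have "(\<Sum>j\<in>UNIV. axis \<kappa> 1 $ i * axis \<mu> 1 $ j * A $ i $ j) = (if i = \<kappa> then A $ i $ \<mu> else 0)" for i
        proof -
          have "(\<Sum>j\<in>UNIV. axis \<kappa> 1 $ i * axis \<mu> 1 $ j * A $ i $ j) =
              (\<Sum>j\<in>UNIV. if j = \<mu> then axis \<kappa> 1 $ i * A $ i $ j else 0)"
            by (intro sum.cong) (auto simp: axis_def)
          then show ?thesis by (simp add: axis_def)
        qed
        then show ?thesis by simp
      qed
      then show ?thesis by simp
    qed
    finally show ?thesis .
  qed
  then show ?thesis by (simp add: vec_eq_iff)
qed

end

section \<open>From the local result on balls to the statement over the whole base\<close>

theorem theorem1p6:
  fixes U\<^sub>0 :: "(real ^ 'n) set"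
    and D W W' :: "((real ^ 'n) \<times> (real ^ 'm)) set"
    and gF :: "(real ^ 'n) \<times> (real ^ 'm) \<Rightarrow> real ^ 'r ^ 'r"
  assumes "open U\<^sub>0" and "connected U\<^sub>0"
    and "strictly_convex_family U\<^sub>0 D"
    and "\<And>t. t \<in> U\<^sub>0 \<Longrightarrow> connected (fiber D t)"
    and "closure_neighborhood U\<^sub>0 D W"
    and "riemannian_metric_on W gF"
    and "closure_neighborhood U\<^sub>0 D W'" and "W' \<subseteq> W"
    and "nakano_positive_on W' gF"
  shows "riemannian_metric_on U\<^sub>0 (direct_image_metric D gF) \<and>
    nakano_strictly_positive_on U\<^sub>0 (direct_image_metric D gF)"
proof -
  obtain \<rho> V where bdf: "bounded_domain_family U\<^sub>0 D" and df: "defining_function U\<^sub>0 D \<rho>"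
    and V: "closure_neighborhood U\<^sub>0 D V" "V \<subseteq> U\<^sub>0 \<times> UNIV" "\<And>s. s \<in> V \<Longrightarrow> hessian_pos_def \<rho> s"
    using assms(3) unfolding strictly_convex_family_def by blast
  obtain \<rho>1 \<rho>2 where rho: "C2_partials (U\<^sub>0 \<times> UNIV) \<rho> \<rho>1 \<rho>2"
    using df unfolding defining_function_def C2_on_iff_partials by blast
  have D: "D = {(t, x). t \<in> U\<^sub>0 \<and> \<rho> (t, x) < 0}" using df by (simp add: defining_function_def)
  have oS: "open (U\<^sub>0 \<times> (UNIV :: (real^'m) set))" using assms(1) by (intro open_Times) auto
  interpret convex_family U\<^sub>0 D \<rho> \<rho>1 \<rho>2
  proof
    show "open U\<^sub>0" by fact
    show "open D" "D \<subseteq> U\<^sub>0 \<times> UNIV" using bdf by (auto simp: bounded_domain_family_def)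
    show "C2_partials (U\<^sub>0 \<times> UNIV) \<rho> \<rho>1 \<rho>2" by fact
    show "z \<in> D \<longleftrightarrow> \<rho> z < 0" if "z \<in> U\<^sub>0 \<times> UNIV" for z using that unfolding D by auto
    fix t assume t: "t \<in> U\<^sub>0"
    show "connected (fiber D t)" using assms(4)[OF t] .
    show "bounded (fiber D t)" using bdf t by (simp add: bounded_domain_family_def)
    have "t \<in> fst ` D" using bdf t by (simp add: bounded_domain_family_def)
    then show "fiber D t \<noteq> {}" by (auto simp: fiber_def)
    fix x assume x: "x \<in> frontier (fiber D t)"
    show "\<exists>e\<in>Basis. \<rho>1 (0, e) (t, x) \<noteq> 0"
    proof (rule ccontr)
      assume "\<not> (\<exists>e\<in>Basis. \<rho>1 (0, e) (t, x) \<noteq> 0)"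
      then have z: "\<rho>1 (0, e) (t, x) = 0" if "e \<in> Basis" for e using that by blast
      have "((\<lambda>y. (t, y)) has_derivative (\<lambda>h. (0, h))) (at x)" by (intro derivative_intros)
      moreover have "(t, x) \<in> U\<^sub>0 \<times> UNIV" using t by simp
      ultimately have "((\<lambda>y. \<rho> (t, y)) has_derivative (\<lambda>h. \<Sum>j\<in>Basis. ((0, h) \<bullet> j) *\<^sub>R \<rho>1 j (t, x))) (at x)"
        using has_derivative_compose[OF _ C2_partialsD(1)[OF rho]] by blast
      then have "((\<lambda>y. \<rho> (t, y)) has_derivative (\<lambda>_. 0)) (at x)"
        by (simp add: sum_Basis_Pair z)
      then have "frechet_derivative (\<lambda>y. \<rho> (t, y)) (at x) = (\<lambda>_. 0)"
        by (rule frechet_derivative_at[symmetric])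
      then show False using df t x by (auto simp: defining_function_def)
    qed
  next
    fix z and v :: "(real^'n) \<times> (real^'m)"
    assume z: "z \<in> closure D \<inter> (U\<^sub>0 \<times> UNIV)" and v: "v \<noteq> 0"
    then have zS: "z \<in> U\<^sub>0 \<times> UNIV" and zV: "z \<in> V" using V(1) by (auto simp: closure_neighborhood_def)
    have pd: "partial_deriv k (partial_deriv j \<rho>) z = \<rho>2 j k z" if j: "j \<in> Basis" and k: "k \<in> Basis" for j k
    proof -
      have "partial_deriv k (partial_deriv j \<rho>) z = partial_deriv k (\<rho>1 j) z"
        by (rule partial_deriv_cong_open[OF oS zS])
          (rule partial_deriv_eq[where p = "\<lambda>j. \<rho>1 j _", OF C2_partialsD(1)[OF rho] j])
      also have "\<dots> = \<rho>2 j k z"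
        by (rule partial_deriv_eq[where p = "\<lambda>k. \<rho>2 j k z", OF C2_partialsD(2)[OF rho zS j] k])
      finally show ?thesis .
    qed
    show "(\<Sum>j\<in>Basis. \<Sum>k\<in>Basis. (v \<bullet> j) * (v \<bullet> k) * \<rho>2 j k z) > 0"
      using V(3)[OF zV, unfolded hessian_pos_def_def, rule_format, OF v] by (simp add: pd)
  qed
  obtain g1 g2 where gW: "C2_partials W gF g1 g2"
    using assms(6) unfolding riemannian_metric_on_def C2_on_iff_partials by blast
  have oW: "open W" "open W'" and DcW: "Dc \<subseteq> W'" using assms(5,7) by (auto simp: closure_neighborhood_def)
  have posW: "pos_def (gF z)" if "z \<in> W" for z
    using assms(6) that by (auto simp: riemannian_metric_on_def pos_def_def)
  have gN: "nakano_ge Basis (gF z) (\<lambda>j. g1 j z) (\<lambda>j k. g2 j k z) 0" if z: "z \<in> W'" for z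
    unfolding nakano_ge_def
  proof (intro allI impI)
    fix u w assume w: "gF z *v w = (\<Sum>j\<in>Basis. g1 j z *v u j)"
    have zW: "z \<in> W" using z assms(8) by blast
    have "nakano_form gF z u = (gF z *v w) \<bullet> w - (\<Sum>j\<in>Basis. \<Sum>k\<in>Basis. (g2 j k z *v u j) \<bullet> u k)"
      by (rule nakano_form_eq[OF gW oW(1) zW posW w])
    \<comment> \<open>The positivity hypothesis speaks only of u not vanishing on
      \<open>Basis\<close>; otherwise the form is 0.\<close>
    moreover have "nakano_form gF z u \<ge> 0"
    proof (cases "\<exists>j\<in>Basis. u j \<noteq> 0")
      case True
      then show ?thesis using assms(9) z by (auto simp: nakano_positive_on_def)
    next
      case False
      then show ?thesis by (simp add: nakano_form_def mv.zero_right)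
    qed
    ultimately show "(\<Sum>j\<in>Basis. \<Sum>k\<in>Basis. (g2 j k z *v u j) \<bullet> u k) + 0 * (\<Sum>j\<in>Basis. (norm (u j))\<^sup>2) \<le> (gF z *v w) \<bullet> w"
      by simp
  qed
  \<comment> \<open>Near t0 the fibres are uniformly bounded; the closed ball provides compactness,
    the open ball differentiability. \<kappa> may depend on t, since strict positivity is a
    pointwise condition.\<close>
  have local: "\<exists>B p q. open B \<and> t0 \<in> B \<and> C2_partials B (direct_image_metric D gF) p q \<and>
      (\<forall>t\<in>B. pos_def (direct_image_metric D gF t) \<and>
        (\<exists>\<kappa>>0. nakano_ge Basis (direct_image_metric D gF t) (\<lambda>j. p j t) (\<lambda>j k. q j k t) \<kappa>))"
    if t0: "t0 \<in> U\<^sub>0" for t0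
  proof -
    obtain \<delta> R where \<delta>: "\<delta> > 0" "cball t0 \<delta> \<subseteq> U\<^sub>0"
      "\<And>t x. t \<in> cball t0 \<delta> \<Longrightarrow> x \<in> fiber D t \<Longrightarrow> norm x < R"
      by (rule locally_bounded[OF t0]) blast
    interpret L: nakano_family_over U\<^sub>0 D \<rho> \<rho>1 \<rho>2 "cball t0 \<delta>" R W' gF g1 g2
    proof
      show "compact (cball t0 \<delta>)" by (rule compact_cball)
      show "cball t0 \<delta> \<subseteq> U\<^sub>0" by fact
      show "norm x < R" if "t \<in> cball t0 \<delta>" "x \<in> fiber D t" for t x using \<delta>(3) that .
      show "C2_partials W' gF g1 g2" by (rule C2_partials_subset[OF gW assms(8)])
      show "open W'" "Dc \<subseteq> W'" by fact+
      show "pos_def (gF z)" if "z \<in> W'" for z using posW assms(8) that by blast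
      show "nakano_ge Basis (gF z) (\<lambda>j. g1 j z) (\<lambda>j k. g2 j k z) 0" if "z \<in> D" for z
        using gN DcW D_sub_Dc that by blast
    qed
    have eq: "L.J (\<lambda>_. 1) gF t = direct_image_metric D gF t" if "t \<in> ball t0 \<delta>" for t
      unfolding direct_image_metric_def direct_image_inner_def
      by (rule L.direct_image_metric_eq) (use that in auto)
    obtain p q where pq: "C2_partials (ball t0 \<delta>) (L.J (\<lambda>_. 1) gF) p q"
      "\<And>t. t \<in> ball t0 \<delta> \<Longrightarrow> \<exists>\<kappa>>0. nakano_ge Basis (L.J (\<lambda>_. 1) gF t) (\<lambda>j. p j t) (\<lambda>j k. q j k t) \<kappa>"
      using L.direct_image_local[OF open_ball convex_ball ball_subset_cball] by blast
    have "C2_partials (ball t0 \<delta>) (direct_image_metric D gF) p q"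
      by (rule C2_partials_cong[OF open_ball pq(1) eq])
    moreover have "pos_def (direct_image_metric D gF t)" if "t \<in> ball t0 \<delta>" for t
      unfolding eq[OF that, symmetric] by (rule L.pos_def_direct_image) (use that in auto)
    ultimately show ?thesis
      using pq(2) \<delta>(1) eq by (intro exI[of _ "ball t0 \<delta>"] exI[of _ p] exI[of _ q]) auto
  qed
  show ?thesis
  proof
    have "C2_on U\<^sub>0 (direct_image_metric D gF)"
    proof (rule C2_on_locally)
      fix t assume "t \<in> U\<^sub>0"
      from local[OF this] show "\<exists>T. open T \<and> t \<in> T \<and> C2_on T (direct_image_metric D gF)"
        unfolding C2_on_iff_partials by blast
    qed
    moreover have "pos_def (direct_image_metric D gF t)" if "t \<in> U\<^sub>0" for t
      using local[OF that] by blast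
    ultimately show "riemannian_metric_on U\<^sub>0 (direct_image_metric D gF)"
      unfolding riemannian_metric_on_def pos_def_def by blast
    show "nakano_strictly_positive_on U\<^sub>0 (direct_image_metric D gF)"
      unfolding nakano_strictly_positive_on_def
    proof (intro ballI allI impI)
      fix t and u :: "real^'n \<Rightarrow> real^'r" assume t: "t \<in> U\<^sub>0" and u: "\<exists>j\<in>Basis. u j \<noteq> 0"
      let ?G = "direct_image_metric D gF"
      obtain B p q where B: "open B" "t \<in> B" and pq: "C2_partials B ?G p q"
        and pos: "\<And>t. t \<in> B \<Longrightarrow> pos_def (?G t)"
        and N: "\<And>t. t \<in> B \<Longrightarrow> \<exists>\<kappa>>0. nakano_ge Basis (?G t) (\<lambda>j. p j t) (\<lambda>j k. q j k t) \<kappa>"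
        using local[OF t] by blast
      obtain \<kappa> where \<kappa>: "\<kappa> > 0" "nakano_ge Basis (?G t) (\<lambda>j. p j t) (\<lambda>j k. q j k t) \<kappa>"
        using N[OF B(2)] by blast
      define w where "w = matrix_inv (?G t) *v (\<Sum>j\<in>Basis. p j t *v u j)"
      have w: "?G t *v w = (\<Sum>j\<in>Basis. p j t *v u j)"
        unfolding w_def by (rule matrix_inv_mult_vector(1)[OF pos_def_invertible[OF pos[OF B(2)]]])
      have "nakano_form ?G t u = (?G t *v w) \<bullet> w - (\<Sum>j\<in>Basis. \<Sum>k\<in>Basis. (q j k t *v u j) \<bullet> u k)"
        by (rule nakano_form_eq[OF pq B pos w])
      moreover have "(\<Sum>j\<in>Basis. \<Sum>k\<in>Basis. (q j k t *v u j) \<bullet> u k) + \<kappa> * (\<Sum>j\<in>Basis. (norm (u j))\<^sup>2) \<le> (?G t *v w) \<bullet> w"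
        using \<kappa>(2) w unfolding nakano_ge_def by blast
      moreover have "(\<Sum>j\<in>Basis. (norm (u j))\<^sup>2) > 0"
      proof -
        obtain j where "j \<in> Basis" "u j \<noteq> 0" using u by blast
        then show ?thesis by (intro sum_pos2[of Basis j]) auto
      qed
      then have "\<kappa> * (\<Sum>j\<in>Basis. (norm (u j))\<^sup>2) > 0" using \<kappa>(1) by simp
      ultimately show "nakano_form ?G t u > 0" by linarith
    qed
  qed
qed

end
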